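(* Let $G_1$ and $G_2$ be finite groups. There exist faithful finite-dimensional complex representations $\rho_1$ of $G_1$ and $\rho_2$ of $G_2$ such that the McKay quivers satisfy $\Gamma_{\rho_1}(G_1)\cong\Gamma_{\rho_2}(G_2)$ (isomorphism of quivers) if and only if the irreducible complex representations of $G_1$ and $G_2$ have the same dimensions, counted with multiplicity (i.e. the multisets of dimensions of the irreducible complex representations, up to isomorphism, of $G_1$ and of $G_2$ are equal).
   Context: For a finite group $G$, let $\sigma_1,\dots,\sigma_r$ be a complete list of its irreducible complex representations up to isomorphism, with $\sigma_1$ trivial, and let $\rho$ be a finite-dimensional complex representation of $G$. The McKay matrix $A_\rho(G)=(a_{ij})_{i,j=1}^r$ has as entries the non-negative integers determined by $\rho\otimes\sigma_i\cong\bigoplus_{j=1}^r\sigma_j^{\oplus a_{ij}}$. The McKay quiver $\Gamma_\rho(G)$ is the quiver with vertices $v_1,\dots,v_r$ and $a_{ij}$ directed edges from $v_i$ to $v_j$. *)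

theory Defs
  imports
    "Jordan_Normal_Form.Matrix"
    "Jordan_Normal_Form.VS_Connect"
    "Graph_Theory.Digraph_Isomorphism"
    "HOL-Library.Multiset"
begin

text \<open>
  Representations are matrix representations: a representation of degree \<open>n\<close> of \<open>G\<close> is a
  homomorphism from \<open>G\<close> to \<open>GL\<^sub>n(\<complex>)\<close>. Only the values on \<open>carrier G\<close> matter. The degree is
  recovered from the value at the identity, which is the \<open>n \<times> n\<close> identity matrix; degree \<open>0\<close>
  is allowed.
\<close>

abbreviation GL :: "nat \<Rightarrow> complex mat monoid" where
  "GL n \<equiv> units_of (ring_mat TYPE(complex) n ())"

definition rep_degree :: "('a, 'm) monoid_scheme \<Rightarrow> ('a \<Rightarrow> complex mat) \<Rightarrow> nat" where
  "rep_degree G \<rho> = dim_row (\<rho> \<one>\<^bsub>G\<^esub>)"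

definition representation :: "('a, 'm) monoid_scheme \<Rightarrow> ('a \<Rightarrow> complex mat) \<Rightarrow> bool" where
  "representation G \<rho> \<longleftrightarrow> \<rho> \<in> hom G (GL (rep_degree G \<rho>))"

definition faithful_rep :: "('a, 'm) monoid_scheme \<Rightarrow> ('a \<Rightarrow> complex mat) \<Rightarrow> bool" where
  "faithful_rep G \<rho> \<longleftrightarrow> representation G \<rho> \<and> inj_on \<rho> (carrier G)"

definition rep_iso ::
  "('a, 'm) monoid_scheme \<Rightarrow> ('a \<Rightarrow> complex mat) \<Rightarrow> ('a \<Rightarrow> complex mat) \<Rightarrow> bool" where
  "rep_iso G \<rho> \<sigma> \<longleftrightarrow> rep_degree G \<rho> = rep_degree G \<sigma> \<and>
     (\<exists>P \<in> carrier (GL (rep_degree G \<rho>)). \<forall>g \<in> carrier G. P * \<rho> g = \<sigma> g * P)"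

definition invariant_subspace ::
  "('a, 'm) monoid_scheme \<Rightarrow> ('a \<Rightarrow> complex mat) \<Rightarrow> complex vec set \<Rightarrow> bool" where
  "invariant_subspace G \<rho> W \<longleftrightarrow>
     VectorSpace.subspace class_ring W (module_vec TYPE(complex) (rep_degree G \<rho>)) \<and>
     (\<forall>g \<in> carrier G. \<forall>w \<in> W. \<rho> g *\<^sub>v w \<in> W)"

definition irreducible_rep :: "('a, 'm) monoid_scheme \<Rightarrow> ('a \<Rightarrow> complex mat) \<Rightarrow> bool" where
  "irreducible_rep G \<rho> \<longleftrightarrow> representation G \<rho> \<and> rep_degree G \<rho> \<noteq> 0 \<and>
     (\<forall>W. invariant_subspace G \<rho> W \<longrightarrow>
        W = {0\<^sub>v (rep_degree G \<rho>)} \<or> W = carrier_vec (rep_degree G \<rho>))"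

definition trivial_rep :: "'a \<Rightarrow> complex mat" where
  "trivial_rep g = 1\<^sub>m 1"

definition kronecker :: "complex mat \<Rightarrow> complex mat \<Rightarrow> complex mat" where
  "kronecker A B = mat (dim_row A * dim_row B) (dim_col A * dim_col B)
     (\<lambda>(i, j). A $$ (i div dim_row B, j div dim_col B) * B $$ (i mod dim_row B, j mod dim_col B))"

definition tensor_rep ::
  "('a \<Rightarrow> complex mat) \<Rightarrow> ('a \<Rightarrow> complex mat) \<Rightarrow> 'a \<Rightarrow> complex mat" where
  "tensor_rep \<rho> \<sigma> g = kronecker (\<rho> g) (\<sigma> g)"

definition direct_sum_rep :: "('a \<Rightarrow> complex mat) list \<Rightarrow> 'a \<Rightarrow> complex mat" where
  "direct_sum_rep \<sigma>s g = diag_block_mat (map (\<lambda>\<sigma>. \<sigma> g) \<sigma>s)"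

definition complete_irreps ::
  "('a, 'm) monoid_scheme \<Rightarrow> ('a \<Rightarrow> complex mat) list \<Rightarrow> bool" where
  "complete_irreps G \<sigma>s \<longleftrightarrow>
     \<sigma>s \<noteq> [] \<and> rep_iso G (hd \<sigma>s) trivial_rep \<and>
     (\<forall>\<sigma> \<in> set \<sigma>s. irreducible_rep G \<sigma>) \<and>
     (\<forall>i < length \<sigma>s. \<forall>j < length \<sigma>s. rep_iso G (\<sigma>s ! i) (\<sigma>s ! j) \<longrightarrow> i = j) \<and>
     (\<forall>\<sigma>. irreducible_rep G \<sigma> \<longrightarrow> (\<exists>\<tau> \<in> set \<sigma>s. rep_iso G \<sigma> \<tau>))"

text \<open>
  A fixed choice of the list \<open>\<sigma>\<^sub>1, \<dots>, \<sigma>\<^sub>r\<close>; such a list exists for every finite group, and two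
  such lists differ only by a permutation and by isomorphisms of the entries. Indices start at
  \<open>0\<close> below.
\<close>

definition irreps :: "('a, 'm) monoid_scheme \<Rightarrow> ('a \<Rightarrow> complex mat) list" where
  "irreps G = (SOME \<sigma>s. complete_irreps G \<sigma>s)"

definition irrep_degrees :: "('a, 'm) monoid_scheme \<Rightarrow> nat multiset" where
  "irrep_degrees G = image_mset (rep_degree G) (mset (irreps G))"

definition mckay_matrix :: "('a, 'm) monoid_scheme \<Rightarrow> ('a \<Rightarrow> complex mat) \<Rightarrow> nat mat" where
  "mckay_matrix G \<rho> =
     (let \<sigma>s = irreps G; r = length \<sigma>s in
      THE A. A \<in> carrier_mat r r \<and>
        (\<forall>i < r. rep_iso G (tensor_rep \<rho> (\<sigma>s ! i))
           (direct_sum_rep (concat (map (\<lambda>j. replicate (A $$ (i, j)) (\<sigma>s ! j)) [0..<r])))))"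

text \<open>
  The arc \<open>(i, j, k)\<close> is the \<open>k\<close>-th arrow from \<open>i\<close> to \<open>j\<close>.
\<close>

definition mckay_quiver ::
  "('a, 'm) monoid_scheme \<Rightarrow> ('a \<Rightarrow> complex mat) \<Rightarrow> (nat, nat \<times> nat \<times> nat) pre_digraph" where
  "mckay_quiver G \<rho> =
     (let r = length (irreps G) in
      \<lparr> verts = {..<r},
        arcs = {(i, j, k). i < r \<and> j < r \<and> k < mckay_matrix G \<rho> $$ (i, j)},
        tail = (\<lambda>(i, j, k). i),
        head = (\<lambda>(i, j, k). j) \<rparr>)"

end

theory Submission
  imports Defs "Jordan_Normal_Form.Spectral_Radius" "HOL-Combinatorics.List_Permutation"
begin

text \<open>
  Let \<open>d\<close> be the vector of degrees of the irreducible representations and \<open>A\<close> the McKay matrix of a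
  faithful representation \<open>\<rho>\<close> of degree \<open>n\<close>. Counting dimensions in \<open>\<rho> \<otimes> \<sigma>\<^sub>i\<close> gives \<open>A d = n d\<close>. The
  quiver is strongly connected: if \<open>\<sigma>\<^sub>j\<close> could not be reached from \<open>\<sigma>\<^sub>i\<close>, then Schur orthogonality
  would give \<open>\<Sum>\<^sub>g f(g) \<sigma>\<^sub>i(g)\<^sub>a\<^sub>b \<sigma>\<^sub>j(g\<inverse>)\<^sub>c\<^sub>d = 0\<close> for every polynomial \<open>f\<close> in the matrix coefficients of \<open>\<rho>\<close>,
  and as \<open>\<rho>\<close> is faithful the indicator function of \<open>\<one>\<close> is such a polynomial. Hence positive
  eigenvectors of \<open>A\<close> are unique up to scaling (Perron--Frobenius), and \<open>d\<close> is the one with least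
  entry \<open>1\<close>, so that it can be read off the quiver. Conversely, the McKay matrix of the regular
  representation has the entries \<open>d\<^sub>i d\<^sub>j\<close>.
\<close>

subsection \<open>Linear algebra\<close>

text \<open>The least degree is 1 because the trivial representation occurs among the irreducibles.
  So the normalisation can be read off the quiver, although nothing marks the vertex of the trivial
  representation. The degree \<open>n\<close> does not come with the quiver either: the two faithful
  representations may have different degrees, so the comparison of positive eigenvectors starts from
  two eigenvalues and must first show that they agree. Reachability rests on the meaning of an
  arrow: multiplying a coefficient of an irreducible by one of \<rho> leads only to coefficients of
  its successors, so polynomials in the coefficients of \<rho> follow paths of the quiver. In the
  converse direction the regular representation works because its character is supported at \<one>,
  where every character value is a degree. The McKay matrix is a definite description. Its existence
  needs complete reducibility with the diagonal blocks in a prescribed order, and its uniqueness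
  needs the orthogonality of characters; most of the development serves these two facts.\<close>

lemma left_inverse_dim_le:
  fixes U V :: "complex mat"
  assumes U: "U \<in> carrier_mat n k" and V: "V \<in> carrier_mat k n" and VU: "V * U = 1\<^sub>m k"
  shows "k \<le> n"
proof (rule ccontr)
  assume "\<not> k \<le> n"
  then have nk: "n < k" by simp
  \<comment> \<open>Padded to \<open>k \<times> k\<close> matrices, \<open>U\<close> and \<open>V\<close> would be inverse to each other, but \<open>U'\<close> has a zero row.\<close>
  define U' where "U' = mat k k (\<lambda>(i,j). if i < n then U $$ (i,j) else 0)"
  define V' where "V' = mat k k (\<lambda>(i,j). if j < n then V $$ (i,j) else 0)"
  have c: "U' \<in> carrier_mat k k" "V' \<in> carrier_mat k k" by (auto simp: U'_def V'_def)
  have "V' * U' = 1\<^sub>m k"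
  proof (rule eq_matI)
    fix i j assume ij: "i < dim_row (1\<^sub>m k :: complex mat)" "j < dim_col (1\<^sub>m k :: complex mat)"
    have "(V' * U') $$ (i,j) = (\<Sum>l\<in>{0..<k}. V' $$ (i,l) * U' $$ (l,j))"
      using ij c by (auto simp: scalar_prod_def)
    also have "\<dots> = (\<Sum>l\<in>{0..<n}. V' $$ (i,l) * U' $$ (l,j))"
      using nk ij by (intro sum.mono_neutral_right) (auto simp: U'_def)
    also have "\<dots> = (\<Sum>l\<in>{0..<n}. V $$ (i,l) * U $$ (l,j))"
      using nk ij by (intro sum.cong) (auto simp: U'_def V'_def)
    also have "\<dots> = (V * U) $$ (i,j)"
      using ij U V by (auto simp: scalar_prod_def)
    finally show "(V' * U') $$ (i,j) = 1\<^sub>m k $$ (i,j)" by (simp add: VU)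
  qed (use c in auto)
  then have "U' * V' = 1\<^sub>m k" using mat_mult_left_right_inverse c by blast
  moreover have "(U' * V') $$ (n,n) = 0"
    using nk by (auto simp: U'_def V'_def scalar_prod_def)
  ultimately show False using nk by simp
qed

text \<open>Irreducibility is defined through abstract subspaces of \<open>module_vec\<close>; this
  closure form is the only way in which they are accessed below.\<close>

lemma subspace_module_vec_iff:
  "VectorSpace.subspace class_ring W (module_vec TYPE(complex) n) \<longleftrightarrow>
     W \<subseteq> carrier_vec n \<and> 0\<^sub>v n \<in> W \<and> (\<forall>v\<in>W. \<forall>w\<in>W. v + w \<in> W) \<and> (\<forall>c. \<forall>v\<in>W. c \<cdot>\<^sub>v v \<in> W)"
proof -
  have "vectorspace class_ring (module_vec TYPE(complex) n)" by (rule vec_vs)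
  moreover have "Module.module class_ring (module_vec TYPE(complex) n)" by (rule vec_module)
  ultimately show ?thesis
    unfolding VectorSpace.subspace_def LinearCombinations.submodule_def module_vec_simps
    by auto
qed

text \<open>A subspace is handled as a pair of matrices: the columns of \<open>U\<close> are a
  basis, and the left inverse \<open>V\<close> computes coordinates. Restricting a representation to
  the subspace then becomes a matrix product.\<close>

lemma subspace_split:
  fixes W :: "complex vec set"
  assumes W: "VectorSpace.subspace class_ring W (module_vec TYPE(complex) n)"
  shows "\<exists>k U V. U \<in> carrier_mat n k \<and> V \<in> carrier_mat k n \<and> V * U = 1\<^sub>m k \<and>
           W = (\<lambda>x. U *\<^sub>v x) ` carrier_vec k"
proof -
  have Wc: "W \<subseteq> carrier_vec n" and W0: "0\<^sub>v n \<in> W"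
    and Wadd: "\<And>v w. v \<in> W \<Longrightarrow> w \<in> W \<Longrightarrow> v + w \<in> W"
    and Wsm: "\<And>c v. v \<in> W \<Longrightarrow> c \<cdot>\<^sub>v v \<in> W"
    using W unfolding subspace_module_vec_iff by auto
  define P where "P k \<longleftrightarrow> (\<exists>U V. U \<in> carrier_mat n k \<and> V \<in> carrier_mat k n \<and> V * U = 1\<^sub>m k \<and>
           (\<lambda>x. U *\<^sub>v x) ` carrier_vec k \<subseteq> W)" for k
  have P0: "P 0" unfolding P_def
  proof (intro exI conjI)
    show "0\<^sub>m n 0 \<in> carrier_mat n 0" "0\<^sub>m 0 n \<in> carrier_mat 0 n" by auto
    show "0\<^sub>m 0 n * 0\<^sub>m n 0 = (1\<^sub>m 0 :: complex mat)" by auto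
    show "(\<lambda>x. 0\<^sub>m n 0 *\<^sub>v x) ` carrier_vec 0 \<subseteq> W"
    proof safe
      fix x :: "complex vec" assume "x \<in> carrier_vec 0"
      then have "0\<^sub>m n 0 *\<^sub>v x = 0\<^sub>v n" by (intro eq_vecI) (auto simp: scalar_prod_def)
      then show "0\<^sub>m n 0 *\<^sub>v x \<in> W" using W0 by simp
    qed
  qed
  have bound: "k \<le> n" if "P k" for k using that left_inverse_dim_le unfolding P_def by blast
  \<comment> \<open>For the largest \<open>k\<close>, the columns of \<open>U\<close> span \<open>W\<close>: a vector of \<open>W\<close> outside their span could be
    reduced modulo it and appended to \<open>U\<close> as a further column.\<close>
  define k where "k = (GREATEST k. P k)"
  have Pk: "P k" unfolding k_def using GreatestI_nat[of P 0 n] P0 bound by blast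
  have max: "\<not> P (Suc k)"
    using Greatest_le_nat[of P "Suc k" n] bound unfolding k_def by fastforce
  obtain U V where U: "U \<in> carrier_mat n k" and V: "V \<in> carrier_mat k n" and VU: "V * U = 1\<^sub>m k"
    and sub: "(\<lambda>x. U *\<^sub>v x) ` carrier_vec k \<subseteq> W" using Pk unfolding P_def by blast
  have "W \<subseteq> (\<lambda>x. U *\<^sub>v x) ` carrier_vec k"
  proof (rule ccontr)
    assume "\<not> ?thesis"
    then obtain w0 where w0: "w0 \<in> W" "w0 \<notin> (\<lambda>x. U *\<^sub>v x) ` carrier_vec k" by auto
    have w0c: "w0 \<in> carrier_vec n" using w0 Wc by auto
    have Vw0: "V *\<^sub>v w0 \<in> carrier_vec k" using V w0c by auto
    \<comment> \<open>Removing the component \<open>U V w0\<close> keeps the vector in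
      \<open>W\<close>, makes \<open>V\<close> annihilate it, and leaves it nonzero because
      \<open>w0\<close> is outside the range of \<open>U\<close>.\<close>
    define w where "w = w0 + (-1) \<cdot>\<^sub>v (U *\<^sub>v (V *\<^sub>v w0))"
    have wW: "w \<in> W" unfolding w_def using w0 sub Vw0 by (intro Wadd Wsm) auto
    have wc: "w \<in> carrier_vec n" using wW Wc by auto
    have "w \<noteq> 0\<^sub>v n"
    proof
      assume w: "w = 0\<^sub>v n"
      have "w0 = U *\<^sub>v (V *\<^sub>v w0)"
      proof (rule eq_vecI)
        fix i assume i: "i < dim_vec (U *\<^sub>v (V *\<^sub>v w0))"
        then have "w $ i = 0" using w U by auto
        then show "w0 $ i = (U *\<^sub>v (V *\<^sub>v w0)) $ i" using i U w0c unfolding w_def by auto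
      qed (use U w0c in auto)
      then show False using w0 Vw0 by auto
    qed
    then obtain p where p: "p < n" "w $ p \<noteq> 0"
      using wc by (metis carrier_vecD eq_vecI index_zero_vec(1,2))
    have Vw: "V *\<^sub>v w = 0\<^sub>v k"
    proof -
      have "V *\<^sub>v w = V *\<^sub>v w0 + (-1) \<cdot>\<^sub>v (V *\<^sub>v (U *\<^sub>v (V *\<^sub>v w0)))"
        unfolding w_def using V U w0c Vw0
        by (subst mult_add_distrib_mat_vec[of _ k n]) (auto simp: mult_mat_vec[of _ k n])
      also have "V *\<^sub>v (U *\<^sub>v (V *\<^sub>v w0)) = V *\<^sub>v w0"
        using V U Vw0 by (subst assoc_mult_mat_vec[symmetric, of _ k n _ k]) (auto simp: VU)
      finally show ?thesis using V w0c by auto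
    qed
    \<comment> \<open>The new row of the left inverse: row \<open>p\<close> of
      \<open>1 - U V\<close>, scaled by the nonzero entry \<open>w $ p\<close>. It kills
      \<open>U\<close> since \<open>(1 - U V) U = 0\<close>, and it sends \<open>w\<close> to 1
      since \<open>V w = 0\<close>.\<close>
    define r where "r = mat 1 n (\<lambda>(i,j). (1\<^sub>m n - U * V) $$ (p,j) / w $ p)"
    define wm where "wm = mat n 1 (\<lambda>(i,j). w $ i)"
    have rU: "r * U = 0\<^sub>m 1 k"
    proof (rule eq_matI)
      fix i j assume ij: "i < dim_row (0\<^sub>m 1 k :: complex mat)" "j < dim_col (0\<^sub>m 1 k :: complex mat)"
      have "(1\<^sub>m n - U * V) * U = 0\<^sub>m n k"
        using U V VU by (subst minus_mult_distrib_mat[of _ n n]) (auto simp: assoc_mult_mat[of U n k V n U k])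
      then have "((1\<^sub>m n - U * V) * U) $$ (p,j) = 0" using p ij by simp
      moreover have "(r * U) $$ (i,j) = ((1\<^sub>m n - U * V) * U) $$ (p,j) / w $ p"
        using p ij U V unfolding r_def by (auto simp: scalar_prod_def sum_divide_distrib)
      ultimately show "(r * U) $$ (i,j) = 0\<^sub>m 1 k $$ (i,j)" using ij by simp
    qed (use U in \<open>auto simp: r_def\<close>)
    have rw: "r * wm = 1\<^sub>m 1"
    proof (rule eq_matI)
      fix i j assume ij: "i < dim_row (1\<^sub>m 1 :: complex mat)" "j < dim_col (1\<^sub>m 1 :: complex mat)"
      have "(1\<^sub>m n - U * V) *\<^sub>v w = w - U *\<^sub>v (V *\<^sub>v w)"
        using U V wc by (subst minus_mult_distrib_mat_vec[of _ n n]) auto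
      also have "\<dots> = w" using U wc unfolding Vw by auto
      finally have "((1\<^sub>m n - U * V) *\<^sub>v w) $ p = w $ p" by simp
      moreover have "(r * wm) $$ (i,j) = ((1\<^sub>m n - U * V) *\<^sub>v w) $ p / w $ p"
        using p ij U V wc unfolding r_def wm_def by (auto simp: scalar_prod_def sum_divide_distrib)
      ultimately show "(r * wm) $$ (i,j) = 1\<^sub>m 1 $$ (i,j)" using ij p by simp
    qed (auto simp: r_def wm_def)
    have Vwm: "V * wm = 0\<^sub>m k 1"
    proof (rule eq_matI)
      fix i j assume ij: "i < dim_row (0\<^sub>m k 1 :: complex mat)" "j < dim_col (0\<^sub>m k 1 :: complex mat)"
      have "(V * wm) $$ (i,j) = (V *\<^sub>v w) $ i"
        using ij V wc unfolding wm_def by (auto simp: scalar_prod_def)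
      then show "(V * wm) $$ (i,j) = 0\<^sub>m k 1 $$ (i,j)" using ij Vw by simp
    qed (use V in \<open>auto simp: wm_def\<close>)
    \<comment> \<open>The blocks without rows or columns turn \<open>four_block_mat\<close> into
      appending a column to \<open>U\<close> and a row to \<open>V\<close>, so that its
      multiplication rule applies.\<close>
    define U' where "U' = four_block_mat U wm (0\<^sub>m 0 k) (0\<^sub>m 0 1)"
    define V' where "V' = four_block_mat V (0\<^sub>m k 0) r (0\<^sub>m 1 0)"
    have U': "U' \<in> carrier_mat n (Suc k)" and V': "V' \<in> carrier_mat (Suc k) n"
      using U V unfolding U'_def V'_def by (auto simp: wm_def r_def)
    have "V' * U' = four_block_mat (V * U + 0\<^sub>m k 0 * 0\<^sub>m 0 k) (V * wm + 0\<^sub>m k 0 * 0\<^sub>m 0 1)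
                      (r * U + 0\<^sub>m 1 0 * 0\<^sub>m 0 k) (r * wm + 0\<^sub>m 1 0 * 0\<^sub>m 0 1)"
      unfolding U'_def V'_def
      by (rule mult_four_block_mat) (use U V in \<open>auto simp: r_def wm_def\<close>)
    also have "\<dots> = four_block_mat (1\<^sub>m k) (0\<^sub>m k 1) (0\<^sub>m 1 k) (1\<^sub>m 1)"
      unfolding VU Vwm rU rw by (intro cong_four_block_mat) auto
    also have "\<dots> = 1\<^sub>m (Suc k)" by simp
    finally have V'U': "V' * U' = 1\<^sub>m (Suc k)" .
    have "(\<lambda>x. U' *\<^sub>v x) ` carrier_vec (Suc k) \<subseteq> W"
    proof safe
      fix x :: "complex vec" assume x: "x \<in> carrier_vec (Suc k)"
      have "U' *\<^sub>v x = U *\<^sub>v vec k (\<lambda>i. x $ i) + (x $ k) \<cdot>\<^sub>v w"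
        using U U' wc x
        by (intro eq_vecI) (auto simp: U'_def wm_def scalar_prod_def intro!: sum.cong)
      also have "\<dots> \<in> W" using wW sub by (intro Wadd Wsm) auto
      finally show "U' *\<^sub>v x \<in> W" .
    qed
    then have "P (Suc k)" unfolding P_def using U' V' V'U' by blast
    then show False using max by simp
  qed
  then show ?thesis using U V VU sub by blast
qed

lemma mat_eq_mult_vecI:
  fixes A B :: "complex mat"
  assumes A: "A \<in> carrier_mat n m" and B: "B \<in> carrier_mat n m"
    and eq: "\<And>x. x \<in> carrier_vec m \<Longrightarrow> A *\<^sub>v x = B *\<^sub>v x"
  shows "A = B"
proof (rule eq_matI)
  fix i j assume ij: "i < dim_row B" "j < dim_col B"
  have "(A *\<^sub>v unit_vec m j) $ i = (B *\<^sub>v unit_vec m j) $ i" using eq by simp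
  then show "A $$ (i,j) = B $$ (i,j)" using ij A B by simp
qed (use A B in auto)

text \<open>Column \<open>j\<close> of \<open>Y\<close> is a preimage under \<open>B\<close> of
  column \<open>j\<close> of \<open>A\<close>, which is the image of a unit vector.\<close>

lemma mat_factor_range:
  fixes A B :: "complex mat"
  assumes A: "A \<in> carrier_mat n a" and B: "B \<in> carrier_mat n b"
    and sub: "(\<lambda>x. A *\<^sub>v x) ` carrier_vec a \<subseteq> (\<lambda>x. B *\<^sub>v x) ` carrier_vec b"
  shows "\<exists>Y \<in> carrier_mat b a. A = B * Y"
proof -
  have "\<exists>y. y \<in> carrier_vec b \<and> col A j = B *\<^sub>v y" if "j < a" for j
  proof -
    have "col A j = A *\<^sub>v unit_vec a j"
      using A that by (intro eq_vecI) auto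
    then show ?thesis using sub that by (metis (no_types, lifting) image_iff subsetD unit_vec_carrier)
  qed
  then obtain y where y: "\<And>j. j < a \<Longrightarrow> y j \<in> carrier_vec b \<and> col A j = B *\<^sub>v y j" by metis
  define Y where "Y = mat b a (\<lambda>(i,j). y j $ i)"
  have "A = B * Y"
  proof (rule eq_matI)
    fix i j assume ij: "i < dim_row (B * Y)" "j < dim_col (B * Y)"
    then have "A $$ (i,j) = col A j $ i" using A B by (auto simp: Y_def)
    also have "\<dots> = (B *\<^sub>v y j) $ i" using y ij by (auto simp: Y_def)
    also have "\<dots> = (B * Y) $$ (i,j)"
      using ij B y[of j] by (auto simp: Y_def scalar_prod_def)
    finally show "A $$ (i,j) = (B * Y) $$ (i,j)" .
  qed (use A B in \<open>auto simp: Y_def\<close>)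
  then show ?thesis by (intro bexI[of _ Y]) (auto simp: Y_def)
qed

lemma subspace_range:
  fixes A :: "complex mat"
  assumes A: "A \<in> carrier_mat n m"
  shows "VectorSpace.subspace class_ring ((\<lambda>x. A *\<^sub>v x) ` carrier_vec m) (module_vec TYPE(complex) n)"
  unfolding subspace_module_vec_iff
proof (intro conjI ballI allI)
  show "(\<lambda>x. A *\<^sub>v x) ` carrier_vec m \<subseteq> carrier_vec n" using A by auto
  show "0\<^sub>v n \<in> (\<lambda>x. A *\<^sub>v x) ` carrier_vec m"
    using A by (intro image_eqI[of _ _ "0\<^sub>v m"]) auto
next
  fix v w assume "v \<in> (\<lambda>x. A *\<^sub>v x) ` carrier_vec m" "w \<in> (\<lambda>x. A *\<^sub>v x) ` carrier_vec m"
  then obtain x y where "x \<in> carrier_vec m" "y \<in> carrier_vec m" "v = A *\<^sub>v x" "w = A *\<^sub>v y" by auto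
  then show "v + w \<in> (\<lambda>x. A *\<^sub>v x) ` carrier_vec m"
    using A by (intro image_eqI[of _ _ "x + y"]) (auto simp: mult_add_distrib_mat_vec)
next
  fix c v assume "v \<in> (\<lambda>x. A *\<^sub>v x) ` carrier_vec m"
  then obtain x where "x \<in> carrier_vec m" "v = A *\<^sub>v x" by auto
  then show "c \<cdot>\<^sub>v v \<in> (\<lambda>x. A *\<^sub>v x) ` carrier_vec m"
    using A by (intro image_eqI[of _ _ "c \<cdot>\<^sub>v x"]) (auto simp: mult_mat_vec)
qed

lemma subspace_kernel:
  fixes A :: "complex mat"
  assumes A: "A \<in> carrier_mat n m"
  shows "VectorSpace.subspace class_ring {x \<in> carrier_vec m. A *\<^sub>v x = 0\<^sub>v n} (module_vec TYPE(complex) m)"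
  unfolding subspace_module_vec_iff
  using A by (auto simp: mult_add_distrib_mat_vec mult_mat_vec)

lemma surjective_right_inverse:
  fixes T :: "complex mat"
  assumes T: "T \<in> carrier_mat m n" and surj: "(\<lambda>x. T *\<^sub>v x) ` carrier_vec n = carrier_vec m"
  shows "\<exists>Y \<in> carrier_mat n m. T * Y = 1\<^sub>m m"
proof -
  have "(\<lambda>x. 1\<^sub>m m *\<^sub>v x) ` carrier_vec m \<subseteq> (\<lambda>x. T *\<^sub>v x) ` carrier_vec n"
    unfolding surj by auto
  from mat_factor_range[OF _ T this] show ?thesis by (metis one_carrier_mat)
qed

text \<open>With \<open>U\<close> a basis matrix of the range of \<open>T\<close>, write
  \<open>T = U X\<close> and \<open>U = T Y\<close>. Then \<open>T (Y X) = T\<close>, so injectivity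
  gives \<open>Y X = 1\<close>; as \<open>V T = X\<close>, the matrix \<open>Y V\<close> is a left
  inverse.\<close>

lemma injective_left_inverse:
  fixes T :: "complex mat"
  assumes T: "T \<in> carrier_mat m n"
    and inj: "\<And>x. x \<in> carrier_vec n \<Longrightarrow> T *\<^sub>v x = 0\<^sub>v m \<Longrightarrow> x = 0\<^sub>v n"
  shows "\<exists>L \<in> carrier_mat n m. L * T = 1\<^sub>m n"
proof -
  obtain k U V where U: "U \<in> carrier_mat m k" and V: "V \<in> carrier_mat k m" and VU: "V * U = 1\<^sub>m k"
    and R: "(\<lambda>x. T *\<^sub>v x) ` carrier_vec n = (\<lambda>x. U *\<^sub>v x) ` carrier_vec k"
    using subspace_split[OF subspace_range[OF T]] by blast
  obtain X where X: "X \<in> carrier_mat k n" and TX: "T = U * X"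
    using mat_factor_range[OF T U] R by auto
  obtain Y where Y: "Y \<in> carrier_mat n k" and UY: "U = T * Y"
    using mat_factor_range[OF U T] R by auto
  have "V * T = X"
    unfolding TX using U V X VU by (subst assoc_mult_mat[symmetric, of _ k m _ k _ n]) auto
  have "Y * X = 1\<^sub>m n"
  proof (rule mat_eq_mult_vecI)
    fix x :: "complex vec" assume x: "x \<in> carrier_vec n"
    have Yx: "(Y * X) *\<^sub>v x \<in> carrier_vec n" using X Y x by (metis mult_carrier_mat mult_mat_vec_carrier)
    have "T * (Y * X) = T"
      using T X Y U UY TX by (metis assoc_mult_mat)
    then have "T *\<^sub>v ((Y * X) *\<^sub>v x) = T *\<^sub>v x"
      using T X Y x by (metis assoc_mult_mat_vec mult_carrier_mat)
    then have "T *\<^sub>v ((Y * X) *\<^sub>v x - x) = 0\<^sub>v m"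
      using T Yx x by (subst mult_minus_distrib_mat_vec[of _ m n]) auto
    then have z: "(Y * X) *\<^sub>v x - x = 0\<^sub>v n" using inj Yx x by auto
    show "Y * X *\<^sub>v x = 1\<^sub>m n *\<^sub>v x"
    proof (rule eq_vecI)
      fix i assume "i < dim_vec (1\<^sub>m n *\<^sub>v x)"
      then have "((Y * X) *\<^sub>v x - x) $ i = 0" "i < n" using z by auto
      then show "(Y * X *\<^sub>v x) $ i = (1\<^sub>m n *\<^sub>v x) $ i" using x Yx by auto
    qed (use x Y in auto)
  qed (use X Y in auto)
  then have "(Y * V) * T = 1\<^sub>m n"
    using Y V T \<open>V * T = X\<close> by (subst assoc_mult_mat[of _ n k _ m _ n]) auto
  then show ?thesis using Y V by (intro bexI[of _ "Y * V"]) auto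
qed

section \<open>Finite sums and traces of matrices\<close>

definition mat_sum :: "nat \<Rightarrow> nat \<Rightarrow> ('i \<Rightarrow> complex mat) \<Rightarrow> 'i set \<Rightarrow> complex mat" where
  "mat_sum n m F S = mat n m (\<lambda>ij. \<Sum>x\<in>S. F x $$ ij)"

lemma mat_sum_carrier[simp]: "mat_sum n m F S \<in> carrier_mat n m"
  by (simp add: mat_sum_def)

lemma index_mat_sum[simp]: "i < n \<Longrightarrow> j < m \<Longrightarrow> mat_sum n m F S $$ (i,j) = (\<Sum>x\<in>S. F x $$ (i,j))"
  by (simp add: mat_sum_def)

lemma dim_mat_sum[simp]: "dim_row (mat_sum n m F S) = n" "dim_col (mat_sum n m F S) = m"
  by (auto simp: mat_sum_def)

lemma mult_mat_sum:
  assumes "A \<in> carrier_mat l n" and "\<And>x. x \<in> S \<Longrightarrow> F x \<in> carrier_mat n m"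
  shows "A * mat_sum n m F S = mat_sum l m (\<lambda>x. A * F x) S"
proof (rule eq_matI)
  fix i j assume ij: "i < dim_row (mat_sum l m (\<lambda>x. A * F x) S)" "j < dim_col (mat_sum l m (\<lambda>x. A * F x) S)"
  have "(A * mat_sum n m F S) $$ (i,j) = (\<Sum>k\<in>{0..<n}. \<Sum>x\<in>S. A $$ (i,k) * F x $$ (k,j))"
    using ij assms by (auto simp: scalar_prod_def sum_distrib_left)
  also have "\<dots> = (\<Sum>x\<in>S. \<Sum>k\<in>{0..<n}. A $$ (i,k) * F x $$ (k,j))" by (rule sum.swap)
  also have "\<dots> = (\<Sum>x\<in>S. (A * F x) $$ (i,j))"
    using assms ij by (intro sum.cong) (auto simp: scalar_prod_def dest!: assms(2))
  finally show "(A * mat_sum n m F S) $$ (i,j) = mat_sum l m (\<lambda>x. A * F x) S $$ (i,j)"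
    using ij by simp
qed (use assms in auto)

lemma mat_sum_mult:
  assumes "A \<in> carrier_mat m l" and "\<And>x. x \<in> S \<Longrightarrow> F x \<in> carrier_mat n m"
  shows "mat_sum n m F S * A = mat_sum n l (\<lambda>x. F x * A) S"
proof (rule eq_matI)
  fix i j assume ij: "i < dim_row (mat_sum n l (\<lambda>x. F x * A) S)" "j < dim_col (mat_sum n l (\<lambda>x. F x * A) S)"
  have "(mat_sum n m F S * A) $$ (i,j) = (\<Sum>k\<in>{0..<m}. \<Sum>x\<in>S. F x $$ (i,k) * A $$ (k,j))"
    using ij assms by (auto simp: scalar_prod_def sum_distrib_right)
  also have "\<dots> = (\<Sum>x\<in>S. \<Sum>k\<in>{0..<m}. F x $$ (i,k) * A $$ (k,j))" by (rule sum.swap)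
  also have "\<dots> = (\<Sum>x\<in>S. (F x * A) $$ (i,j))"
    using assms ij by (intro sum.cong) (auto simp: scalar_prod_def dest!: assms(2))
  finally show "(mat_sum n m F S * A) $$ (i,j) = mat_sum n l (\<lambda>x. F x * A) S $$ (i,j)"
    using ij by simp
qed (use assms in auto)

lemma mat_sum_cong: "(\<And>x. x \<in> S \<Longrightarrow> F x = F' x) \<Longrightarrow> mat_sum n m F S = mat_sum n m F' S"
  by (auto simp: mat_sum_def intro!: sum.cong)

lemma mat_sum_reindex_bij_betw:
  "bij_betw h S T \<Longrightarrow> mat_sum n m (\<lambda>x. F (h x)) S = mat_sum n m F T"
  unfolding mat_sum_def by (intro cong_mat) (auto intro!: sum.reindex_bij_betw)

lemma mat_sum_const:
  "A \<in> carrier_mat n m \<Longrightarrow> mat_sum n m (\<lambda>x. A) S = of_nat (card S) \<cdot>\<^sub>m A"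
  by (intro eq_matI) auto

definition mat_trace :: "complex mat \<Rightarrow> complex" where
  "mat_trace A = (\<Sum>i\<in>{0..<dim_row A}. A $$ (i,i))"

lemma mat_trace_mult_comm:
  assumes A: "A \<in> carrier_mat n m" and B: "B \<in> carrier_mat m n"
  shows "mat_trace (A * B) = mat_trace (B * A)"
proof -
  have "mat_trace (A * B) = (\<Sum>i\<in>{0..<n}. \<Sum>j\<in>{0..<m}. A $$ (i,j) * B $$ (j,i))"
    using A B by (auto simp: mat_trace_def scalar_prod_def)
  also have "\<dots> = (\<Sum>j\<in>{0..<m}. \<Sum>i\<in>{0..<n}. A $$ (i,j) * B $$ (j,i))" by (rule sum.swap)
  also have "\<dots> = mat_trace (B * A)"
    using A B by (auto simp: mat_trace_def scalar_prod_def mult.commute)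
  finally show ?thesis .
qed

lemma mat_trace_one[simp]: "mat_trace (1\<^sub>m n) = of_nat n"
  by (simp add: mat_trace_def)

lemma mat_trace_smult: "A \<in> carrier_mat n n \<Longrightarrow> mat_trace (c \<cdot>\<^sub>m A) = c * mat_trace A"
  by (simp add: mat_trace_def sum_distrib_left)

lemma mat_trace_mat_sum:
  assumes "\<And>x. x \<in> S \<Longrightarrow> F x \<in> carrier_mat n n"
  shows "mat_trace (mat_sum n n F S) = (\<Sum>x\<in>S. mat_trace (F x))"
proof -
  have "mat_trace (mat_sum n n F S) = (\<Sum>x\<in>S. \<Sum>i\<in>{0..<n}. F x $$ (i,i))"
    by (simp add: mat_trace_def sum.swap[of _ S])
  also have "\<dots> = (\<Sum>x\<in>S. mat_trace (F x))"
    using assms by (intro sum.cong) (auto simp: mat_trace_def dest!: assms)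
  finally show ?thesis .
qed

lemma mat_trace_similar:
  assumes A: "A \<in> carrier_mat n n" and B: "B \<in> carrier_mat n n" and P: "P \<in> carrier_mat n n"
    and Q: "Q \<in> carrier_mat n n" and QP: "Q * P = 1\<^sub>m n" and PA: "P * A = B * P"
  shows "mat_trace A = mat_trace B"
proof -
  \<comment> \<open>\<open>A = Q B P\<close>, and cyclicity of the trace moves \<open>Q\<close> to
    the right, where it cancels against \<open>P\<close>.\<close>
  have "mat_trace A = mat_trace ((Q * P) * A)" using A QP by simp
  also have "(Q * P) * A = Q * (B * P)" using assoc_mult_mat[OF Q P A] PA by simp
  also have "mat_trace (Q * (B * P)) = mat_trace ((B * P) * Q)"
    using mat_trace_mult_comm[of Q n n "B * P"] B P Q by auto
  also have "(B * P) * Q = B"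
    using assoc_mult_mat[OF B P Q] mat_mult_left_right_inverse[OF Q P QP] B by simp
  finally show ?thesis .
qed

lemma mat_trace_four_block:
  assumes "A \<in> carrier_mat n n" "D \<in> carrier_mat m m"
  shows "mat_trace (four_block_mat A B C D) = mat_trace A + mat_trace D"
proof -
  have "mat_trace (four_block_mat A B C D) =
      (\<Sum>i\<in>{0..<n+m}. if i < n then A $$ (i,i) else D $$ (i-n,i-n))"
    using assms by (auto simp: mat_trace_def intro!: sum.cong)
  also have "\<dots> = (\<Sum>i\<in>{0..<n}. A $$ (i,i)) + (\<Sum>i\<in>{n..<n+m}. D $$ (i-n,i-n))"
    by (subst sum.atLeastLessThan_concat[of 0 n "n+m", symmetric]) auto
  also have "(\<Sum>i\<in>{n..<n+m}. D $$ (i-n,i-n)) = (\<Sum>i\<in>{0..<m}. D $$ (i,i))"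
    using sum.shift_bounds_nat_ivl[of "\<lambda>i. D $$ (i-n,i-n)" 0 n m] by (simp add: add.commute)
  finally show ?thesis using assms by (simp add: mat_trace_def)
qed

section \<open>Kronecker products\<close>

lemma bij_betw_div_mod:
  fixes n m :: nat
  shows "bij_betw (\<lambda>k. (k div m, k mod m)) {0..<n*m} ({0..<n} \<times> {0..<m})"
proof (rule bij_betwI[where g = "\<lambda>(i,j). i * m + j"])
  show "(\<lambda>k. (k div m, k mod m)) \<in> {0..<n*m} \<rightarrow> {0..<n} \<times> {0..<m}"
    by (cases "m = 0") (auto simp: less_mult_imp_div_less)
  show "(\<lambda>(i,j). i * m + j) \<in> {0..<n} \<times> {0..<m} \<rightarrow> {0..<n*m}"
  proof (clarsimp)
    fix i j assume "i < n" "j < m"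
    then have "i * m + j < Suc i * m" "Suc i * m \<le> n * m" by (auto intro: mult_le_mono1 simp del: mult_Suc) simp
    then show "i * m + j < n * m" by linarith
  qed
qed auto

lemma sum_div_mod:
  fixes f :: "nat \<Rightarrow> nat \<Rightarrow> 'c::comm_monoid_add"
  shows "(\<Sum>k\<in>{0..<n*m}. f (k div m) (k mod m)) = (\<Sum>i\<in>{0..<n}. \<Sum>j\<in>{0..<m}. f i j)"
  using sum.reindex_bij_betw[OF bij_betw_div_mod[of m n], of "\<lambda>(i,j). f i j"]
  by (simp add: sum.cartesian_product)

lemma kronecker_carrier[simp]:
  "A \<in> carrier_mat n m \<Longrightarrow> B \<in> carrier_mat p q \<Longrightarrow> kronecker A B \<in> carrier_mat (n*p) (m*q)"
  by (auto simp: kronecker_def)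

text \<open>A row or column index \<open>k\<close> stands for the pair of its quotient and
  remainder. Under this bijection the sum in the matrix product becomes a double sum that factors
  into the two smaller products.\<close>

lemma kronecker_mult:
  assumes A: "A \<in> carrier_mat n m" and B: "B \<in> carrier_mat p q"
    and C: "C \<in> carrier_mat m k" and D: "D \<in> carrier_mat q l"
  shows "kronecker A B * kronecker C D = kronecker (A * C) (B * D)"
proof (rule eq_matI)
  fix i j assume "i < dim_row (kronecker (A * C) (B * D))" "j < dim_col (kronecker (A * C) (B * D))"
  then have ij: "i < n * p" "j < k * l" using assms by (auto simp: kronecker_def)
  then have "0 < p" "0 < l" by (auto intro: gr0I)
  then have b: "i div p < n" "i mod p < p" "j div l < k" "j mod l < l"
    using ij by (auto simp: less_mult_imp_div_less)
  have "(kronecker A B * kronecker C D) $$ (i,j) =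
      (\<Sum>x\<in>{0..<m*q}. (A $$ (i div p, x div q) * B $$ (i mod p, x mod q)) *
                       (C $$ (x div q, j div l) * D $$ (x mod q, j mod l)))"
    using ij assms by (auto simp: kronecker_def scalar_prod_def)
  also have "\<dots> = (\<Sum>x\<in>{0..<m}. \<Sum>y\<in>{0..<q}. (A $$ (i div p, x) * B $$ (i mod p, y)) *
                       (C $$ (x, j div l) * D $$ (y, j mod l)))"
    by (rule sum_div_mod)
  also have "\<dots> = (\<Sum>x\<in>{0..<m}. A $$ (i div p, x) * C $$ (x, j div l)) *
                 (\<Sum>y\<in>{0..<q}. B $$ (i mod p, y) * D $$ (y, j mod l))"
    by (simp add: sum_product mult_ac)
  also have "\<dots> = (A * C) $$ (i div p, j div l) * (B * D) $$ (i mod p, j mod l)"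
    using assms b by (auto simp: scalar_prod_def)
  also have "\<dots> = kronecker (A * C) (B * D) $$ (i,j)"
    using assms ij by (auto simp: kronecker_def)
  finally show "(kronecker A B * kronecker C D) $$ (i,j) = kronecker (A * C) (B * D) $$ (i,j)" .
qed (use assms in \<open>auto simp: kronecker_def\<close>)

lemma kronecker_one: "kronecker (1\<^sub>m n) (1\<^sub>m m) = 1\<^sub>m (n * m)"
proof (rule eq_matI)
  fix i j assume ij: "i < dim_row (1\<^sub>m (n*m) :: complex mat)" "j < dim_col (1\<^sub>m (n*m) :: complex mat)"
  then have "0 < m" by (auto intro: gr0I)
  moreover have "i = j \<longleftrightarrow> i div m = j div m \<and> i mod m = j mod m" by (metis div_mult_mod_eq)
  ultimately show "kronecker (1\<^sub>m n) (1\<^sub>m m) $$ (i,j) = 1\<^sub>m (n*m) $$ (i,j)"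
    using ij by (auto simp: kronecker_def less_mult_imp_div_less)
qed (auto simp: kronecker_def)

lemma mat_trace_kronecker:
  assumes A: "A \<in> carrier_mat n n" and B: "B \<in> carrier_mat m m"
  shows "mat_trace (kronecker A B) = mat_trace A * mat_trace B"
proof -
  have "mat_trace (kronecker A B) = (\<Sum>k\<in>{0..<n*m}. A $$ (k div m, k div m) * B $$ (k mod m, k mod m))"
    using assms by (auto simp: mat_trace_def kronecker_def)
  also have "\<dots> = (\<Sum>i\<in>{0..<n}. \<Sum>j\<in>{0..<m}. A $$ (i,i) * B $$ (j,j))" by (rule sum_div_mod)
  also have "\<dots> = mat_trace A * mat_trace B" using assms by (simp add: mat_trace_def sum_product)
  finally show ?thesis .
qed

lemma index_kronecker:
  assumes A: "A \<in> carrier_mat n m" and B: "B \<in> carrier_mat p q"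
    and "i < n" "j < m" "a < p" "b < q"
  shows "kronecker A B $$ (i * p + a, j * q + b) = A $$ (i,j) * B $$ (a,b)"
proof -
  have "i * p + a < n * p" "j * q + b < m * q"
    using bij_betw_div_mod[of p n] bij_betw_div_mod[of q m] assms
    by (metis add_less_cancel_left less_le_trans mult.commute mult_Suc_right Suc_leI mult_le_mono2 add.commute)+
  then show ?thesis using assms by (auto simp: kronecker_def)
qed

text \<open>The side conditions are equations between dimensions, so the simplifier can reassociate
  products without guessing the inner dimensions that \<open>assoc_mult_mat\<close> leaves
  open.\<close>

lemma mat_assoc:
  fixes A B C :: "complex mat"
  assumes "dim_col A = dim_row B" "dim_col B = dim_row C"
  shows "A * B * C = A * (B * C)"
  by (rule assoc_mult_mat[of _ "dim_row A" "dim_col A" _ "dim_col B" _ "dim_col C"]) (use assms in auto)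

text \<open>Removes a one-sided inverse pair from the head of a right-nested product, the normal
  form produced by \<open>mat_assoc\<close>.\<close>

lemma mat_cancel_left:
  fixes A B C :: "complex mat"
  assumes "A * B = 1\<^sub>m n" "dim_row C = n" "dim_col A = dim_row B" "dim_col B = n"
  shows "A * (B * C) = C"
proof -
  have "A * (B * C) = (A * B) * C" by (rule mat_assoc[symmetric]) (use assms in auto)
  then show ?thesis using assms by (simp add: left_mult_one_mat')
qed

lemma zero_mat_mult_vec: "x \<in> carrier_vec n \<Longrightarrow> 0\<^sub>m m n *\<^sub>v x = (0\<^sub>v m :: complex vec)"
  by (intro eq_vecI) auto

lemma GL_iff:
  "A \<in> carrier (GL n) \<longleftrightarrow>
     A \<in> carrier_mat n n \<and> (\<exists>B \<in> carrier_mat n n. B * A = 1\<^sub>m n \<and> A * B = 1\<^sub>m n)"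
  by (auto simp: units_of_carrier Units_def ring_mat_simps)

lemma group_GL: "group (GL n)"
proof -
  interpret ring "ring_mat TYPE(complex) n ()" by (rule ring_mat)
  show ?thesis by (rule units_group)
qed

subsection \<open>Representations and intertwiners\<close>

locale finite_group = group +
  assumes fin: "finite (carrier G)"
begin

abbreviation deg :: "('a \<Rightarrow> complex mat) \<Rightarrow> nat" where
  "deg \<equiv> rep_degree G"

definition intertwiner :: "('a \<Rightarrow> complex mat) \<Rightarrow> ('a \<Rightarrow> complex mat) \<Rightarrow> complex mat \<Rightarrow> bool" where
  "intertwiner \<rho> \<sigma> T \<longleftrightarrow> T \<in> carrier_mat (deg \<sigma>) (deg \<rho>) \<and> (\<forall>g \<in> carrier G. T * \<rho> g = \<sigma> g * T)"

text \<open>For irreducible \<rho> this says that \<rho> is a constituent of \<sigma>; splitting off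
  constituents only asks whether the space of intertwiners vanishes, not for its dimension.\<close>

definition hom_nonzero :: "('a \<Rightarrow> complex mat) \<Rightarrow> ('a \<Rightarrow> complex mat) \<Rightarrow> bool" where
  "hom_nonzero \<rho> \<sigma> \<longleftrightarrow> (\<exists>T. intertwiner \<rho> \<sigma> T \<and> T \<noteq> 0\<^sub>m (deg \<sigma>) (deg \<rho>))"

text \<open>Invertibility of each value comes from the value at the inverse element.\<close>

lemma representationI:
  assumes car: "\<And>g. g \<in> carrier G \<Longrightarrow> \<rho> g \<in> carrier_mat n n"
    and one: "\<rho> \<one> = 1\<^sub>m n"
    and mult: "\<And>g h. g \<in> carrier G \<Longrightarrow> h \<in> carrier G \<Longrightarrow> \<rho> (g \<otimes> h) = \<rho> g * \<rho> h"
  shows "representation G \<rho>" and "deg \<rho> = n"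
proof -
  show deg: "deg \<rho> = n" unfolding rep_degree_def one by simp
  have "\<rho> g \<in> carrier (GL n)" if g: "g \<in> carrier G" for g
    unfolding GL_iff
  proof (intro conjI car bexI[of _ "\<rho> (inv g)"])
    show "\<rho> (inv g) * \<rho> g = 1\<^sub>m n" using g mult[of "inv g" g] one by simp
    show "\<rho> g * \<rho> (inv g) = 1\<^sub>m n" using g mult[of g "inv g"] one by simp
  qed (use g in auto)
  then show "representation G \<rho>"
    unfolding representation_def deg hom_def
    using mult by (auto simp: units_of_mult ring_mat_simps)
qed

context
  fixes \<rho> assumes \<rho>: "representation G \<rho>"
begin

lemma rep_carrier: "g \<in> carrier G \<Longrightarrow> \<rho> g \<in> carrier_mat (deg \<rho>) (deg \<rho>)"
  using \<rho> by (auto simp: representation_def hom_def GL_iff Pi_iff)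

lemma rep_dim: "g \<in> carrier G \<Longrightarrow> dim_row (\<rho> g) = deg \<rho>" "g \<in> carrier G \<Longrightarrow> dim_col (\<rho> g) = deg \<rho>"
  using rep_carrier by auto

lemma rep_mult: "g \<in> carrier G \<Longrightarrow> h \<in> carrier G \<Longrightarrow> \<rho> (g \<otimes> h) = \<rho> g * \<rho> h"
  using \<rho> by (auto simp: representation_def hom_def units_of_mult ring_mat_simps)

lemma rep_one: "\<rho> \<one> = 1\<^sub>m (deg \<rho>)"
proof -
  have "group_hom G (GL (deg \<rho>)) \<rho>"
    using \<rho> unfolding representation_def by (intro group_hom.intro group_hom_axioms.intro) (auto intro: group_axioms group_GL)
  from group_hom.hom_one[OF this] show ?thesis by (simp add: units_of_one ring_mat_simps)
qed

lemma rep_inv: "g \<in> carrier G \<Longrightarrow> \<rho> (inv g) * \<rho> g = 1\<^sub>m (deg \<rho>)" "g \<in> carrier G \<Longrightarrow> \<rho> g * \<rho> (inv g) = 1\<^sub>m (deg \<rho>)"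
  using rep_mult[of "inv g" g] rep_mult[of g "inv g"] by (simp_all add: rep_one)

lemma mat_trace_one_rep: "mat_trace (\<rho> \<one>) = of_nat (deg \<rho>)"
  by (simp add: rep_one)

end

lemma intertwiner_dim:
  "intertwiner \<rho> \<sigma> T \<Longrightarrow> dim_row T = deg \<sigma>" "intertwiner \<rho> \<sigma> T \<Longrightarrow> dim_col T = deg \<rho>"
  by (auto simp: intertwiner_def)

lemma intertwinerD: "intertwiner \<rho> \<sigma> T \<Longrightarrow> g \<in> carrier G \<Longrightarrow> T * \<rho> g = \<sigma> g * T"
  by (auto simp: intertwiner_def)

lemma intertwiner_carrier: "intertwiner \<rho> \<sigma> T \<Longrightarrow> T \<in> carrier_mat (deg \<sigma>) (deg \<rho>)"
  by (auto simp: intertwiner_def)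

lemma intertwiner_mult:
  assumes S: "intertwiner \<sigma> \<tau> S" and T: "intertwiner \<rho> \<sigma> T"
    and r: "representation G \<rho>" "representation G \<sigma>" "representation G \<tau>"
  shows "intertwiner \<rho> \<tau> (S * T)"
  unfolding intertwiner_def
proof (intro conjI ballI)
  show "S * T \<in> carrier_mat (deg \<tau>) (deg \<rho>)" using S T by (auto simp: intertwiner_def)
  fix g assume g: "g \<in> carrier G"
  note d = rep_dim[OF r(1) g] rep_dim[OF r(2) g] rep_dim[OF r(3) g] intertwiner_dim[OF S] intertwiner_dim[OF T]
  have "S * T * \<rho> g = S * (T * \<rho> g)" using d by (simp add: mat_assoc)
  also have "T * \<rho> g = \<sigma> g * T" using T g by (rule intertwinerD)
  also have "S * (\<sigma> g * T) = (S * \<sigma> g) * T" using d by (simp add: mat_assoc)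
  also have "S * \<sigma> g = \<tau> g * S" using S g by (rule intertwinerD)
  also have "\<tau> g * S * T = \<tau> g * (S * T)" using d by (simp add: mat_assoc)
  finally show "S * T * \<rho> g = \<tau> g * (S * T)" .
qed

text \<open>A form in which the two degrees may be syntactically different. An isomorphism can thus
  be built as a rectangular inverse pair, and equality of the degrees follows by applying
  \<open>left_inverse_dim_le\<close> in both directions.\<close>

lemma rep_iso_iff:
  "rep_iso G \<rho> \<sigma> \<longleftrightarrow> (\<exists>P Q. intertwiner \<rho> \<sigma> P \<and> Q \<in> carrier_mat (deg \<rho>) (deg \<sigma>) \<and>
      Q * P = 1\<^sub>m (deg \<rho>) \<and> P * Q = 1\<^sub>m (deg \<sigma>))"
proof
  assume "rep_iso G \<rho> \<sigma>"
  then obtain P where d: "deg \<rho> = deg \<sigma>" and P: "P \<in> carrier (GL (deg \<rho>))" "\<forall>g\<in>carrier G. P * \<rho> g = \<sigma> g * P"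
    unfolding rep_iso_def by blast
  moreover obtain Q where "P \<in> carrier_mat (deg \<rho>) (deg \<rho>)" "Q \<in> carrier_mat (deg \<rho>) (deg \<rho>)"
    "Q * P = 1\<^sub>m (deg \<rho>)" "P * Q = 1\<^sub>m (deg \<rho>)" using P(1) unfolding GL_iff by blast
  ultimately show "\<exists>P Q. intertwiner \<rho> \<sigma> P \<and> Q \<in> carrier_mat (deg \<rho>) (deg \<sigma>) \<and>
      Q * P = 1\<^sub>m (deg \<rho>) \<and> P * Q = 1\<^sub>m (deg \<sigma>)"
    unfolding intertwiner_def by (intro exI[of _ P] exI[of _ Q]) auto
next
  assume "\<exists>P Q. intertwiner \<rho> \<sigma> P \<and> Q \<in> carrier_mat (deg \<rho>) (deg \<sigma>) \<and>
      Q * P = 1\<^sub>m (deg \<rho>) \<and> P * Q = 1\<^sub>m (deg \<sigma>)"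
  then obtain P Q where PQ: "intertwiner \<rho> \<sigma> P" "Q \<in> carrier_mat (deg \<rho>) (deg \<sigma>)"
    "Q * P = 1\<^sub>m (deg \<rho>)" "P * Q = 1\<^sub>m (deg \<sigma>)" by blast
  have "deg \<rho> \<le> deg \<sigma>" "deg \<sigma> \<le> deg \<rho>"
    using left_inverse_dim_le[of P "deg \<sigma>" "deg \<rho>" Q] left_inverse_dim_le[of Q "deg \<rho>" "deg \<sigma>" P] PQ
    by (auto simp: intertwiner_def)
  then have "deg \<rho> = deg \<sigma>" by simp
  moreover have "P \<in> carrier (GL (deg \<rho>))"
    unfolding GL_iff using PQ \<open>deg \<rho> = deg \<sigma>\<close> by (auto simp: intertwiner_def)
  ultimately show "rep_iso G \<rho> \<sigma>" unfolding rep_iso_def using PQ(1) by (auto simp: intertwiner_def)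
qed

lemma intertwiner_inverse:
  assumes P: "intertwiner \<rho> \<sigma> P" and r: "representation G \<rho>" "representation G \<sigma>"
    and Q: "Q \<in> carrier_mat (deg \<rho>) (deg \<sigma>)" and QP: "Q * P = 1\<^sub>m (deg \<rho>)" and PQ: "P * Q = 1\<^sub>m (deg \<sigma>)"
  shows "intertwiner \<sigma> \<rho> Q"
  unfolding intertwiner_def
proof (intro conjI ballI)
  fix g assume g: "g \<in> carrier G"
  note d = rep_dim[OF r(1) g] rep_dim[OF r(2) g] intertwiner_dim[OF P] carrier_matD[OF Q]
  have "Q * \<sigma> g = Q * (\<sigma> g * (P * Q))" using d PQ by (simp add: right_mult_one_mat')
  also have "\<dots> = Q * ((\<sigma> g * P) * Q)" using d by (simp add: mat_assoc)
  also have "\<sigma> g * P = P * \<rho> g" using intertwinerD[OF P g] by simp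
  also have "Q * (P * \<rho> g * Q) = Q * (P * (\<rho> g * Q))" using d by (simp add: mat_assoc)
  also have "\<dots> = \<rho> g * Q" using d QP by (intro mat_cancel_left) auto
  finally show "Q * \<sigma> g = \<rho> g * Q" .
qed (rule Q)

lemma intertwiner_one: "representation G \<rho> \<Longrightarrow> intertwiner \<rho> \<rho> (1\<^sub>m (deg \<rho>))"
  by (auto simp: intertwiner_def rep_dim left_mult_one_mat' right_mult_one_mat')

lemma rep_iso_refl: "representation G \<rho> \<Longrightarrow> rep_iso G \<rho> \<rho>"
  unfolding rep_iso_iff using intertwiner_one by (intro exI[of _ "1\<^sub>m (deg \<rho>)"]) auto

lemma rep_iso_sym:
  assumes "rep_iso G \<rho> \<sigma>" and r: "representation G \<rho>" "representation G \<sigma>"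
  shows "rep_iso G \<sigma> \<rho>"
  using assms(1) intertwiner_inverse[OF _ r] intertwiner_carrier unfolding rep_iso_iff by blast

lemma rep_iso_trans:
  assumes "rep_iso G \<rho> \<sigma>" "rep_iso G \<sigma> \<tau>"
    and r: "representation G \<rho>" "representation G \<sigma>" "representation G \<tau>"
  shows "rep_iso G \<rho> \<tau>"
proof -
  obtain P Q where 1: "intertwiner \<rho> \<sigma> P" "Q \<in> carrier_mat (deg \<rho>) (deg \<sigma>)"
    "Q * P = 1\<^sub>m (deg \<rho>)" "P * Q = 1\<^sub>m (deg \<sigma>)" using assms(1) unfolding rep_iso_iff by blast
  obtain P' Q' where 2: "intertwiner \<sigma> \<tau> P'" "Q' \<in> carrier_mat (deg \<sigma>) (deg \<tau>)"
    "Q' * P' = 1\<^sub>m (deg \<sigma>)" "P' * Q' = 1\<^sub>m (deg \<tau>)" using assms(2) unfolding rep_iso_iff by blast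
  note d = intertwiner_dim[OF 1(1)] intertwiner_dim[OF 2(1)] carrier_matD[OF 1(2)] carrier_matD[OF 2(2)]
  have "(Q * Q') * (P' * P) = 1\<^sub>m (deg \<rho>)" "(P' * P) * (Q * Q') = 1\<^sub>m (deg \<tau>)"
    using d 1 2 by (simp_all add: mat_assoc mat_cancel_left[OF 2(3)] mat_cancel_left[OF 1(4)])
  moreover have "intertwiner \<rho> \<tau> (P' * P)" using 1 2 r intertwiner_mult by blast
  moreover have "Q * Q' \<in> carrier_mat (deg \<rho>) (deg \<tau>)" using 1 2 by auto
  ultimately show ?thesis unfolding rep_iso_iff by blast
qed

lemma rep_iso_deg: "rep_iso G \<rho> \<sigma> \<Longrightarrow> deg \<rho> = deg \<sigma>"
  by (simp add: rep_iso_def)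

lemma rep_iso_mat_trace:
  assumes "rep_iso G \<rho> \<sigma>" and r: "representation G \<rho>" "representation G \<sigma>" and g: "g \<in> carrier G"
  shows "mat_trace (\<rho> g) = mat_trace (\<sigma> g)"
proof -
  obtain P where P: "P \<in> carrier (GL (deg \<rho>))" "P * \<rho> g = \<sigma> g * P" and d: "deg \<rho> = deg \<sigma>"
    using assms(1) g unfolding rep_iso_def by auto
  from P(1) obtain Q where "P \<in> carrier_mat (deg \<rho>) (deg \<rho>)" "Q \<in> carrier_mat (deg \<rho>) (deg \<rho>)"
    "Q * P = 1\<^sub>m (deg \<rho>)" unfolding GL_iff by blast
  with P(2) show ?thesis
    using rep_carrier[OF r(1) g] rep_carrier[OF r(2) g] d by (intro mat_trace_similar) auto
qed

text \<open>The action of \<open>G\<close> on an invariant column space of \<open>U\<close>, in the coordinates given by \<open>V\<close>.\<close>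

lemma compression:
  assumes r: "representation G \<rho>" and U: "U \<in> carrier_mat (deg \<rho>) k" and V: "V \<in> carrier_mat k (deg \<rho>)"
    and VU: "V * U = 1\<^sub>m k"
    and inv: "\<forall>g \<in> carrier G. \<exists>X \<in> carrier_mat k k. \<rho> g * U = U * X"
  defines "\<sigma> \<equiv> \<lambda>g. V * (\<rho> g * U)"
  shows "representation G \<sigma>" and "deg \<sigma> = k" and "intertwiner \<sigma> \<rho> U"
proof -
  note d = rep_dim[OF r] carrier_matD[OF U] carrier_matD[OF V]
  have car: "\<sigma> g \<in> carrier_mat k k" if "g \<in> carrier G" for g
    using that U V d unfolding \<sigma>_def by auto
  have U\<sigma>: "U * \<sigma> g = \<rho> g * U" if g: "g \<in> carrier G" for g
  proof -
    obtain X where X: "X \<in> carrier_mat k k" "\<rho> g * U = U * X" using inv g by blast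
    then have "\<sigma> g = X" unfolding \<sigma>_def using d by (simp add: mat_cancel_left[OF VU])
    then show ?thesis using X by simp
  qed
  have one: "\<sigma> \<one> = 1\<^sub>m k" unfolding \<sigma>_def using d VU by (simp add: rep_one[OF r])
  have mult: "\<sigma> (g \<otimes> h) = \<sigma> g * \<sigma> h" if gh: "g \<in> carrier G" "h \<in> carrier G" for g h
  proof -
    have "\<sigma> (g \<otimes> h) = V * (\<rho> g * \<rho> h * U)" unfolding \<sigma>_def using rep_mult[OF r gh] by simp
    also have "\<rho> g * \<rho> h * U = \<rho> g * (U * \<sigma> h)" using d gh U\<sigma>[OF gh(2)] by (simp add: mat_assoc)
    also have "\<dots> = \<rho> g * U * \<sigma> h" using d gh car[OF gh(2)] by (simp add: mat_assoc)
    also have "\<dots> = U * (\<sigma> g * \<sigma> h)"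
      using d gh car[OF gh(2)] car[OF gh(1)] by (simp add: mat_assoc flip: U\<sigma>[OF gh(1)])
    also have "V * \<dots> = \<sigma> g * \<sigma> h"
      using d car[OF gh(1)] car[OF gh(2)] by (intro mat_cancel_left[OF VU]) auto
    finally show ?thesis .
  qed
  show "representation G \<sigma>" and deg: "deg \<sigma> = k"
    using representationI[of \<sigma> k] car one mult by blast+
  show "intertwiner \<sigma> \<rho> U" unfolding intertwiner_def deg using U U\<sigma> by auto
qed

section \<open>Irreducible constituents and Schur's lemma\<close>

lemma irreducible_rep_representation: "irreducible_rep G \<rho> \<Longrightarrow> representation G \<rho>"
  by (simp add: irreducible_rep_def)

text \<open>Induction on the degree: a reducible representation is compressed to a proper nonzero
  invariant subspace. The matrix \<open>L\<close> witnesses injectivity of \<open>T\<close> and is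
  composed with the coordinate map \<open>V\<close> of the subspace.\<close>

lemma exists_irreducible_hom:
  "representation G \<rho> \<Longrightarrow> deg \<rho> \<noteq> 0 \<Longrightarrow>
     \<exists>\<sigma> T L. irreducible_rep G \<sigma> \<and> intertwiner \<sigma> \<rho> T \<and> L \<in> carrier_mat (deg \<sigma>) (deg \<rho>) \<and> L * T = 1\<^sub>m (deg \<sigma>)"
proof (induction "deg \<rho>" arbitrary: \<rho> rule: less_induct)
  case less
  show ?case
  proof (cases "irreducible_rep G \<rho>")
    case True
    then show ?thesis using intertwiner_one[OF less.prems(1)]
      by (intro exI[of _ \<rho>] exI[of _ "1\<^sub>m (deg \<rho>)"]) auto
  next
    case False
    then obtain W where W: "invariant_subspace G \<rho> W" "W \<noteq> {0\<^sub>v (deg \<rho>)}" "W \<noteq> carrier_vec (deg \<rho>)"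
      using less.prems unfolding irreducible_rep_def by auto
    have "VectorSpace.subspace class_ring W (module_vec TYPE(complex) (deg \<rho>))"
      using W(1) unfolding invariant_subspace_def by (rule conjunct1)
    from subspace_split[OF this] obtain k U V where U: "U \<in> carrier_mat (deg \<rho>) k"
      and V: "V \<in> carrier_mat k (deg \<rho>)" and VU: "V * U = 1\<^sub>m k"
      and WU: "W = (\<lambda>x. U *\<^sub>v x) ` carrier_vec k" by blast
    have X: "\<forall>g \<in> carrier G. \<exists>X \<in> carrier_mat k k. \<rho> g * U = U * X"
    proof (intro ballI mat_factor_range)
      fix g assume g: "g \<in> carrier G"
      show "\<rho> g * U \<in> carrier_mat (deg \<rho>) k" using rep_carrier[OF less.prems(1) g] U by auto
      show "U \<in> carrier_mat (deg \<rho>) k" by (rule U)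
      show "(\<lambda>x. (\<rho> g * U) *\<^sub>v x) ` carrier_vec k \<subseteq> (\<lambda>x. U *\<^sub>v x) ` carrier_vec k"
      proof (rule image_subsetI)
        fix x :: "complex vec" assume x: "x \<in> carrier_vec k"
        then have "\<rho> g *\<^sub>v (U *\<^sub>v x) \<in> W"
          using W(1) g unfolding invariant_subspace_def by (auto simp: WU)
        then show "(\<rho> g * U) *\<^sub>v x \<in> (\<lambda>x. U *\<^sub>v x) ` carrier_vec k"
          using assoc_mult_mat_vec[OF rep_carrier[OF less.prems(1) g] U x] by (simp add: WU)
      qed
    qed
    define \<sigma> where "\<sigma> = (\<lambda>g. V * (\<rho> g * U))"
    note c = compression[OF less.prems(1) U V VU X, folded \<sigma>_def]
    have "k \<noteq> 0"
    proof
      assume "k = 0"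
      have z: "U *\<^sub>v x = 0\<^sub>v (deg \<rho>)" if "x \<in> carrier_vec k" for x
        using U that \<open>k = 0\<close> by (intro eq_vecI) (auto simp: scalar_prod_def)
      have "W = {0\<^sub>v (deg \<rho>)}"
      proof
        show "W \<subseteq> {0\<^sub>v (deg \<rho>)}" unfolding WU by (rule image_subsetI) (simp add: z)
        have "U *\<^sub>v 0\<^sub>v k \<in> W" unfolding WU by (rule imageI) simp
        then show "{0\<^sub>v (deg \<rho>)} \<subseteq> W" by (simp add: z)
      qed
      then show False using W by simp
    qed
    have "k \<le> deg \<rho>" using left_inverse_dim_le[OF U V VU] .
    have "k \<noteq> deg \<rho>"
    proof
      assume k: "k = deg \<rho>"
      have UV: "U * V = 1\<^sub>m (deg \<rho>)" using mat_mult_left_right_inverse[of V k U] U V VU k by auto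
      have "x \<in> W" if x: "x \<in> carrier_vec (deg \<rho>)" for x
      proof -
        have "x = U *\<^sub>v (V *\<^sub>v x)" using assoc_mult_mat_vec[OF U V x] x UV by simp
        moreover have "V *\<^sub>v x \<in> carrier_vec k" using V x by simp
        ultimately show ?thesis unfolding WU by (rule image_eqI)
      qed
      moreover have "W \<subseteq> carrier_vec (deg \<rho>)" unfolding WU using U by auto
      ultimately show False using W(3) by auto
    qed
    then have lt: "deg \<sigma> < deg \<rho>" using c(2) \<open>k \<le> deg \<rho>\<close> by simp
    have "\<exists>\<tau> T L. irreducible_rep G \<tau> \<and> intertwiner \<tau> \<sigma> T \<and> L \<in> carrier_mat (deg \<tau>) (deg \<sigma>) \<and> L * T = 1\<^sub>m (deg \<tau>)"
      by (rule less.hyps[OF lt c(1)]) (simp add: c(2) \<open>k \<noteq> 0\<close>)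
    then obtain \<tau> T L where
      t: "irreducible_rep G \<tau>" "intertwiner \<tau> \<sigma> T" "L \<in> carrier_mat (deg \<tau>) k" "L * T = 1\<^sub>m (deg \<tau>)"
      unfolding c(2) by blast
    have "intertwiner \<tau> \<rho> (U * T)"
      using intertwiner_mult[OF c(3) t(2) _ c(1) less.prems(1)] t(1) irreducible_rep_representation by blast
    moreover have "(L * V) * (U * T) = 1\<^sub>m (deg \<tau>)"
    proof -
      have "V * (U * T) = T" using U V intertwiner_dim[OF t(2)] c(2) by (intro mat_cancel_left[OF VU]) auto
      moreover have "(L * V) * (U * T) = L * (V * (U * T))"
        using U V t(3) by (intro mat_assoc) auto
      ultimately show ?thesis using t(4) by simp
    qed
    moreover have "L * V \<in> carrier_mat (deg \<tau>) (deg \<rho>)" using t V by auto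
    ultimately show ?thesis using t(1) by (intro exI conjI)
  qed
qed

lemma invariant_subspace_kernel:
  assumes r: "representation G \<rho>" "representation G \<sigma>" and T: "intertwiner \<rho> \<sigma> T"
  shows "invariant_subspace G \<rho> {x \<in> carrier_vec (deg \<rho>). T *\<^sub>v x = 0\<^sub>v (deg \<sigma>)}"
  unfolding invariant_subspace_def
proof (intro conjI ballI)
  show "VectorSpace.subspace class_ring {x \<in> carrier_vec (deg \<rho>). T *\<^sub>v x = 0\<^sub>v (deg \<sigma>)}
      (module_vec TYPE(complex) (deg \<rho>))"
    using subspace_kernel T by (auto simp: intertwiner_def)
  fix g w assume g: "g \<in> carrier G" and w: "w \<in> {x \<in> carrier_vec (deg \<rho>). T *\<^sub>v x = 0\<^sub>v (deg \<sigma>)}"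
  have Tc: "T \<in> carrier_mat (deg \<sigma>) (deg \<rho>)" using T by (rule intertwiner_carrier)
  have "T *\<^sub>v (\<rho> g *\<^sub>v w) = (T * \<rho> g) *\<^sub>v w"
    using Tc rep_carrier[OF r(1) g] w by (simp add: assoc_mult_mat_vec)
  also have "\<dots> = \<sigma> g *\<^sub>v (T *\<^sub>v w)"
    using Tc rep_carrier[OF r(2) g] w by (simp add: intertwinerD[OF T g] assoc_mult_mat_vec)
  also have "\<dots> = 0\<^sub>v (deg \<sigma>)" using w rep_carrier[OF r(2) g] by auto
  finally show "\<rho> g *\<^sub>v w \<in> {x \<in> carrier_vec (deg \<rho>). T *\<^sub>v x = 0\<^sub>v (deg \<sigma>)}"
    using w rep_carrier[OF r(1) g] by auto
qed

lemma invariant_subspace_range: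
  assumes r: "representation G \<rho>" "representation G \<sigma>" and T: "intertwiner \<rho> \<sigma> T"
  shows "invariant_subspace G \<sigma> ((\<lambda>x. T *\<^sub>v x) ` carrier_vec (deg \<rho>))"
  unfolding invariant_subspace_def
proof (intro conjI ballI)
  show "VectorSpace.subspace class_ring ((\<lambda>x. T *\<^sub>v x) ` carrier_vec (deg \<rho>))
      (module_vec TYPE(complex) (deg \<sigma>))"
    using subspace_range T by (auto simp: intertwiner_def)
  fix g w assume g: "g \<in> carrier G" and w: "w \<in> (\<lambda>x. T *\<^sub>v x) ` carrier_vec (deg \<rho>)"
  then obtain x where x: "x \<in> carrier_vec (deg \<rho>)" "w = T *\<^sub>v x" by auto
  have Tc: "T \<in> carrier_mat (deg \<sigma>) (deg \<rho>)" using T by (rule intertwiner_carrier)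
  have "\<sigma> g *\<^sub>v w = (\<sigma> g * T) *\<^sub>v x"
    using Tc rep_carrier[OF r(2) g] x by (simp add: assoc_mult_mat_vec)
  also have "\<dots> = T *\<^sub>v (\<rho> g *\<^sub>v x)"
    using Tc rep_carrier[OF r(1) g] x by (simp flip: intertwinerD[OF T g] add: assoc_mult_mat_vec)
  finally show "\<sigma> g *\<^sub>v w \<in> (\<lambda>x. T *\<^sub>v x) ` carrier_vec (deg \<rho>)"
    using x rep_carrier[OF r(1) g] by auto
qed

text \<open>The kernel of \<open>T\<close> is an invariant subspace of the irreducible source, and
  it is not everything, so it is zero.\<close>

lemma schur_left_inverse:
  assumes \<rho>: "irreducible_rep G \<rho>" and \<sigma>: "representation G \<sigma>" and T: "intertwiner \<rho> \<sigma> T"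
    and nz: "T \<noteq> 0\<^sub>m (deg \<sigma>) (deg \<rho>)"
  shows "\<exists>L \<in> carrier_mat (deg \<rho>) (deg \<sigma>). L * T = 1\<^sub>m (deg \<rho>)"
proof (rule injective_left_inverse)
  show Tc: "T \<in> carrier_mat (deg \<sigma>) (deg \<rho>)" using T by (rule intertwiner_carrier)
  let ?W = "{x \<in> carrier_vec (deg \<rho>). T *\<^sub>v x = 0\<^sub>v (deg \<sigma>)}"
  have "invariant_subspace G \<rho> ?W"
    using invariant_subspace_kernel[OF _ \<sigma> T] \<rho> by (simp add: irreducible_rep_def)
  then consider "?W = {0\<^sub>v (deg \<rho>)}" | "?W = carrier_vec (deg \<rho>)"
    using \<rho> unfolding irreducible_rep_def by blast
  then show "x = 0\<^sub>v (deg \<rho>)" if "x \<in> carrier_vec (deg \<rho>)" "T *\<^sub>v x = 0\<^sub>v (deg \<sigma>)" for x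
  proof cases
    case 2
    have "T = 0\<^sub>m (deg \<sigma>) (deg \<rho>)" by (rule mat_eq_mult_vecI[OF Tc]) (use 2 zero_mat_mult_vec in auto)
    then show ?thesis using nz by simp
  qed (use that in blast)
qed

text \<open>Dually, the range of \<open>T\<close> is a nonzero invariant subspace of the irreducible
  target.\<close>

lemma schur_right_inverse:
  assumes \<rho>: "representation G \<rho>" and \<sigma>: "irreducible_rep G \<sigma>" and T: "intertwiner \<rho> \<sigma> T"
    and nz: "T \<noteq> 0\<^sub>m (deg \<sigma>) (deg \<rho>)"
  shows "\<exists>R \<in> carrier_mat (deg \<rho>) (deg \<sigma>). T * R = 1\<^sub>m (deg \<sigma>)"
proof (rule surjective_right_inverse)
  show Tc: "T \<in> carrier_mat (deg \<sigma>) (deg \<rho>)" using T by (rule intertwiner_carrier)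
  let ?W = "(\<lambda>x. T *\<^sub>v x) ` carrier_vec (deg \<rho>)"
  have "invariant_subspace G \<sigma> ?W"
    using invariant_subspace_range[OF \<rho> _ T] \<sigma> by (simp add: irreducible_rep_def)
  then consider "?W = {0\<^sub>v (deg \<sigma>)}" | "?W = carrier_vec (deg \<sigma>)"
    using \<sigma> unfolding irreducible_rep_def by blast
  then show "?W = carrier_vec (deg \<sigma>)"
  proof cases
    case 1
    have "T = 0\<^sub>m (deg \<sigma>) (deg \<rho>)" by (rule mat_eq_mult_vecI[OF Tc]) (use 1 zero_mat_mult_vec in auto)
    then show ?thesis using nz by simp
  qed
qed

lemma schur_iso:
  assumes \<rho>: "irreducible_rep G \<rho>" and \<sigma>: "irreducible_rep G \<sigma>" and h: "hom_nonzero \<rho> \<sigma>"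
  shows "rep_iso G \<rho> \<sigma>"
proof -
  obtain T where T: "intertwiner \<rho> \<sigma> T" and nz: "T \<noteq> 0\<^sub>m (deg \<sigma>) (deg \<rho>)"
    using h unfolding hom_nonzero_def by blast
  obtain L where L: "L \<in> carrier_mat (deg \<rho>) (deg \<sigma>)" "L * T = 1\<^sub>m (deg \<rho>)"
    using schur_left_inverse[OF \<rho> irreducible_rep_representation[OF \<sigma>] T nz] by blast
  obtain R where R: "R \<in> carrier_mat (deg \<rho>) (deg \<sigma>)" "T * R = 1\<^sub>m (deg \<sigma>)"
    using schur_right_inverse[OF irreducible_rep_representation[OF \<rho>] \<sigma> T nz] by blast
  have "L = L * (T * R)" using L R by simp
  also have "\<dots> = R" using L R intertwiner_dim[OF T] by (intro mat_cancel_left) auto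
  finally show ?thesis unfolding rep_iso_iff using T L R by blast
qed

text \<open>Over the complex numbers \<open>T\<close> has an eigenvalue \<open>c\<close>. The
  intertwiner \<open>T - c\<close> kills an eigenvector, so it has no left inverse and must vanish
  by \<open>schur_left_inverse\<close>.\<close>

lemma schur_scalar:
  assumes \<rho>: "irreducible_rep G \<rho>" and T: "intertwiner \<rho> \<rho> T"
  shows "\<exists>c. T = c \<cdot>\<^sub>m 1\<^sub>m (deg \<rho>)"
proof -
  have r: "representation G \<rho>" and d: "deg \<rho> > 0" using \<rho> by (auto simp: irreducible_rep_def)
  have Tc: "T \<in> carrier_mat (deg \<rho>) (deg \<rho>)" using T by (rule intertwiner_carrier)
  obtain c where "eigenvalue T c" using spectrum_non_empty[OF Tc d] unfolding spectrum_def by auto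
  then obtain v where v: "v \<in> carrier_vec (deg \<rho>)" "v \<noteq> 0\<^sub>v (deg \<rho>)" "T *\<^sub>v v = c \<cdot>\<^sub>v v"
    using Tc unfolding eigenvalue_def eigenvector_def by auto
  define S where "S = T - c \<cdot>\<^sub>m 1\<^sub>m (deg \<rho>)"
  have Sc: "S \<in> carrier_mat (deg \<rho>) (deg \<rho>)" unfolding S_def using Tc by auto
  have S: "intertwiner \<rho> \<rho> S"
    unfolding intertwiner_def
  proof (intro conjI ballI)
    fix g assume g: "g \<in> carrier G"
    note rc = rep_carrier[OF r g]
    have "S * \<rho> g = T * \<rho> g - c \<cdot>\<^sub>m \<rho> g"
      unfolding S_def using Tc rc by (subst minus_mult_distrib_mat[of _ "deg \<rho>" "deg \<rho>"]) auto
    also have "\<dots> = \<rho> g * T - \<rho> g * (c \<cdot>\<^sub>m 1\<^sub>m (deg \<rho>))"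
      using rc mult_smult_distrib[OF rc one_carrier_mat, of c] by (simp add: intertwinerD[OF T g])
    also have "\<dots> = \<rho> g * S"
      unfolding S_def using Tc rc by (subst mult_minus_distrib_mat[of _ "deg \<rho>" "deg \<rho>"]) auto
    finally show "S * \<rho> g = \<rho> g * S" .
  qed (rule Sc)
  have Sv: "S *\<^sub>v v = 0\<^sub>v (deg \<rho>)"
    unfolding S_def using Tc v by (subst minus_mult_distrib_mat_vec[of _ "deg \<rho>" "deg \<rho>"]) auto
  have S0: "S = 0\<^sub>m (deg \<rho>) (deg \<rho>)"
  proof (rule ccontr)
    assume "S \<noteq> 0\<^sub>m (deg \<rho>) (deg \<rho>)"
    then obtain L where L: "L \<in> carrier_mat (deg \<rho>) (deg \<rho>)" "L * S = 1\<^sub>m (deg \<rho>)"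
      using schur_left_inverse[OF \<rho> r S] by blast
    have "v = L *\<^sub>v (S *\<^sub>v v)" using L Sc v by (simp flip: assoc_mult_mat_vec)
    also have "\<dots> = 0\<^sub>v (deg \<rho>)" unfolding Sv using L by (intro eq_vecI) auto
    finally show False using v by simp
  qed
  have "T = c \<cdot>\<^sub>m 1\<^sub>m (deg \<rho>)"
  proof (rule eq_matI)
    fix i j assume ij: "i < dim_row (c \<cdot>\<^sub>m 1\<^sub>m (deg \<rho>))" "j < dim_col (c \<cdot>\<^sub>m 1\<^sub>m (deg \<rho>))"
    then have "S $$ (i,j) = 0" using S0 by simp
    then show "T $$ (i,j) = (c \<cdot>\<^sub>m 1\<^sub>m (deg \<rho>)) $$ (i,j)" unfolding S_def using ij Tc by simp
  qed (use Tc in auto)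
  then show ?thesis by blast
qed

lemma average_intertwiner:
  assumes r: "representation G \<rho>" "representation G \<sigma>" and X: "X \<in> carrier_mat (deg \<sigma>) (deg \<rho>)"
  shows "intertwiner \<rho> \<sigma> (mat_sum (deg \<sigma>) (deg \<rho>) (\<lambda>g. \<sigma> g * (X * \<rho> (inv g))) (carrier G))"
  unfolding intertwiner_def
proof (intro conjI ballI mat_sum_carrier)
  let ?F = "\<lambda>g. \<sigma> g * (X * \<rho> (inv g))"
  have Fc: "?F g \<in> carrier_mat (deg \<sigma>) (deg \<rho>)" if "g \<in> carrier G" for g
    using rep_carrier[OF r(1), of "inv g"] rep_carrier[OF r(2), of g] X that by auto
  fix h assume h: "h \<in> carrier G"
  note rd = rep_dim[OF r(1)] rep_dim[OF r(2)] carrier_matD[OF X]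
  have "mat_sum (deg \<sigma>) (deg \<rho>) ?F (carrier G) * \<rho> h =
      mat_sum (deg \<sigma>) (deg \<rho>) (\<lambda>g. ?F g * \<rho> h) (carrier G)"
    by (rule mat_sum_mult[OF rep_carrier[OF r(1) h]]) (rule Fc)
  also have "\<dots> = mat_sum (deg \<sigma>) (deg \<rho>) (\<lambda>g. ?F (h \<otimes> g) * \<rho> h) (carrier G)"
    by (rule mat_sum_reindex_bij_betw[symmetric])
      (rule bij_betwI[where g = "\<lambda>x. inv h \<otimes> x"], use h in \<open>auto simp flip: m_assoc\<close>)
  also have "\<dots> = mat_sum (deg \<sigma>) (deg \<rho>) (\<lambda>g. \<sigma> h * ?F g) (carrier G)"
  proof (rule mat_sum_cong)
    fix g assume g: "g \<in> carrier G"
    have "\<rho> (inv (h \<otimes> g)) * \<rho> h = \<rho> (inv g)"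
      using g h by (simp flip: rep_mult[OF r(1)] add: inv_mult_group m_assoc)
    then show "?F (h \<otimes> g) * \<rho> h = \<sigma> h * ?F g"
      using g h rd by (simp add: rep_mult[OF r(2)] mat_assoc)
  qed
  also have "\<dots> = \<sigma> h * mat_sum (deg \<sigma>) (deg \<rho>) ?F (carrier G)"
    by (rule mult_mat_sum[OF rep_carrier[OF r(2) h], symmetric]) (rule Fc)
  finally show "mat_sum (deg \<sigma>) (deg \<rho>) ?F (carrier G) * \<rho> h = \<sigma> h * mat_sum (deg \<sigma>) (deg \<rho>) ?F (carrier G)" .
qed

end

subsection \<open>Complete reducibility\<close>

lemma four_block_mat_zero_dim:
  fixes A :: "complex mat"
  shows "A \<in> carrier_mat n n \<Longrightarrow> four_block_mat A (0\<^sub>m n 0) (0\<^sub>m 0 n) (0\<^sub>m 0 0) = A"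
  by (intro eq_matI) auto

section \<open>Maschke's theorem\<close>

context finite_group
begin

text \<open>Records that \<rho> is the direct sum of \<sigma> and \<tau>, with inclusions
  \<open>i\<close>, \<open>j\<close> and projections \<open>p\<close>, \<open>q\<close>.
  Constituents can so be split off without a change of basis; block matrices enter only in
  \<open>rep_iso_direct_sum_Cons\<close>.\<close>

definition biproduct where
  "biproduct \<rho> \<sigma> \<tau> i p j q \<longleftrightarrow>
     intertwiner \<sigma> \<rho> i \<and> intertwiner \<rho> \<sigma> p \<and> intertwiner \<tau> \<rho> j \<and> intertwiner \<rho> \<tau> q \<and>
     p * i = 1\<^sub>m (deg \<sigma>) \<and> q * j = 1\<^sub>m (deg \<tau>) \<and> p * j = 0\<^sub>m (deg \<sigma>) (deg \<tau>) \<and>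
     q * i = 0\<^sub>m (deg \<tau>) (deg \<sigma>) \<and> i * p + j * q = 1\<^sub>m (deg \<rho>)"

lemma intertwiner_smult:
  assumes T: "intertwiner \<rho> \<sigma> T" and r: "representation G \<rho>" "representation G \<sigma>"
  shows "intertwiner \<rho> \<sigma> (c \<cdot>\<^sub>m T)"
  unfolding intertwiner_def
proof (intro conjI ballI)
  show "c \<cdot>\<^sub>m T \<in> carrier_mat (deg \<sigma>) (deg \<rho>)" using intertwiner_carrier[OF T] by simp
  fix g assume g: "g \<in> carrier G"
  show "c \<cdot>\<^sub>m T * \<rho> g = \<sigma> g * (c \<cdot>\<^sub>m T)"
    using intertwiner_carrier[OF T] rep_carrier[OF r(1) g] rep_carrier[OF r(2) g] intertwinerD[OF T g]
    by (simp add: mult_smult_assoc_mat mult_smult_distrib)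
qed

lemma card_carrier_pos: "of_nat (card (carrier G)) \<noteq> (0 :: complex)"
  using fin one_closed by auto

text \<open>The averaging argument of Maschke's theorem. Since \<open>T\<close> is an intertwiner
  and \<open>L T = 1\<close>, each summand of the average of \<open>L\<close> becomes the identity
  after multiplication by \<open>T\<close>, so dividing by the group order gives the equivariant
  left inverse.\<close>

lemma equivariant_left_inverse:
  assumes r: "representation G \<rho>" "representation G \<sigma>" and T: "intertwiner \<sigma> \<rho> T"
    and L: "L \<in> carrier_mat (deg \<sigma>) (deg \<rho>)" and LT: "L * T = 1\<^sub>m (deg \<sigma>)"
  shows "\<exists>p. intertwiner \<rho> \<sigma> p \<and> p * T = 1\<^sub>m (deg \<sigma>)"
proof -
  let ?N = "of_nat (card (carrier G)) :: complex"
  let ?F = "\<lambda>g. \<sigma> g * (L * \<rho> (inv g))"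
  define S where "S = mat_sum (deg \<sigma>) (deg \<rho>) ?F (carrier G)"
  note Tc = intertwiner_carrier[OF T]
  have S: "intertwiner \<rho> \<sigma> S" unfolding S_def by (rule average_intertwiner[OF r L])
  have "S * T = mat_sum (deg \<sigma>) (deg \<sigma>) (\<lambda>g. ?F g * T) (carrier G)"
    unfolding S_def
  proof (rule mat_sum_mult[OF Tc])
    fix g assume g: "g \<in> carrier G"
    show "?F g \<in> carrier_mat (deg \<sigma>) (deg \<rho>)"
      using rep_carrier[OF r(2) g] rep_carrier[OF r(1) inv_closed[OF g]] L by simp
  qed
  also have "\<dots> = mat_sum (deg \<sigma>) (deg \<sigma>) (\<lambda>g. 1\<^sub>m (deg \<sigma>)) (carrier G)"
  proof (rule mat_sum_cong)
    fix g assume g: "g \<in> carrier G"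
    note d = rep_dim[OF r(1) g] rep_dim[OF r(2) g] rep_dim[OF r(1) inv_closed[OF g]]
      rep_dim[OF r(2) inv_closed[OF g]] carrier_matD[OF L] carrier_matD[OF Tc]
    have "?F g * T = \<sigma> g * (L * (\<rho> (inv g) * T))" using d by (simp add: mat_assoc)
    also have "\<rho> (inv g) * T = T * \<sigma> (inv g)" using intertwinerD[OF T, of "inv g"] g by simp
    also have "L * (T * \<sigma> (inv g)) = \<sigma> (inv g)" using d by (intro mat_cancel_left[OF LT]) auto
    also have "\<sigma> g * \<sigma> (inv g) = 1\<^sub>m (deg \<sigma>)" by (rule rep_inv[OF r(2) g])
    finally show "?F g * T = 1\<^sub>m (deg \<sigma>)" .
  qed
  also have "\<dots> = ?N \<cdot>\<^sub>m 1\<^sub>m (deg \<sigma>)" by (rule mat_sum_const) simp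
  finally have ST: "S * T = ?N \<cdot>\<^sub>m 1\<^sub>m (deg \<sigma>)" .
  have "((1 / ?N) \<cdot>\<^sub>m S) * T = (1 / ?N) \<cdot>\<^sub>m (S * T)"
    using intertwiner_carrier[OF S] Tc by (rule mult_smult_assoc_mat)
  also have "\<dots> = 1\<^sub>m (deg \<sigma>)" unfolding ST using card_carrier_pos by (intro eq_matI) auto
  finally show ?thesis using intertwiner_smult[OF S r] by blast
qed

text \<open>The complement is the range of the idempotent \<open>E = 1 - i p\<close>, which commutes
  with the action. If \<open>U\<close> is a basis matrix of this range and \<open>E = U Y\<close>,
  then \<open>U\<close> and \<open>Y\<close> serve as inclusion and projection.\<close>

lemma biproduct_complement:
  assumes r: "representation G \<rho>" "representation G \<sigma>" and i: "intertwiner \<sigma> \<rho> i"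
    and p: "intertwiner \<rho> \<sigma> p" and pi: "p * i = 1\<^sub>m (deg \<sigma>)"
  shows "\<exists>\<tau> j q. representation G \<tau> \<and> biproduct \<rho> \<sigma> \<tau> i p j q"
proof -
  let ?n = "deg \<rho>"
  note ic = intertwiner_carrier[OF i] and pc = intertwiner_carrier[OF p]
  note id = carrier_matD[OF ic] and pd = carrier_matD[OF pc]
  define E where "E = 1\<^sub>m ?n - i * p"
  have Ec: "E \<in> carrier_mat ?n ?n" unfolding E_def using ic pc by auto
  note Ed = carrier_matD[OF Ec]
  have pE: "p * E = 0\<^sub>m (deg \<sigma>) ?n"
  proof -
    have "p * E = p * 1\<^sub>m ?n - p * (i * p)"
      unfolding E_def by (rule mult_minus_distrib_mat) (use ic pc in auto)
    also have "p * (i * p) = p" using id pd by (intro mat_cancel_left[OF pi]) auto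
    finally show ?thesis using pc by simp
  qed
  have Ei: "E * i = 0\<^sub>m ?n (deg \<sigma>)"
  proof -
    have "E * i = 1\<^sub>m ?n * i - i * p * i"
      unfolding E_def by (rule minus_mult_distrib_mat) (use ic pc in auto)
    also have "i * p * i = i * (p * i)" using id pd by (intro mat_assoc) auto
    finally show ?thesis using ic pi by simp
  qed
  have EE: "E * E = E"
  proof -
    have "E * E = 1\<^sub>m ?n * E - i * p * E"
      by (subst (1) E_def, rule minus_mult_distrib_mat) (use ic pc Ec in auto)
    also have "i * p * E = i * (p * E)" using id pd Ed by (intro mat_assoc) auto
    also have "\<dots> = 0\<^sub>m ?n ?n" unfolding pE using ic by simp
    also have "1\<^sub>m ?n * E - 0\<^sub>m ?n ?n = E" using Ec by (intro eq_matI) auto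
    finally show ?thesis .
  qed
  have E\<rho>: "E * \<rho> g = \<rho> g * E" if g: "g \<in> carrier G" for g
  proof -
    note rc = rep_carrier[OF r(1) g]
    have "E * \<rho> g = 1\<^sub>m ?n * \<rho> g - i * p * \<rho> g"
      unfolding E_def by (rule minus_mult_distrib_mat) (use ic pc rc in auto)
    also have "i * p * \<rho> g = \<rho> g * (i * p)"
      using intertwinerD[OF intertwiner_mult[OF i p r(1,2,1)] g] .
    also have "1\<^sub>m ?n * \<rho> g - \<rho> g * (i * p) = \<rho> g * 1\<^sub>m ?n - \<rho> g * (i * p)" using rc by simp
    also have "\<dots> = \<rho> g * E"
      unfolding E_def by (rule mult_minus_distrib_mat[symmetric]) (use ic pc rc in auto)
    finally show ?thesis .
  qed
  obtain k U V where U: "U \<in> carrier_mat ?n k" and V: "V \<in> carrier_mat k ?n" and VU: "V * U = 1\<^sub>m k"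
    and R: "(\<lambda>x. E *\<^sub>v x) ` carrier_vec ?n = (\<lambda>x. U *\<^sub>v x) ` carrier_vec k"
    using subspace_split[OF subspace_range[OF Ec]] by blast
  note Ud = carrier_matD[OF U] and Vd = carrier_matD[OF V]
  obtain Y where Y: "Y \<in> carrier_mat k ?n" and EY: "E = U * Y" using mat_factor_range[OF Ec U] R by auto
  obtain Z where Z: "Z \<in> carrier_mat ?n k" and UZ: "U = E * Z" using mat_factor_range[OF U Ec] R by auto
  have EU: "E * U = U"
  proof -
    have "E * U = (E * E) * Z" unfolding UZ using Ed Z by (intro mat_assoc[symmetric]) auto
    then show ?thesis by (simp add: EE flip: UZ)
  qed
  have VE: "V * E = Y" unfolding EY using Ud Vd Y by (intro mat_cancel_left[OF VU]) auto
  have X: "\<forall>g \<in> carrier G. \<exists>X \<in> carrier_mat k k. \<rho> g * U = U * X"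
  proof
    fix g assume g: "g \<in> carrier G"
    note rd = rep_dim[OF r(1) g]
    have "\<rho> g * U = \<rho> g * (E * U)" by (simp add: EU)
    also have "\<dots> = (E * \<rho> g) * U" unfolding E\<rho>[OF g] using rd Ed Ud by (intro mat_assoc[symmetric]) auto
    also have "\<dots> = E * (\<rho> g * U)" using rd Ed Ud by (intro mat_assoc) auto
    also have "\<dots> = U * (Y * (\<rho> g * U))" unfolding EY using rd Y Ud by (intro mat_assoc) auto
    finally show "\<exists>X \<in> carrier_mat k k. \<rho> g * U = U * X" using Y U rep_carrier[OF r(1) g] by auto
  qed
  define \<tau> where "\<tau> = (\<lambda>g. V * (\<rho> g * U))"
  note c = compression[OF r(1) U V VU X, folded \<tau>_def]
  have YU: "Y * U = 1\<^sub>m k"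
  proof -
    have "Y * U = V * (E * U)" unfolding VE[symmetric] using Vd Ed Ud by (intro mat_assoc) auto
    then show ?thesis by (simp add: EU VU)
  qed
  have q: "intertwiner \<rho> \<tau> Y"
    unfolding intertwiner_def c(2)
  proof (intro conjI ballI Y)
    fix g assume g: "g \<in> carrier G"
    note rd = rep_dim[OF r(1) g]
    have "Y * \<rho> g = V * (E * \<rho> g)" unfolding VE[symmetric] using Vd Ed rd by (intro mat_assoc) auto
    also have "\<dots> = V * (\<rho> g * (U * Y))" by (simp add: E\<rho>[OF g] flip: EY)
    also have "\<rho> g * (U * Y) = (\<rho> g * U) * Y" using rd Ud Y by (intro mat_assoc[symmetric]) auto
    also have "V * \<dots> = \<tau> g * Y" unfolding \<tau>_def using rd Ud Y Vd by (intro mat_assoc[symmetric]) auto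
    finally show "Y * \<rho> g = \<tau> g * Y" .
  qed
  have pU: "p * U = 0\<^sub>m (deg \<sigma>) k"
  proof -
    have "p * U = (p * E) * Z" unfolding UZ using pd Ed Z by (intro mat_assoc[symmetric]) auto
    then show ?thesis unfolding pE using Z by simp
  qed
  have Yi: "Y * i = 0\<^sub>m k (deg \<sigma>)"
  proof -
    have "Y * i = V * (E * i)" unfolding VE[symmetric] using Vd Ed id by (intro mat_assoc) auto
    then show ?thesis unfolding Ei using V by simp
  qed
  have "i * p + U * Y = 1\<^sub>m ?n"
    unfolding EY[symmetric] E_def using ic pc by (intro eq_matI) auto
  then show ?thesis
    unfolding biproduct_def using c i p pi q YU pU Yi by metis
qed

lemma hom_nonzeroI: "intertwiner \<rho> \<sigma> T \<Longrightarrow> T \<noteq> 0\<^sub>m (deg \<sigma>) (deg \<rho>) \<Longrightarrow> hom_nonzero \<rho> \<sigma>"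
  by (auto simp: hom_nonzero_def)

text \<open>Schur's lemma makes a nonzero map out of \<sigma> injective, Maschke's theorem makes its
  left inverse equivariant, and the complement is then a representation.\<close>

lemma extract_irreducible:
  assumes r: "representation G \<rho>" and \<sigma>: "irreducible_rep G \<sigma>" and h: "hom_nonzero \<sigma> \<rho>"
  shows "\<exists>\<tau> i p j q. representation G \<tau> \<and> biproduct \<rho> \<sigma> \<tau> i p j q"
proof -
  obtain T where T: "intertwiner \<sigma> \<rho> T" "T \<noteq> 0\<^sub>m (deg \<rho>) (deg \<sigma>)" using h by (auto simp: hom_nonzero_def)
  note r\<sigma> = irreducible_rep_representation[OF \<sigma>]
  obtain L where L: "L \<in> carrier_mat (deg \<sigma>) (deg \<rho>)" "L * T = 1\<^sub>m (deg \<sigma>)"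
    using schur_left_inverse[OF \<sigma> r T] by blast
  obtain p where "intertwiner \<rho> \<sigma> p" "p * T = 1\<^sub>m (deg \<sigma>)"
    using equivariant_left_inverse[OF r r\<sigma> T(1) L] by blast
  from biproduct_complement[OF r r\<sigma> T(1) this] show ?thesis by blast
qed

lemma hom_nonzero_biproduct_left:
  assumes r: "representation G \<rho>" "representation G \<tau>" "representation G \<mu>"
    and b: "biproduct \<rho> \<sigma> \<tau> i p j q" and h: "hom_nonzero \<mu> \<tau>"
  shows "hom_nonzero \<mu> \<rho>"
proof -
  obtain T where T: "intertwiner \<mu> \<tau> T" and nz: "T \<noteq> 0\<^sub>m (deg \<tau>) (deg \<mu>)" using h by (auto simp: hom_nonzero_def)
  have j: "intertwiner \<tau> \<rho> j" and q: "intertwiner \<rho> \<tau> q" and qj: "q * j = 1\<^sub>m (deg \<tau>)"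
    using b by (auto simp: biproduct_def)
  have "q * (j * T) = T"
    using intertwiner_dim[OF T] intertwiner_dim[OF j] intertwiner_dim[OF q] by (intro mat_cancel_left[OF qj]) auto
  then have "j * T \<noteq> 0\<^sub>m (deg \<rho>) (deg \<mu>)"
    using nz intertwiner_carrier[OF q] by (metis right_mult_zero_mat)
  then show ?thesis using intertwiner_mult[OF j T r(3,2,1)] by (rule hom_nonzeroI[rotated])
qed

text \<open>An intertwiner into \<rho> is \<open>i (p T) + j (q T)\<close>, so its two components
  cannot both vanish.\<close>

lemma hom_nonzero_biproduct:
  assumes r: "representation G \<rho>" "representation G \<sigma>" "representation G \<tau>" "representation G \<mu>"
    and b: "biproduct \<rho> \<sigma> \<tau> i p j q" and h: "hom_nonzero \<mu> \<rho>"
  shows "hom_nonzero \<mu> \<sigma> \<or> hom_nonzero \<mu> \<tau>"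
proof (rule ccontr)
  assume n: "\<not> ?thesis"
  obtain T where T: "intertwiner \<mu> \<rho> T" and nz: "T \<noteq> 0\<^sub>m (deg \<rho>) (deg \<mu>)" using h by (auto simp: hom_nonzero_def)
  have ij: "intertwiner \<sigma> \<rho> i" "intertwiner \<tau> \<rho> j" and p: "intertwiner \<rho> \<sigma> p" and q: "intertwiner \<rho> \<tau> q"
    and s: "i * p + j * q = 1\<^sub>m (deg \<rho>)"
    using b by (auto simp: biproduct_def)
  have "p * T = 0\<^sub>m (deg \<sigma>) (deg \<mu>)" "q * T = 0\<^sub>m (deg \<tau>) (deg \<mu>)"
    using n intertwiner_mult[OF p T r(4,1,2)] intertwiner_mult[OF q T r(4,1,3)] hom_nonzeroI by blast+
  note z = this
  note c = intertwiner_carrier[OF ij(1)] intertwiner_carrier[OF ij(2)] intertwiner_carrier[OF p]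
    intertwiner_carrier[OF q] intertwiner_carrier[OF T]
  have "T = (i * p + j * q) * T" unfolding s using c by simp
  also have "\<dots> = i * p * T + j * q * T" by (rule add_mult_distrib_mat) (use c in auto)
  also have "i * p * T = i * (p * T)" using c by (intro mat_assoc) auto
  also have "j * q * T = j * (q * T)" using c by (intro mat_assoc) auto
  finally have "T = 0\<^sub>m (deg \<rho>) (deg \<mu>)" unfolding z using c by simp
  with nz show False by simp
qed

lemma hom_nonzero_iso:
  assumes "rep_iso G \<mu> \<nu>" and h: "hom_nonzero \<mu> \<rho>"
    and r: "representation G \<mu>" "representation G \<nu>" "representation G \<rho>"
  shows "hom_nonzero \<nu> \<rho>"
proof -
  obtain P Q where P: "intertwiner \<mu> \<nu> P" and Q: "Q \<in> carrier_mat (deg \<mu>) (deg \<nu>)"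
    and QP: "Q * P = 1\<^sub>m (deg \<mu>)" and PQ: "P * Q = 1\<^sub>m (deg \<nu>)"
    using assms(1) unfolding rep_iso_iff by blast
  obtain T where T: "intertwiner \<mu> \<rho> T" and nz: "T \<noteq> 0\<^sub>m (deg \<rho>) (deg \<mu>)" using h by (auto simp: hom_nonzero_def)
  note c = intertwiner_carrier[OF P] Q intertwiner_carrier[OF T]
  have "T * Q * P = T * (Q * P)" using c by (intro mat_assoc) auto
  then have "T * Q * P = T" using QP c by simp
  then have "T * Q \<noteq> 0\<^sub>m (deg \<rho>) (deg \<nu>)" using nz c by (metis left_mult_zero_mat)
  moreover have "intertwiner \<nu> \<rho> (T * Q)"
    using intertwiner_mult[OF T intertwiner_inverse[OF P r(1,2) Q QP PQ] r(2,1,3)] .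
  ultimately show ?thesis using hom_nonzeroI by blast
qed

section \<open>Block-diagonal direct sums\<close>

lemma direct_sum_rep_Nil: "direct_sum_rep [] g = 0\<^sub>m 0 0"
  by (simp add: direct_sum_rep_def)

lemma direct_sum_rep_representation:
  assumes "\<forall>\<sigma> \<in> set \<sigma>s. representation G \<sigma>"
  shows "representation G (direct_sum_rep \<sigma>s) \<and> deg (direct_sum_rep \<sigma>s) = sum_list (map deg \<sigma>s)"
  using assms
proof (induction \<sigma>s)
  case Nil
  have "representation G (direct_sum_rep [])" "deg (direct_sum_rep []) = 0"
    by (rule_tac [!] representationI) (auto simp: direct_sum_rep_Nil)
  then show ?case by simp
next
  case (Cons \<sigma> \<sigma>s)
  define D where "D = direct_sum_rep \<sigma>s"
  have D: "representation G D" "deg D = sum_list (map deg \<sigma>s)" and \<sigma>: "representation G \<sigma>"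
    using Cons unfolding D_def by auto
  have eq: "direct_sum_rep (\<sigma> # \<sigma>s) g =
      four_block_mat (\<sigma> g) (0\<^sub>m (deg \<sigma>) (deg D)) (0\<^sub>m (deg D) (deg \<sigma>)) (D g)" if g: "g \<in> carrier G" for g
    using rep_dim[OF \<sigma> g] rep_dim[OF D(1) g] unfolding D_def direct_sum_rep_def by (simp add: Let_def)
  have "representation G (direct_sum_rep (\<sigma> # \<sigma>s))" "deg (direct_sum_rep (\<sigma> # \<sigma>s)) = deg \<sigma> + deg D"
  \<comment> \<open>Both conclusions of \<open>representationI\<close> have the same premises, so
    every premise arises twice and is discharged a second time by repeating it.\<close>
  proof (rule_tac [!] representationI)
    fix g assume g: "g \<in> carrier G"
    show "direct_sum_rep (\<sigma> # \<sigma>s) g \<in> carrier_mat (deg \<sigma> + deg D) (deg \<sigma> + deg D)"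
      unfolding eq[OF g] using rep_carrier[OF \<sigma> g] rep_carrier[OF D(1) g] by auto
    then show "direct_sum_rep (\<sigma> # \<sigma>s) g \<in> carrier_mat (deg \<sigma> + deg D) (deg \<sigma> + deg D)" .
    fix h assume h: "h \<in> carrier G"
    have "direct_sum_rep (\<sigma> # \<sigma>s) g * direct_sum_rep (\<sigma> # \<sigma>s) h =
      four_block_mat (\<sigma> g * \<sigma> h + 0\<^sub>m (deg \<sigma>) (deg D) * 0\<^sub>m (deg D) (deg \<sigma>))
        (\<sigma> g * 0\<^sub>m (deg \<sigma>) (deg D) + 0\<^sub>m (deg \<sigma>) (deg D) * D h)
        (0\<^sub>m (deg D) (deg \<sigma>) * \<sigma> h + D g * 0\<^sub>m (deg D) (deg \<sigma>))
        (0\<^sub>m (deg D) (deg \<sigma>) * 0\<^sub>m (deg \<sigma>) (deg D) + D g * D h)"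
      unfolding eq[OF g] eq[OF h]
      using rep_carrier[OF \<sigma> g] rep_carrier[OF D(1) g] rep_carrier[OF \<sigma> h] rep_carrier[OF D(1) h]
      by (intro mult_four_block_mat) auto
    also have "\<dots> = direct_sum_rep (\<sigma> # \<sigma>s) (g \<otimes> h)"
      unfolding eq[OF m_closed[OF g h]] rep_mult[OF \<sigma> g h] rep_mult[OF D(1) g h]
      using rep_carrier[OF \<sigma> g] rep_carrier[OF D(1) g] rep_carrier[OF \<sigma> h] rep_carrier[OF D(1) h]
      by (intro cong_four_block_mat) auto
    finally show "direct_sum_rep (\<sigma> # \<sigma>s) (g \<otimes> h) = direct_sum_rep (\<sigma> # \<sigma>s) g * direct_sum_rep (\<sigma> # \<sigma>s) h" ..
    then show "direct_sum_rep (\<sigma> # \<sigma>s) (g \<otimes> h) = direct_sum_rep (\<sigma> # \<sigma>s) g * direct_sum_rep (\<sigma> # \<sigma>s) h" .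
  next
    show "direct_sum_rep (\<sigma> # \<sigma>s) \<one> = 1\<^sub>m (deg \<sigma> + deg D)"
      by (simp add: eq rep_one[OF \<sigma>] rep_one[OF D(1)])
    then show "direct_sum_rep (\<sigma> # \<sigma>s) \<one> = 1\<^sub>m (deg \<sigma> + deg D)" .
  qed
  then show ?case using D(2) by simp
qed

context
  fixes \<sigma>s assumes reps: "\<forall>\<sigma> \<in> set \<sigma>s. representation G \<sigma>"
begin

lemma representation_direct_sum_rep: "representation G (direct_sum_rep \<sigma>s)"
  using direct_sum_rep_representation reps by blast

lemma deg_direct_sum_rep: "deg (direct_sum_rep \<sigma>s) = sum_list (map deg \<sigma>s)"
  using direct_sum_rep_representation reps by blast

lemma direct_sum_rep_Cons:
  assumes \<sigma>: "representation G \<sigma>" and g: "g \<in> carrier G"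
  shows "direct_sum_rep (\<sigma> # \<sigma>s) g =
      four_block_mat (\<sigma> g) (0\<^sub>m (deg \<sigma>) (deg (direct_sum_rep \<sigma>s))) (0\<^sub>m (deg (direct_sum_rep \<sigma>s)) (deg \<sigma>)) (direct_sum_rep \<sigma>s g)"
  using rep_dim[OF \<sigma> g] rep_dim[OF representation_direct_sum_rep g]
  by (simp add: Let_def direct_sum_rep_def)

end

lemma mat_trace_direct_sum_rep:
  assumes "\<forall>\<sigma> \<in> set \<sigma>s. representation G \<sigma>" and g: "g \<in> carrier G"
  shows "mat_trace (direct_sum_rep \<sigma>s g) = (\<Sum>\<sigma>\<leftarrow>\<sigma>s. mat_trace (\<sigma> g))"
  using assms(1)
proof (induction \<sigma>s)
  case Nil
  then show ?case by (simp add: direct_sum_rep_Nil mat_trace_def)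
next
  case (Cons \<sigma> \<sigma>s)
  have r: "representation G \<sigma>" "\<forall>\<sigma> \<in> set \<sigma>s. representation G \<sigma>" using Cons.prems by auto
  show ?case
    using Cons.IH[OF r(2)] direct_sum_rep_Cons[OF r(2,1) g]
      mat_trace_four_block[OF rep_carrier[OF r(1) g] rep_carrier[OF representation_direct_sum_rep[OF r(2)] g]]
    by simp
qed

text \<open>The alternative is uniform in \<open>g\<close>: a fixed position either lies outside the
  blocks or reads a fixed coefficient of one summand. Linear relations among coefficients of the
  summands therefore pass to the direct sum.\<close>

lemma direct_sum_rep_entry:
  assumes "\<forall>\<sigma> \<in> set \<sigma>s. representation G \<sigma>"
    and "r < deg (direct_sum_rep \<sigma>s)" "s < deg (direct_sum_rep \<sigma>s)"
  shows "(\<forall>g \<in> carrier G. direct_sum_rep \<sigma>s g $$ (r,s) = 0) \<or>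
     (\<exists>\<sigma> \<in> set \<sigma>s. \<exists>a < deg \<sigma>. \<exists>b < deg \<sigma>. \<forall>g \<in> carrier G. direct_sum_rep \<sigma>s g $$ (r,s) = \<sigma> g $$ (a,b))"
  using assms
proof (induction \<sigma>s arbitrary: r s)
  case Nil
  then show ?case using deg_direct_sum_rep[of "[]"] by simp
next
  case (Cons \<sigma> \<sigma>s)
  have rp: "representation G \<sigma>" "\<forall>\<sigma> \<in> set \<sigma>s. representation G \<sigma>" using Cons.prems(1) by auto
  let ?n = "deg \<sigma>" and ?m = "deg (direct_sum_rep \<sigma>s)"
  have m: "deg (direct_sum_rep (\<sigma> # \<sigma>s)) = ?n + ?m"
    using deg_direct_sum_rep[of "\<sigma> # \<sigma>s"] deg_direct_sum_rep[of \<sigma>s] Cons.prems(1) by auto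
  have eq: "direct_sum_rep (\<sigma> # \<sigma>s) g $$ (r,s) =
     (if r < ?n then if s < ?n then \<sigma> g $$ (r,s) else 0 else
        if s < ?n then 0 else direct_sum_rep \<sigma>s g $$ (r - ?n, s - ?n))" if g: "g \<in> carrier G" for g
    using Cons.prems(2,3) rep_dim[OF rp(1) g] rep_dim[OF representation_direct_sum_rep[OF rp(2)] g]
    unfolding direct_sum_rep_Cons[OF rp(2,1) g] m by auto
  consider "r < ?n" "s < ?n" | "r < ?n \<longleftrightarrow> \<not> s < ?n" | "\<not> r < ?n" "\<not> s < ?n" by blast
  then show ?case
  proof cases
    case 1
    then show ?thesis using eq by (intro disjI2 bexI[of _ \<sigma>]) auto
  next
    case 2
    then show ?thesis using eq by auto
  next
    case 3
    then have lt: "r - ?n < ?m" "s - ?n < ?m" using Cons.prems(2,3) m by auto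
    show ?thesis using Cons.IH[OF rp(2) lt] eq 3 by (metis list.set_intros(2))
  qed
qed


lemma rep_iso_direct_sum_Cons:
  assumes r: "representation G \<rho>" "representation G \<sigma>" "representation G \<tau>"
    and rs: "\<forall>\<sigma> \<in> set \<sigma>s. representation G \<sigma>"
    and b: "biproduct \<rho> \<sigma> \<tau> i p j q" and iso: "rep_iso G \<tau> (direct_sum_rep \<sigma>s)"
  shows "rep_iso G \<rho> (direct_sum_rep (\<sigma> # \<sigma>s))"
proof -
  define D where "D = direct_sum_rep \<sigma>s"
  have D: "representation G D" unfolding D_def by (rule representation_direct_sum_rep[OF rs])
  have dD: "deg (direct_sum_rep (\<sigma> # \<sigma>s)) = deg \<sigma> + deg D"
    unfolding D_def using deg_direct_sum_rep[of "\<sigma> # \<sigma>s"] deg_direct_sum_rep[of \<sigma>s] rs r by simp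
  obtain P Q where P: "intertwiner \<tau> D P" and Q: "Q \<in> carrier_mat (deg \<tau>) (deg D)"
    and QP: "Q * P = 1\<^sub>m (deg \<tau>)" and PQ: "P * Q = 1\<^sub>m (deg D)"
    using iso unfolding rep_iso_iff D_def[symmetric] by blast
  have i: "intertwiner \<sigma> \<rho> i" and p: "intertwiner \<rho> \<sigma> p" and j: "intertwiner \<tau> \<rho> j" and q: "intertwiner \<rho> \<tau> q"
    and eqs: "p * i = 1\<^sub>m (deg \<sigma>)" "q * j = 1\<^sub>m (deg \<tau>)" "p * j = 0\<^sub>m (deg \<sigma>) (deg \<tau>)"
     "q * i = 0\<^sub>m (deg \<tau>) (deg \<sigma>)" "i * p + j * q = 1\<^sub>m (deg \<rho>)"
    using b by (auto simp: biproduct_def)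
  note c = intertwiner_carrier[OF i] intertwiner_carrier[OF p] intertwiner_carrier[OF j]
    intertwiner_carrier[OF q] intertwiner_carrier[OF P] Q
  note cd = c[THEN carrier_matD(1)] c[THEN carrier_matD(2)]
  define q' where "q' = P * q"
  define j' where "j' = j * Q"
  have q': "intertwiner \<rho> D q'" unfolding q'_def by (rule intertwiner_mult[OF P q r(1,3) D])
  have j'c: "j' \<in> carrier_mat (deg \<rho>) (deg D)" unfolding j'_def using c by auto
  have q'c: "q' \<in> carrier_mat (deg D) (deg \<rho>)" by (rule intertwiner_carrier[OF q'])
  have e1: "q' * j' = 1\<^sub>m (deg D)"
  proof -
    have "q' * j' = P * (q * (j * Q))" unfolding q'_def j'_def using cd by (simp add: mat_assoc)
    also have "q * (j * Q) = Q" using cd by (intro mat_cancel_left[OF eqs(2)]) auto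
    finally show ?thesis using PQ by simp
  qed
  have e2: "p * j' = 0\<^sub>m (deg \<sigma>) (deg D)"
  proof -
    have "p * j' = p * j * Q" unfolding j'_def using cd by (simp add: mat_assoc)
    then show ?thesis unfolding eqs using Q by simp
  qed
  have e3: "q' * i = 0\<^sub>m (deg D) (deg \<sigma>)"
  proof -
    have "q' * i = P * (q * i)" unfolding q'_def using cd by (simp add: mat_assoc)
    then show ?thesis unfolding eqs using c by simp
  qed
  have e4: "i * p + j' * q' = 1\<^sub>m (deg \<rho>)"
  proof -
    have "j' * q' = j * (Q * (P * q))" unfolding q'_def j'_def using cd by (simp add: mat_assoc)
    also have "Q * (P * q) = q" using cd by (intro mat_cancel_left[OF QP]) auto
    finally show ?thesis using eqs by simp
  qed
  let ?n = "deg \<rho>" and ?a = "deg \<sigma>" and ?m = "deg D"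
  \<comment> \<open>\<open>A\<close> stacks \<open>p\<close> on \<open>q'\<close> and
    \<open>B\<close> puts \<open>i\<close> beside \<open>j'\<close>, again by means of empty blocks;
    the biproduct equations say that they are mutually inverse.\<close>
  define A where "A = four_block_mat p (0\<^sub>m ?a 0) q' (0\<^sub>m ?m 0)"
  define B where "B = four_block_mat i j' (0\<^sub>m 0 ?a) (0\<^sub>m 0 ?m)"
  have "A * B = four_block_mat (p * i + 0\<^sub>m ?a 0 * 0\<^sub>m 0 ?a) (p * j' + 0\<^sub>m ?a 0 * 0\<^sub>m 0 ?m)
      (q' * i + 0\<^sub>m ?m 0 * 0\<^sub>m 0 ?a) (q' * j' + 0\<^sub>m ?m 0 * 0\<^sub>m 0 ?m)"
    unfolding A_def B_def by (rule mult_four_block_mat) (use c j'c q'c in auto)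
  also have "\<dots> = four_block_mat (1\<^sub>m ?a) (0\<^sub>m ?a ?m) (0\<^sub>m ?m ?a) (1\<^sub>m ?m)"
    unfolding e1 e2 e3 eqs by (intro cong_four_block_mat) auto
  finally have AB: "A * B = 1\<^sub>m (?a + ?m)" by simp
  have "B * A = four_block_mat (i * p + j' * q') (i * 0\<^sub>m ?a 0 + j' * 0\<^sub>m ?m 0)
      (0\<^sub>m 0 ?a * p + 0\<^sub>m 0 ?m * q') (0\<^sub>m 0 ?a * 0\<^sub>m ?a 0 + 0\<^sub>m 0 ?m * 0\<^sub>m ?m 0)"
    unfolding A_def B_def by (rule mult_four_block_mat) (use c j'c q'c in auto)
  also have "\<dots> = four_block_mat (1\<^sub>m ?n) (0\<^sub>m ?n 0) (0\<^sub>m 0 ?n) (0\<^sub>m 0 0)"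
    unfolding e4 using c j'c q'c by (intro cong_four_block_mat) auto
  also have "\<dots> = 1\<^sub>m ?n" by (rule four_block_mat_zero_dim) simp
  finally have BA: "B * A = 1\<^sub>m ?n" .
  have Ac: "A \<in> carrier_mat (?a + ?m) ?n" and Bc: "B \<in> carrier_mat ?n (?a + ?m)"
    unfolding A_def B_def using c j'c q'c by auto
  have "intertwiner \<rho> (direct_sum_rep (\<sigma> # \<sigma>s)) A"
    unfolding intertwiner_def dD
  proof (intro conjI ballI Ac)
    fix g assume g: "g \<in> carrier G"
    note rc = rep_carrier[OF r(1) g] rep_carrier[OF r(2) g] rep_carrier[OF D g]
    have "A * \<rho> g = A * four_block_mat (\<rho> g) (0\<^sub>m ?n 0) (0\<^sub>m 0 ?n) (0\<^sub>m 0 0)"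
      using four_block_mat_zero_dim[OF rc(1)] by simp
    also have "\<dots> = four_block_mat (p * \<rho> g + 0\<^sub>m ?a 0 * 0\<^sub>m 0 ?n) (p * 0\<^sub>m ?n 0 + 0\<^sub>m ?a 0 * 0\<^sub>m 0 0)
        (q' * \<rho> g + 0\<^sub>m ?m 0 * 0\<^sub>m 0 ?n) (q' * 0\<^sub>m ?n 0 + 0\<^sub>m ?m 0 * 0\<^sub>m 0 0)"
      unfolding A_def by (rule mult_four_block_mat) (use c q'c rc in auto)
    also have "\<dots> = four_block_mat (\<sigma> g * p + 0\<^sub>m ?a ?m * q') (\<sigma> g * 0\<^sub>m ?a 0 + 0\<^sub>m ?a ?m * 0\<^sub>m ?m 0)
        (0\<^sub>m ?m ?a * p + D g * q') (0\<^sub>m ?m ?a * 0\<^sub>m ?a 0 + D g * 0\<^sub>m ?m 0)"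
      unfolding intertwinerD[OF p g] intertwinerD[OF q' g]
      using c q'c rc by (intro cong_four_block_mat) auto
    also have "\<dots> = four_block_mat (\<sigma> g) (0\<^sub>m ?a ?m) (0\<^sub>m ?m ?a) (D g) * A"
      unfolding A_def by (rule mult_four_block_mat[symmetric]) (use c q'c rc in auto)
    also have "four_block_mat (\<sigma> g) (0\<^sub>m ?a ?m) (0\<^sub>m ?m ?a) (D g) = direct_sum_rep (\<sigma> # \<sigma>s) g"
      unfolding D_def by (rule direct_sum_rep_Cons[OF rs r(2) g, symmetric])
    finally show "A * \<rho> g = direct_sum_rep (\<sigma> # \<sigma>s) g * A" .
  qed
  then show ?thesis unfolding rep_iso_iff dD using Bc AB BA by blast
qed

text \<open>Obtained from the isomorphism with the two-block sum of \<sigma> and \<tau>, since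
  isomorphic representations have equal degrees.\<close>

lemma deg_biproduct:
  assumes r: "representation G \<rho>" "representation G \<sigma>" "representation G \<tau>"
    and b: "biproduct \<rho> \<sigma> \<tau> i p j q"
  shows "deg \<rho> = deg \<sigma> + deg \<tau>"
proof -
  have "rep_iso G \<tau> (direct_sum_rep [\<tau>])"
  proof -
    have "direct_sum_rep [\<tau>] = \<tau>"
      by (rule ext) (simp only: direct_sum_rep_def list.map diag_block_mat_singleton)
    then show ?thesis using rep_iso_refl[OF r(3)] by simp
  qed
  from rep_iso_deg[OF rep_iso_direct_sum_Cons[OF r _ b this]] r(2,3)
  show ?thesis using deg_direct_sum_rep[of "[\<sigma>, \<tau>]"] by simp
qed

lemma rep_iso_direct_sum_Nil:
  assumes "representation G \<rho>" and "deg \<rho> = 0"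
  shows "rep_iso G \<rho> (direct_sum_rep [])"
proof -
  have d: "deg (direct_sum_rep []) = 0" using deg_direct_sum_rep[of "[]"] by simp
  have "intertwiner \<rho> (direct_sum_rep []) (0\<^sub>m 0 0)"
    unfolding intertwiner_def d assms(2) using rep_dim[OF assms(1)] assms(2)
    by (auto simp: direct_sum_rep_Nil intro!: eq_matI)
  moreover have "0\<^sub>m 0 0 * 0\<^sub>m 0 0 = (1\<^sub>m 0 :: complex mat)" by (intro eq_matI) auto
  ultimately show ?thesis unfolding rep_iso_iff d assms(2) using zero_carrier_mat by blast
qed

section \<open>Decomposition into irreducibles\<close>

lemma irreducible_deg_pos: "irreducible_rep G \<sigma> \<Longrightarrow> 0 < deg \<sigma>"
  by (simp add: irreducible_rep_def)

lemma exists_irreducible_hom_nonzero: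
  assumes "representation G \<rho>" "deg \<rho> \<noteq> 0"
  shows "\<exists>\<sigma>. irreducible_rep G \<sigma> \<and> hom_nonzero \<sigma> \<rho>"
proof -
  obtain \<sigma> T L where \<sigma>: "irreducible_rep G \<sigma>" and T: "intertwiner \<sigma> \<rho> T"
    and L: "L \<in> carrier_mat (deg \<sigma>) (deg \<rho>)" and LT: "L * T = 1\<^sub>m (deg \<sigma>)"
    using exists_irreducible_hom[OF assms] by blast
  have "T \<noteq> 0\<^sub>m (deg \<rho>) (deg \<sigma>)"
  proof
    assume "T = 0\<^sub>m (deg \<rho>) (deg \<sigma>)"
    then have "(1\<^sub>m (deg \<sigma>) :: complex mat) $$ (0,0) = 0\<^sub>m (deg \<sigma>) (deg \<sigma>) $$ (0,0)" using LT L by simp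
    then show False using irreducible_deg_pos[OF \<sigma>] by simp
  qed
  then show ?thesis using \<sigma> T hom_nonzeroI by blast
qed

definition covers_irreps :: "('a \<Rightarrow> complex mat) list \<Rightarrow> bool" where
  "covers_irreps \<sigma>s \<longleftrightarrow> (\<forall>\<sigma> \<in> set \<sigma>s. irreducible_rep G \<sigma>) \<and>
     (\<forall>\<sigma>. irreducible_rep G \<sigma> \<longrightarrow> (\<exists>\<tau> \<in> set \<sigma>s. rep_iso G \<sigma> \<tau>))"

text \<open>Sortedness matches the block order in \<open>mckay_matrix\<close>. The clause about
  \<open>hom_nonzero\<close> strengthens the induction: constituents of the complement are
  constituents of \<rho>, so their indices are at least the one split off first.\<close>

lemma decomposition:
  assumes cov: "covers_irreps \<sigma>s"
  shows "representation G \<rho> \<Longrightarrow>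
    \<exists>js. sorted js \<and> set js \<subseteq> {..<length \<sigma>s} \<and> (\<forall>j \<in> set js. hom_nonzero (\<sigma>s ! j) \<rho>) \<and>
         rep_iso G \<rho> (direct_sum_rep (map ((!) \<sigma>s) js))"
proof (induction "deg \<rho>" arbitrary: \<rho> rule: less_induct)
  case less
  note r = less.prems
  have irr: "irreducible_rep G (\<sigma>s ! j)" if "j < length \<sigma>s" for j
    using cov that unfolding covers_irreps_def by auto
  show ?case
  proof (cases "deg \<rho> = 0")
    case True
    then show ?thesis using rep_iso_direct_sum_Nil[OF r] by (intro exI[of _ "[]"]) simp
  next
    case False
    \<comment> \<open>Splitting off the constituent of least index first yields a sorted list, so that no reordering
      of the diagonal blocks is needed.\<close>
    let ?P = "\<lambda>j. j < length \<sigma>s \<and> hom_nonzero (\<sigma>s ! j) \<rho>"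
    obtain \<sigma> where \<sigma>: "irreducible_rep G \<sigma>" "hom_nonzero \<sigma> \<rho>"
      using exists_irreducible_hom_nonzero[OF r False] by blast
    obtain \<tau> where \<tau>: "\<tau> \<in> set \<sigma>s" "rep_iso G \<sigma> \<tau>" using cov \<sigma>(1) unfolding covers_irreps_def by blast
    have "hom_nonzero \<tau> \<rho>"
      using hom_nonzero_iso[OF \<tau>(2) \<sigma>(2)] r \<sigma>(1) \<tau>(1) cov irreducible_rep_representation
      unfolding covers_irreps_def by blast
    then have ex: "\<exists>j. ?P j" using \<tau>(1) by (metis in_set_conv_nth)
    define j where "j = (LEAST j. ?P j)"
    have j: "?P j" unfolding j_def by (rule LeastI_ex[OF ex])
    have least: "j \<le> k" if "?P k" for k unfolding j_def using that by (rule Least_le)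
    note rj = irreducible_rep_representation[OF irr]
    obtain \<tau>' i p j' q where \<tau>': "representation G \<tau>'" and b: "biproduct \<rho> (\<sigma>s ! j) \<tau>' i p j' q"
      using extract_irreducible[OF r irr] j by blast
    have "deg \<tau>' < deg \<rho>"
      using deg_biproduct[OF r rj \<tau>' b] j irreducible_deg_pos[OF irr] by simp
    from less.hyps[OF this \<tau>'] obtain js where js: "sorted js" "set js \<subseteq> {..<length \<sigma>s}"
      "\<forall>k \<in> set js. hom_nonzero (\<sigma>s ! k) \<tau>'" "rep_iso G \<tau>' (direct_sum_rep (map ((!) \<sigma>s) js))" by blast
    have h: "hom_nonzero (\<sigma>s ! k) \<rho>" if "k \<in> set js" for k
      using hom_nonzero_biproduct_left[OF r \<tau>' rj b] js that by auto
    have rs: "\<forall>\<sigma> \<in> set (map ((!) \<sigma>s) js). representation G \<sigma>" using rj js(2) by auto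
    have iso: "rep_iso G \<rho> (direct_sum_rep (map ((!) \<sigma>s) (j # js)))"
      using rep_iso_direct_sum_Cons[OF r rj \<tau>' rs b js(4)] j by simp
    have "sorted (j # js)" using js h least by auto
    then show ?thesis using iso js(2) j h by (intro exI[of _ "j # js"]) auto
  qed
qed

text \<open>\<open>decomposition\<close> presupposes a list of all irreducibles; this lemma serves
  to construct one. After splitting off \<sigma>, an irreducible constituent of \<rho> maps
  nontrivially to \<sigma>, hence is isomorphic to it, or to the smaller complement.\<close>

lemma finitely_many_irreducible_constituents:
  "representation G \<rho> \<Longrightarrow> \<exists>xs. (\<forall>\<sigma> \<in> set xs. irreducible_rep G \<sigma>) \<and>
     (\<forall>\<sigma>. irreducible_rep G \<sigma> \<longrightarrow> hom_nonzero \<sigma> \<rho> \<longrightarrow> (\<exists>\<tau> \<in> set xs. rep_iso G \<sigma> \<tau>))"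
proof (induction "deg \<rho>" arbitrary: \<rho> rule: less_induct)
  case less
  note r = less.prems
  show ?case
  proof (cases "deg \<rho> = 0")
    case True
    have "\<not> hom_nonzero \<sigma> \<rho>" for \<sigma>
    proof
      assume "hom_nonzero \<sigma> \<rho>"
      then obtain T where "T \<in> carrier_mat 0 (deg \<sigma>)" "T \<noteq> 0\<^sub>m 0 (deg \<sigma>)"
        using True unfolding hom_nonzero_def intertwiner_def by auto
      moreover from this(1) have "T = 0\<^sub>m 0 (deg \<sigma>)" by (intro eq_matI) auto
      ultimately show False by simp
    qed
    then show ?thesis by (intro exI[of _ "[]"]) simp
  next
    case False
    obtain \<sigma> where \<sigma>: "irreducible_rep G \<sigma>" "hom_nonzero \<sigma> \<rho>"
      using exists_irreducible_hom_nonzero[OF r False] by blast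
    note r\<sigma> = irreducible_rep_representation[OF \<sigma>(1)]
    obtain \<tau> i p j q where \<tau>: "representation G \<tau>" and b: "biproduct \<rho> \<sigma> \<tau> i p j q"
      using extract_irreducible[OF r \<sigma>] by blast
    have "deg \<tau> < deg \<rho>" using deg_biproduct[OF r r\<sigma> \<tau> b] irreducible_deg_pos[OF \<sigma>(1)] by simp
    from less.hyps[OF this \<tau>] obtain xs where xs: "\<forall>\<sigma> \<in> set xs. irreducible_rep G \<sigma>"
      "\<And>\<mu>. irreducible_rep G \<mu> \<Longrightarrow> hom_nonzero \<mu> \<tau> \<Longrightarrow> \<exists>\<tau> \<in> set xs. rep_iso G \<mu> \<tau>" by blast
    have "\<exists>\<nu> \<in> set (\<sigma> # xs). rep_iso G \<mu> \<nu>" if \<mu>: "irreducible_rep G \<mu>" "hom_nonzero \<mu> \<rho>" for \<mu>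
      using hom_nonzero_biproduct[OF r r\<sigma> \<tau> irreducible_rep_representation[OF \<mu>(1)] b \<mu>(2)]
        schur_iso[OF \<mu>(1) \<sigma>(1)] xs(2)[OF \<mu>(1)] by auto
    then show ?thesis using xs(1) \<sigma>(1) by (intro exI[of _ "\<sigma> # xs"]) auto
  qed
qed

section \<open>The regular representation\<close>

definition enum :: "nat \<Rightarrow> 'a" where
  "enum = (SOME e. bij_betw e {0..<card (carrier G)} (carrier G))"

lemma bij_enum: "bij_betw enum {0..<card (carrier G)} (carrier G)"
  unfolding enum_def by (rule someI_ex[OF ex_bij_betw_nat_finite[OF fin]])

lemma enum_closed: "i < card (carrier G) \<Longrightarrow> enum i \<in> carrier G"
  using bij_betwE[OF bij_enum] by simp

lemma sum_enum: "(\<Sum>i\<in>{0..<card (carrier G)}. f (enum i)) = (\<Sum>g\<in>carrier G. f g)"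
  by (rule sum.reindex_bij_betw[OF bij_enum])

definition regular_rep :: "'a \<Rightarrow> complex mat" where
  "regular_rep g = mat (card (carrier G)) (card (carrier G))
     (\<lambda>(i,j). if enum i = g \<otimes> enum j then 1 else 0)"

lemma regular_rep_representation: "representation G regular_rep" "deg regular_rep = card (carrier G)"
proof (rule_tac [!] representationI)
  let ?N = "card (carrier G)"
  show "regular_rep g \<in> carrier_mat ?N ?N" for g by (simp add: regular_rep_def)
  then show "regular_rep g \<in> carrier_mat ?N ?N" for g .
  have inj: "enum i = enum j \<longleftrightarrow> i = j" if "i < ?N" "j < ?N" for i j
    using bij_enum that unfolding bij_betw_def inj_on_def by auto
  show "regular_rep \<one> = 1\<^sub>m ?N"
    by (rule eq_matI) (auto simp: regular_rep_def inj enum_closed)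
  then show "regular_rep \<one> = 1\<^sub>m ?N" .
  fix g h assume gh: "g \<in> carrier G" "h \<in> carrier G"
  show "regular_rep (g \<otimes> h) = regular_rep g * regular_rep h"
  proof (rule eq_matI)
    fix i j assume "i < dim_row (regular_rep g * regular_rep h)" "j < dim_col (regular_rep g * regular_rep h)"
    then have ij: "i < ?N" "j < ?N" by (auto simp: regular_rep_def)
    have "(regular_rep g * regular_rep h) $$ (i,j) =
       (\<Sum>k\<in>{0..<?N}. (if enum i = g \<otimes> enum k then 1 else 0) * (if enum k = h \<otimes> enum j then 1 else 0))"
      using ij by (auto simp: regular_rep_def scalar_prod_def)
    also have "\<dots> = (\<Sum>x\<in>carrier G. (if enum i = g \<otimes> x then 1 else 0) * (if x = h \<otimes> enum j then 1 else 0))"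
      by (rule sum_enum)
    also have "\<dots> = (\<Sum>x\<in>carrier G. if x = h \<otimes> enum j then (if enum i = g \<otimes> x then 1 else 0) else 0)"
      by (rule sum.cong) auto
    also have "\<dots> = (if enum i = g \<otimes> (h \<otimes> enum j) then 1 else 0)"
      using fin gh enum_closed[OF ij(2)] by (subst sum.delta) auto
    also have "\<dots> = regular_rep (g \<otimes> h) $$ (i,j)"
      using ij gh enum_closed[OF ij(2)] by (simp add: regular_rep_def m_assoc)
    finally show "regular_rep (g \<otimes> h) $$ (i,j) = (regular_rep g * regular_rep h) $$ (i,j)" ..
  qed (auto simp: regular_rep_def)
  then show "regular_rep (g \<otimes> h) = regular_rep g * regular_rep h" .
qed

text \<open>Left translation by an element other than \<one> has no fixed point.\<close>

lemma mat_trace_regular_rep: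
  assumes g: "g \<in> carrier G"
  shows "mat_trace (regular_rep g) = (if g = \<one> then of_nat (card (carrier G)) else 0)"
proof -
  have "mat_trace (regular_rep g) = (\<Sum>i\<in>{0..<card (carrier G)}. if g = \<one> then 1 else 0)"
    unfolding mat_trace_def
  proof (rule sum.cong)
    fix i assume "i \<in> {0..<card (carrier G)}"
    then show "regular_rep g $$ (i,i) = (if g = \<one> then 1 else 0)"
      using enum_closed[of i] g r_cancel_one'[of "enum i" g] l_cancel_one'[of "enum i" g] by (auto simp: regular_rep_def)
  qed (simp add: regular_rep_def)
  then show ?thesis by simp
qed

text \<open>The trace already separates \<one> from the other elements; apply this to
  \<open>inv h \<otimes> g\<close>.\<close>

lemma faithful_regular_rep: "faithful_rep G regular_rep"
  unfolding faithful_rep_def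
proof (intro conjI regular_rep_representation inj_onI)
  fix g h assume gh: "g \<in> carrier G" "h \<in> carrier G" "regular_rep g = regular_rep h"
  have "regular_rep (inv h \<otimes> g) = regular_rep (inv h \<otimes> h)"
    using gh(3) rep_mult[OF regular_rep_representation(1) inv_closed[OF gh(2)] gh(1)]
      rep_mult[OF regular_rep_representation(1) inv_closed[OF gh(2)] gh(2)] by (simp only:)
  then have "mat_trace (regular_rep (inv h \<otimes> g)) = of_nat (card (carrier G))"
    using gh by (simp add: mat_trace_regular_rep)
  then have "inv h \<otimes> g = \<one>" using gh card_carrier_pos by (auto simp: mat_trace_regular_rep split: if_splits)
  then show "g = h" using gh by (metis inv_closed inv_equality inv_inv)
qed

lemma hom_nonzero_regular_rep:
  assumes \<sigma>: "irreducible_rep G \<sigma>"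
  shows "hom_nonzero \<sigma> regular_rep"
proof (rule hom_nonzeroI)
  let ?N = "card (carrier G)"
  note r = irreducible_rep_representation[OF \<sigma>] and d = irreducible_deg_pos[OF \<sigma>]
  \<comment> \<open>\<open>T\<close> sends a vector \<open>v\<close> to the function on the group
    whose value at \<open>x\<close> is the first coordinate of
    \<open>\<sigma> (inv x) *\<^sub>v v\<close>. It is nonzero because the first unit vector gives
    the value 1 at \<one>.\<close>
  define T where "T = mat ?N (deg \<sigma>) (\<lambda>(i,b). \<sigma> (inv (enum i)) $$ (0,b))"
  have Tc: "T \<in> carrier_mat ?N (deg \<sigma>)" by (simp add: T_def)
  show "intertwiner \<sigma> regular_rep T"
    unfolding intertwiner_def regular_rep_representation(2)
  proof (intro conjI ballI Tc)
    fix g assume g: "g \<in> carrier G"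
    show "T * \<sigma> g = regular_rep g * T"
    proof (rule eq_matI)
      fix i b assume "i < dim_row (regular_rep g * T)" "b < dim_col (regular_rep g * T)"
      then have ib: "i < ?N" "b < deg \<sigma>" by (auto simp: regular_rep_def T_def)
      note e = enum_closed[OF ib(1)]
      have "(T * \<sigma> g) $$ (i,b) = (\<sigma> (inv (enum i)) * \<sigma> g) $$ (0,b)"
        using ib d rep_carrier[OF r g] rep_carrier[OF r inv_closed[OF e]]
        by (auto simp: T_def scalar_prod_def)
      also have "\<dots> = \<sigma> (inv (enum i) \<otimes> g) $$ (0,b)" using e g by (simp add: rep_mult[OF r])
      finally have L: "(T * \<sigma> g) $$ (i,b) = \<sigma> (inv (enum i) \<otimes> g) $$ (0,b)" .
      have "(regular_rep g * T) $$ (i,b) =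
          (\<Sum>k\<in>{0..<?N}. (if enum i = g \<otimes> enum k then 1 else 0) * \<sigma> (inv (enum k)) $$ (0,b))"
        using ib by (auto simp: regular_rep_def T_def scalar_prod_def)
      also have "\<dots> = (\<Sum>x\<in>carrier G. (if enum i = g \<otimes> x then 1 else 0) * \<sigma> (inv x) $$ (0,b))"
        by (rule sum_enum)
      also have "\<dots> = (\<Sum>x\<in>carrier G. if x = inv g \<otimes> enum i then \<sigma> (inv x) $$ (0,b) else 0)"
        using g e by (intro sum.cong) (auto simp: inv_solve_left)
      also have "\<dots> = \<sigma> (inv (inv g \<otimes> enum i)) $$ (0,b)" using fin g e by (subst sum.delta) auto
      also have "inv (inv g \<otimes> enum i) = inv (enum i) \<otimes> g" using g e by (simp add: inv_mult_group)
      finally show "(T * \<sigma> g) $$ (i,b) = (regular_rep g * T) $$ (i,b)" using L by simp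
    qed (use Tc rep_carrier[OF r g] in \<open>auto simp: regular_rep_def\<close>)
  qed
  show "T \<noteq> 0\<^sub>m (deg regular_rep) (deg \<sigma>)"
  proof
    assume T0: "T = 0\<^sub>m (deg regular_rep) (deg \<sigma>)"
    obtain i where i: "i < ?N" "enum i = \<one>"
      using bij_enum unfolding bij_betw_def by (metis atLeastLessThan_iff imageE one_closed)
    then have "T $$ (i,0) = 1" unfolding T_def using d by (simp add: rep_one[OF r])
    then show False unfolding T0 regular_rep_representation(2) using i d by simp
  qed
qed

lemma representation_trivial_rep: "representation G trivial_rep" "deg trivial_rep = 1"
  by (rule_tac [!] representationI) (auto simp: trivial_rep_def)

lemma irreducible_trivial_rep: "irreducible_rep G trivial_rep"
  unfolding irreducible_rep_def representation_trivial_rep(2)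
proof (intro conjI allI impI representation_trivial_rep)
  fix W assume "invariant_subspace G trivial_rep W"
  then have W: "W \<subseteq> carrier_vec 1" "0\<^sub>v 1 \<in> W" "\<forall>c. \<forall>v\<in>W. c \<cdot>\<^sub>v v \<in> W"
    unfolding invariant_subspace_def representation_trivial_rep(2) subspace_module_vec_iff by blast+
  show "W = {0\<^sub>v 1} \<or> W = carrier_vec 1"
  proof (rule disjCI)
    assume "W \<noteq> carrier_vec 1"
    then obtain v where v: "v \<in> carrier_vec 1" "v \<notin> W" using W by auto
    have "w = 0\<^sub>v 1" if w: "w \<in> W" for w
    proof (rule ccontr)
      assume nz: "w \<noteq> 0\<^sub>v 1"
      have wc: "w \<in> carrier_vec 1" using w W by auto
      have "w $ 0 \<noteq> 0"
      proof
        assume "w $ 0 = 0"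
        then have "w = 0\<^sub>v 1" using wc by (intro eq_vecI) auto
        then show False using nz by simp
      qed
      then have "v = (v $ 0 / w $ 0) \<cdot>\<^sub>v w" using v wc by (intro eq_vecI) auto
      moreover have "(v $ 0 / w $ 0) \<cdot>\<^sub>v w \<in> W" using W(3) w by blast
      ultimately show False using v(2) by simp
    qed
    then show "W = {0\<^sub>v 1}" using W(2) by blast
  qed
qed simp

section \<open>Existence of a complete list of irreducibles\<close>

lemma distinct_representatives:
  assumes "irreducible_rep G \<sigma>0" and "\<forall>\<sigma> \<in> set xs. irreducible_rep G \<sigma>"
  shows "\<exists>ys. ys \<noteq> [] \<and> hd ys = \<sigma>0 \<and> (\<forall>\<sigma> \<in> set ys. irreducible_rep G \<sigma>) \<and>
     (\<forall>i < length ys. \<forall>j < length ys. rep_iso G (ys ! i) (ys ! j) \<longrightarrow> i = j) \<and>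
     (\<forall>\<sigma> \<in> set xs. \<exists>\<tau> \<in> set ys. rep_iso G \<sigma> \<tau>)"
  using assms(2)
proof (induction xs)
  case Nil
  show ?case using assms(1) by (intro exI[of _ "[\<sigma>0]"]) auto
next
  case (Cons x xs)
  then obtain ys where ys: "ys \<noteq> []" "hd ys = \<sigma>0" "\<forall>\<sigma> \<in> set ys. irreducible_rep G \<sigma>"
     "\<forall>i < length ys. \<forall>j < length ys. rep_iso G (ys ! i) (ys ! j) \<longrightarrow> i = j"
     "\<forall>\<sigma> \<in> set xs. \<exists>\<tau> \<in> set ys. rep_iso G \<sigma> \<tau>" by auto
  have x: "irreducible_rep G x" using Cons.prems by simp
  show ?case
  proof (cases "\<exists>\<tau> \<in> set ys. rep_iso G x \<tau>")
    case True
    then show ?thesis using ys by (intro exI[of _ ys]) auto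
  next
    case False
    have n: "\<not> rep_iso G (ys ! i) x" if "i < length ys" for i
      using False rep_iso_sym ys(3) that x irreducible_rep_representation by (metis nth_mem)
    have "i = j" if ij: "i < length (ys @ [x])" "j < length (ys @ [x])" "rep_iso G ((ys @ [x]) ! i) ((ys @ [x]) ! j)" for i j
    proof -
      consider "i < length ys" "j < length ys" | "i < length ys" "j = length ys" | "i = length ys" "j < length ys" | "i = j"
        using ij(1,2) by fastforce
      then show ?thesis
      proof cases
        case 1
        then show ?thesis using ij(3) ys(4) by (simp add: nth_append)
      next
        case 2
        then show ?thesis using ij(3) n by (simp add: nth_append)
      next
        case 3
        then show ?thesis using ij(3) False by (simp add: nth_append)
      qed
    qed
    \<comment> \<open>New representatives are appended at the end, which keeps the prescribed first
      entry; it will be the trivial representation, as \<open>complete_irreps\<close>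
      demands.\<close>
    then show ?thesis using ys x rep_iso_refl[OF irreducible_rep_representation[OF x]]
      by (intro exI[of _ "ys @ [x]"]) auto
  qed
qed

text \<open>Every irreducible is a constituent of the regular representation, which has finitely
  many constituents up to isomorphism. This justifies the choice made in
  \<open>irreps\<close>.\<close>

lemma complete_irreps_irreps: "complete_irreps G (irreps G)"
proof -
  obtain xs where xs: "\<forall>\<sigma> \<in> set xs. irreducible_rep G \<sigma>"
    "\<forall>\<sigma>. irreducible_rep G \<sigma> \<longrightarrow> hom_nonzero \<sigma> regular_rep \<longrightarrow> (\<exists>\<tau> \<in> set xs. rep_iso G \<sigma> \<tau>)"
    using finitely_many_irreducible_constituents[OF regular_rep_representation(1)] by blast
  obtain ys where ys: "ys \<noteq> []" "hd ys = trivial_rep" "\<forall>\<sigma> \<in> set ys. irreducible_rep G \<sigma>"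
     "\<forall>i < length ys. \<forall>j < length ys. rep_iso G (ys ! i) (ys ! j) \<longrightarrow> i = j"
     "\<forall>\<sigma> \<in> set xs. \<exists>\<tau> \<in> set ys. rep_iso G \<sigma> \<tau>"
    using distinct_representatives[OF irreducible_trivial_rep xs(1)] by blast
  have "\<exists>\<tau> \<in> set ys. rep_iso G \<sigma> \<tau>" if \<sigma>: "irreducible_rep G \<sigma>" for \<sigma>
  proof -
    obtain \<mu> where \<mu>: "\<mu> \<in> set xs" "rep_iso G \<sigma> \<mu>" using xs(2) \<sigma> hom_nonzero_regular_rep by blast
    then obtain \<tau> where \<tau>: "\<tau> \<in> set ys" "rep_iso G \<mu> \<tau>" using ys(5) by blast
    then show ?thesis
      using rep_iso_trans[OF \<mu>(2) \<tau>(2)] \<sigma> xs(1) ys(3) \<mu> irreducible_rep_representation by blast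
  qed
  moreover have "rep_iso G (hd ys) trivial_rep" using ys(2) rep_iso_refl representation_trivial_rep by simp
  ultimately have "complete_irreps G ys" unfolding complete_irreps_def using ys by blast
  then show ?thesis unfolding irreps_def by (rule someI)
qed

end

subsection \<open>Characters and the McKay matrix\<close>

definition mat_elem :: "nat \<Rightarrow> nat \<Rightarrow> nat \<Rightarrow> nat \<Rightarrow> complex mat" where
  "mat_elem m n r s = mat m n (\<lambda>(i,j). if i = r \<and> j = s then 1 else 0)"

text \<open>Sandwiching a matrix unit isolates a product of two single coefficients, so averaging
  matrix units yields the sums in Schur orthogonality.\<close>

lemma index_mult_mat_elem_mult:
  assumes A: "A \<in> carrier_mat k m" and B: "B \<in> carrier_mat n l" and "r < m" "s < n" "a < k" "b < l"
  shows "(A * (mat_elem m n r s * B)) $$ (a,b) = A $$ (a,r) * B $$ (s,b)"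
proof -
  have EB: "(mat_elem m n r s * B) $$ (i,b) = (if i = r then B $$ (s,b) else 0)" if "i < m" for i
  proof -
    have "(mat_elem m n r s * B) $$ (i,b) = (\<Sum>j\<in>{0..<n}. (if i = r \<and> j = s then 1 else 0) * B $$ (j,b))"
      using assms that by (auto simp: mat_elem_def scalar_prod_def)
    also have "\<dots> = (\<Sum>j\<in>{0..<n}. if j = s then (if i = r then B $$ (s,b) else 0) else 0)"
      by (rule sum.cong) auto
    finally show ?thesis using assms by simp
  qed
  have "(A * (mat_elem m n r s * B)) $$ (a,b) = (\<Sum>i\<in>{0..<m}. A $$ (a,i) * (mat_elem m n r s * B) $$ (i,b))"
    using assms by (auto simp: mat_elem_def scalar_prod_def)
  also have "\<dots> = (\<Sum>i\<in>{0..<m}. if i = r then A $$ (a,r) * B $$ (s,b) else 0)"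
    by (rule sum.cong) (auto simp: EB)
  finally show ?thesis using assms by simp
qed

lemma mat_trace_mat_elem: "r < n \<Longrightarrow> s < n \<Longrightarrow> mat_trace (mat_elem n n r s) = (if r = s then 1 else 0)"
proof -
  assume "r < n" "s < n"
  have "mat_trace (mat_elem n n r s) = (\<Sum>i\<in>{0..<n}. if i = r then (if r = s then 1 else 0) else 0)"
    by (auto simp: mat_trace_def mat_elem_def intro!: sum.cong)
  then show ?thesis using \<open>r < n\<close> by simp
qed

text \<open>The index list behind the direct sum in \<open>mckay_matrix\<close>, with
  \<open>m\<close> a row of the matrix. Indices, unlike representations, can be sorted and
  counted.\<close>

definition block_list :: "(nat \<Rightarrow> nat) \<Rightarrow> nat \<Rightarrow> nat list" where
  "block_list m r = concat (map (\<lambda>j. replicate (m j) j) [0..<r])"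

lemma block_list_Suc: "block_list m (Suc r) = block_list m r @ replicate (m r) r"
  by (simp add: block_list_def)

lemma set_block_list: "set (block_list m r) \<subseteq> {..<r}"
  by (auto simp: block_list_def split: if_splits)

lemma sorted_block_list: "sorted (block_list m r)"
proof (induction r)
  case 0
  then show ?case by (simp add: block_list_def)
next
  case (Suc r)
  then show ?case using set_block_list[of m r] by (auto simp: block_list_Suc sorted_append)
qed

lemma count_block_list: "count (mset (block_list m r)) j = (if j < r then m j else 0)"
  by (induction r) (auto simp: block_list_Suc, simp add: block_list_def)

lemma sum_list_block_list:
  fixes f :: "nat \<Rightarrow> 'c :: comm_semiring_1"
  shows "(\<Sum>j\<leftarrow>block_list m r. f j) = (\<Sum>j<r. of_nat (m j) * f j)"
  by (induction r) (auto simp: block_list_Suc sum_list_replicate, simp add: block_list_def)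

text \<open>Both lists are sorted and have the same multiset of entries.\<close>

lemma sorted_eq_block_list:
  assumes "sorted js" and "set js \<subseteq> {..<r}"
  shows "js = block_list (count (mset js)) r"
proof -
  have "mset (block_list (count (mset js)) r) = mset js"
  proof (rule multiset_eqI)
    fix x
    show "count (mset (block_list (count (mset js)) r)) x = count (mset js) x"
      using assms(2) by (auto simp: count_block_list count_eq_zero_iff)
  qed
  then show ?thesis
    using assms(1) sorted_block_list by (metis properties_for_sort)
qed

section \<open>Schur orthogonality and characters\<close>

context finite_group
begin

lemma schur_orthogonality_noniso:
  assumes \<rho>: "irreducible_rep G \<rho>" and \<sigma>: "irreducible_rep G \<sigma>" and n: "\<not> rep_iso G \<rho> \<sigma>"
    and i: "a < deg \<sigma>" "r < deg \<sigma>" "s < deg \<rho>" "b < deg \<rho>"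
  shows "(\<Sum>g\<in>carrier G. \<sigma> g $$ (a,r) * \<rho> (inv g) $$ (s,b)) = 0"
proof -
  note r\<rho> = irreducible_rep_representation[OF \<rho>] and r\<sigma> = irreducible_rep_representation[OF \<sigma>]
  define T where "T = mat_sum (deg \<sigma>) (deg \<rho>) (\<lambda>g. \<sigma> g * (mat_elem (deg \<sigma>) (deg \<rho>) r s * \<rho> (inv g))) (carrier G)"
  have "intertwiner \<rho> \<sigma> T"
    unfolding T_def by (rule average_intertwiner[OF r\<rho> r\<sigma>]) (simp add: mat_elem_def)
  then have "T = 0\<^sub>m (deg \<sigma>) (deg \<rho>)" using n schur_iso[OF \<rho> \<sigma>] hom_nonzeroI by blast
  then have "T $$ (a,b) = 0" using i by simp
  moreover have "T $$ (a,b) = (\<Sum>g\<in>carrier G. \<sigma> g $$ (a,r) * \<rho> (inv g) $$ (s,b))"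
    unfolding T_def index_mat_sum[OF i(1,4)]
    by (rule sum.cong[OF refl], rule index_mult_mat_elem_mult[OF rep_carrier[OF r\<sigma>] rep_carrier[OF r\<rho>]])
      (use i in auto)
  ultimately show ?thesis by simp
qed

text \<open>The average of a matrix unit is a scalar matrix by Schur's lemma. Each summand has the
  trace of the unit, so comparing traces determines the scalar.\<close>

lemma schur_orthogonality:
  assumes \<sigma>: "irreducible_rep G \<sigma>"
    and i: "a < deg \<sigma>" "r < deg \<sigma>" "s < deg \<sigma>" "b < deg \<sigma>"
  shows "(\<Sum>g\<in>carrier G. \<sigma> g $$ (a,r) * \<sigma> (inv g) $$ (s,b)) =
           (if r = s \<and> a = b then of_nat (card (carrier G)) / of_nat (deg \<sigma>) else 0)"
proof -
  note r\<sigma> = irreducible_rep_representation[OF \<sigma>]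
  let ?n = "deg \<sigma>"
  let ?E = "mat_elem ?n ?n r s"
  have Ec: "?E \<in> carrier_mat ?n ?n" by (simp add: mat_elem_def)
  define T where "T = mat_sum ?n ?n (\<lambda>g. \<sigma> g * (?E * \<sigma> (inv g))) (carrier G)"
  have "intertwiner \<sigma> \<sigma> T" unfolding T_def by (rule average_intertwiner[OF r\<sigma> r\<sigma> Ec])
  then obtain c where c: "T = c \<cdot>\<^sub>m 1\<^sub>m ?n" using schur_scalar[OF \<sigma>] by blast
  have "mat_trace T = (\<Sum>g\<in>carrier G. mat_trace (\<sigma> g * (?E * \<sigma> (inv g))))"
    unfolding T_def
  proof (rule mat_trace_mat_sum)
    fix g assume g: "g \<in> carrier G"
    show "\<sigma> g * (?E * \<sigma> (inv g)) \<in> carrier_mat ?n ?n"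
      using rep_carrier[OF r\<sigma> g] rep_carrier[OF r\<sigma> inv_closed[OF g]] Ec by simp
  qed
  also have "\<dots> = (\<Sum>g\<in>carrier G. if r = s then 1 else 0)"
  proof (rule sum.cong[OF refl])
    fix g assume g: "g \<in> carrier G"
    note rc = rep_carrier[OF r\<sigma> g] rep_carrier[OF r\<sigma> inv_closed[OF g]]
    have "mat_trace (\<sigma> g * (?E * \<sigma> (inv g))) = mat_trace (?E * \<sigma> (inv g) * \<sigma> g)"
      by (rule mat_trace_mult_comm) (use rc Ec in auto)
    also have "?E * \<sigma> (inv g) * \<sigma> g = ?E * (\<sigma> (inv g) * \<sigma> g)" using rc Ec by (intro mat_assoc) auto
    also have "\<dots> = ?E" using Ec rep_inv[OF r\<sigma> g] by simp
    also have "mat_trace ?E = (if r = s then 1 else 0)" by (rule mat_trace_mat_elem[OF i(2,3)])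
    finally show "mat_trace (\<sigma> g * (?E * \<sigma> (inv g))) = (if r = s then 1 else 0)" .
  qed
  finally have "mat_trace T = (if r = s then of_nat (card (carrier G)) else 0)" by simp
  moreover have "mat_trace T = c * of_nat ?n" unfolding c using mat_trace_smult[OF one_carrier_mat] by simp
  ultimately have "c = (if r = s then of_nat (card (carrier G)) / of_nat ?n else 0)"
    using irreducible_deg_pos[OF \<sigma>] by (auto simp: field_simps)
  then have "T $$ (a,b) = (if r = s \<and> a = b then of_nat (card (carrier G)) / of_nat ?n else 0)"
    unfolding c using i by simp
  moreover have "T $$ (a,b) = (\<Sum>g\<in>carrier G. \<sigma> g $$ (a,r) * \<sigma> (inv g) $$ (s,b))"
    unfolding T_def index_mat_sum[OF i(1,4)]
    by (rule sum.cong[OF refl], rule index_mult_mat_elem_mult[OF rep_carrier[OF r\<sigma>] rep_carrier[OF r\<sigma>]])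
      (use i in auto)
  ultimately show ?thesis by simp
qed

text \<open>The inner product of characters, with the conjugate of the second character written as
  its value at \<open>inv g\<close>.\<close>

definition char_prod :: "('a \<Rightarrow> complex mat) \<Rightarrow> ('a \<Rightarrow> complex mat) \<Rightarrow> complex" where
  "char_prod \<tau> \<sigma> = (\<Sum>g\<in>carrier G. mat_trace (\<tau> g) * mat_trace (\<sigma> (inv g))) / of_nat (card (carrier G))"

lemma char_prod_expand:
  assumes "representation G \<tau>" "representation G \<sigma>"
  shows "char_prod \<tau> \<sigma> = (\<Sum>a\<in>{0..<deg \<tau>}. \<Sum>b\<in>{0..<deg \<sigma>}.
     \<Sum>g\<in>carrier G. \<tau> g $$ (a,a) * \<sigma> (inv g) $$ (b,b)) / of_nat (card (carrier G))"
proof -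
  have "(\<Sum>g\<in>carrier G. mat_trace (\<tau> g) * mat_trace (\<sigma> (inv g))) =
    (\<Sum>g\<in>carrier G. \<Sum>a\<in>{0..<deg \<tau>}. \<Sum>b\<in>{0..<deg \<sigma>}. \<tau> g $$ (a,a) * \<sigma> (inv g) $$ (b,b))"
    using rep_dim[OF assms(1)] rep_dim[OF assms(2)]
    by (intro sum.cong) (auto simp: mat_trace_def sum_product)
  also have "\<dots> = (\<Sum>a\<in>{0..<deg \<tau>}. \<Sum>g\<in>carrier G. \<Sum>b\<in>{0..<deg \<sigma>}. \<tau> g $$ (a,a) * \<sigma> (inv g) $$ (b,b))"
    by (rule sum.swap)
  also have "\<dots> = (\<Sum>a\<in>{0..<deg \<tau>}. \<Sum>b\<in>{0..<deg \<sigma>}. \<Sum>g\<in>carrier G. \<tau> g $$ (a,a) * \<sigma> (inv g) $$ (b,b))"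
    by (intro sum.cong refl sum.swap)
  finally show ?thesis unfolding char_prod_def by simp
qed

lemma char_prod_noniso:
  assumes \<rho>: "irreducible_rep G \<rho>" and \<sigma>: "irreducible_rep G \<sigma>" and n: "\<not> rep_iso G \<rho> \<sigma>"
  shows "char_prod \<sigma> \<rho> = 0"
  unfolding char_prod_expand[OF assms(2,1)[THEN irreducible_rep_representation]]
  using schur_orthogonality_noniso[OF assms] by simp

lemma char_prod_self:
  assumes \<sigma>: "irreducible_rep G \<sigma>"
  shows "char_prod \<sigma> \<sigma> = 1"
proof -
  let ?N = "of_nat (card (carrier G)) :: complex"
  have "(\<Sum>a\<in>{0..<deg \<sigma>}. \<Sum>b\<in>{0..<deg \<sigma>}. \<Sum>g\<in>carrier G. \<sigma> g $$ (a,a) * \<sigma> (inv g) $$ (b,b)) =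
        (\<Sum>a\<in>{0..<deg \<sigma>}. \<Sum>b\<in>{0..<deg \<sigma>}. if b = a then ?N / of_nat (deg \<sigma>) else 0)"
    using schur_orthogonality[OF \<sigma>] by (intro sum.cong) auto
  also have "\<dots> = ?N" using irreducible_deg_pos[OF \<sigma>] by simp
  finally show ?thesis
    unfolding char_prod_expand[OF assms[THEN irreducible_rep_representation] assms[THEN irreducible_rep_representation]]
    using card_carrier_pos by simp
qed

lemma char_prod_iso:
  assumes "rep_iso G \<tau> \<tau>'" and r: "representation G \<tau>" "representation G \<tau>'"
  shows "char_prod \<tau> \<sigma> = char_prod \<tau>' \<sigma>"
  unfolding char_prod_def using rep_iso_mat_trace[OF assms] by simp

lemma char_prod_direct_sum:
  assumes rs: "\<forall>\<sigma> \<in> set \<sigma>s. representation G \<sigma>"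
  shows "char_prod (direct_sum_rep \<sigma>s) \<mu> = (\<Sum>\<sigma>\<leftarrow>\<sigma>s. char_prod \<sigma> \<mu>)"
proof -
  have "(\<Sum>g\<in>carrier G. (\<Sum>\<sigma>\<leftarrow>\<sigma>s. mat_trace (\<sigma> g)) * mat_trace (\<mu> (inv g))) =
        (\<Sum>\<sigma>\<leftarrow>\<sigma>s. \<Sum>g\<in>carrier G. mat_trace (\<sigma> g) * mat_trace (\<mu> (inv g)))"
    by (induction \<sigma>s) (simp_all add: distrib_right sum.distrib)
  then have "(\<Sum>g\<in>carrier G. mat_trace (direct_sum_rep \<sigma>s g) * mat_trace (\<mu> (inv g))) =
        (\<Sum>\<sigma>\<leftarrow>\<sigma>s. \<Sum>g\<in>carrier G. mat_trace (\<sigma> g) * mat_trace (\<mu> (inv g)))"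
    using mat_trace_direct_sum_rep[OF rs] by simp
  moreover have "(\<Sum>\<sigma>\<leftarrow>\<sigma>s. f \<sigma>) / c = (\<Sum>\<sigma>\<leftarrow>\<sigma>s. f \<sigma> / c)" for f :: "('a \<Rightarrow> complex mat) \<Rightarrow> complex" and c
    by (induction \<sigma>s) (simp_all add: add_divide_distrib)
  ultimately show ?thesis unfolding char_prod_def by simp
qed

section \<open>Tensor products\<close>

lemma tensor_rep_representation:
  assumes r: "representation G \<rho>" "representation G \<sigma>"
  shows "representation G (tensor_rep \<rho> \<sigma>)" and "deg (tensor_rep \<rho> \<sigma>) = deg \<rho> * deg \<sigma>"
proof (rule_tac [!] representationI)
  fix g assume g: "g \<in> carrier G"
  show "tensor_rep \<rho> \<sigma> g \<in> carrier_mat (deg \<rho> * deg \<sigma>) (deg \<rho> * deg \<sigma>)"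
    unfolding tensor_rep_def using rep_carrier[OF r(1) g] rep_carrier[OF r(2) g] by (rule kronecker_carrier)
  then show "tensor_rep \<rho> \<sigma> g \<in> carrier_mat (deg \<rho> * deg \<sigma>) (deg \<rho> * deg \<sigma>)" .
  fix h assume h: "h \<in> carrier G"
  show "tensor_rep \<rho> \<sigma> (g \<otimes> h) = tensor_rep \<rho> \<sigma> g * tensor_rep \<rho> \<sigma> h"
    unfolding tensor_rep_def rep_mult[OF r(1) g h] rep_mult[OF r(2) g h]
    using rep_carrier[OF r(1) g] rep_carrier[OF r(2) g] rep_carrier[OF r(1) h] rep_carrier[OF r(2) h]
    by (rule kronecker_mult[symmetric])
  then show "tensor_rep \<rho> \<sigma> (g \<otimes> h) = tensor_rep \<rho> \<sigma> g * tensor_rep \<rho> \<sigma> h" .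
next
  show "tensor_rep \<rho> \<sigma> \<one> = 1\<^sub>m (deg \<rho> * deg \<sigma>)"
    unfolding tensor_rep_def rep_one[OF r(1)] rep_one[OF r(2)] by (rule kronecker_one)
  then show "tensor_rep \<rho> \<sigma> \<one> = 1\<^sub>m (deg \<rho> * deg \<sigma>)" .
qed

lemma mat_trace_tensor_rep:
  assumes r: "representation G \<rho>" "representation G \<sigma>" and g: "g \<in> carrier G"
  shows "mat_trace (tensor_rep \<rho> \<sigma> g) = mat_trace (\<rho> g) * mat_trace (\<sigma> g)"
  unfolding tensor_rep_def using rep_carrier[OF r(1) g] rep_carrier[OF r(2) g] by (rule mat_trace_kronecker)

section \<open>The chosen irreducibles and the McKay matrix\<close>

abbreviation irr :: "nat \<Rightarrow> 'a \<Rightarrow> complex mat" where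
  "irr i \<equiv> irreps G ! i"

abbreviation num_irr :: nat where
  "num_irr \<equiv> length (irreps G)"

lemma num_irr_pos: "0 < num_irr"
  using complete_irreps_irreps by (simp add: complete_irreps_def)

lemma deg_irr_0: "deg (irr 0) = 1"
proof -
  have "rep_iso G (irr 0) trivial_rep"
    using complete_irreps_irreps num_irr_pos unfolding complete_irreps_def by (simp flip: hd_conv_nth)
  then show ?thesis using rep_iso_deg representation_trivial_rep(2) by metis
qed

lemma irreducible_irr: "i < num_irr \<Longrightarrow> irreducible_rep G (irr i)"
  using complete_irreps_irreps by (simp add: complete_irreps_def)

lemma representation_irr: "i < num_irr \<Longrightarrow> representation G (irr i)"
  using irreducible_irr irreducible_rep_representation by blast

lemma deg_irr_pos: "i < num_irr \<Longrightarrow> 0 < deg (irr i)"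
  using irreducible_irr irreducible_deg_pos by blast

lemma irr_noniso: "i < num_irr \<Longrightarrow> j < num_irr \<Longrightarrow> i \<noteq> j \<Longrightarrow> \<not> rep_iso G (irr i) (irr j)"
  using complete_irreps_irreps by (auto simp: complete_irreps_def)

lemma covers_irreps_irreps: "covers_irreps (irreps G)"
  using complete_irreps_irreps by (auto simp: complete_irreps_def covers_irreps_def)

lemma char_prod_irr:
  assumes "i < num_irr" "j < num_irr"
  shows "char_prod (irr i) (irr j) = (if i = j then 1 else 0)"
proof (cases "i = j")
  case True
  then show ?thesis using char_prod_self[OF irreducible_irr[OF assms(1)]] by simp
next
  case False
  then show ?thesis
    using char_prod_noniso[OF irreducible_irr[OF assms(2)] irreducible_irr[OF assms(1)]] irr_noniso[OF assms(2,1)] by simp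
qed

lemma representation_map_irr:
  "set js \<subseteq> {..<num_irr} \<Longrightarrow> \<forall>\<sigma> \<in> set (map irr js). representation G \<sigma>"
  using representation_irr by auto

text \<open>Multiplicities are recovered from the character, which is the source of uniqueness of
  the McKay matrix.\<close>

lemma char_prod_block_list:
  assumes j: "j < num_irr"
  shows "char_prod (direct_sum_rep (map irr (block_list m num_irr))) (irr j) = of_nat (m j)"
proof -
  have "char_prod (direct_sum_rep (map irr (block_list m num_irr))) (irr j) =
      (\<Sum>k\<leftarrow>block_list m num_irr. char_prod (irr k) (irr j))"
    using char_prod_direct_sum[OF representation_map_irr[OF set_block_list]] by (simp add: o_def)
  also have "\<dots> = (\<Sum>k<num_irr. of_nat (m k) * char_prod (irr k) (irr j))" by (rule sum_list_block_list)
  also have "\<dots> = (\<Sum>k<num_irr. if k = j then of_nat (m j) else 0)"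
    using j by (intro sum.cong) (auto simp: char_prod_irr)
  finally show ?thesis using j by simp
qed

lemma decomposition_block_list:
  assumes "representation G \<tau>"
  shows "\<exists>m. rep_iso G \<tau> (direct_sum_rep (map irr (block_list m num_irr)))"
proof -
  obtain js where js: "sorted js" "set js \<subseteq> {..<num_irr}" "rep_iso G \<tau> (direct_sum_rep (map irr js))"
    using decomposition[OF covers_irreps_irreps assms] by blast
  then show ?thesis using sorted_eq_block_list[OF js(1,2)] by metis
qed

definition mckay_cond :: "('a \<Rightarrow> complex mat) \<Rightarrow> nat mat \<Rightarrow> bool" where
  "mckay_cond \<rho> A \<longleftrightarrow> A \<in> carrier_mat num_irr num_irr \<and>
     (\<forall>i < num_irr. rep_iso G (tensor_rep \<rho> (irr i))
        (direct_sum_rep (map irr (block_list (\<lambda>j. A $$ (i, j)) num_irr))))"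

lemma mckay_matrix_eq: "mckay_matrix G \<rho> = (THE A. mckay_cond \<rho> A)"
  by (simp add: mckay_matrix_def mckay_cond_def block_list_def Let_def map_concat o_def)

lemma mckay_cond_entry:
  assumes \<rho>: "representation G \<rho>" and A: "mckay_cond \<rho> A" and ij: "i < num_irr" "j < num_irr"
  shows "of_nat (A $$ (i,j)) = char_prod (tensor_rep \<rho> (irr i)) (irr j)"
proof -
  have "char_prod (tensor_rep \<rho> (irr i)) (irr j) =
      char_prod (direct_sum_rep (map irr (block_list (\<lambda>j. A $$ (i, j)) num_irr))) (irr j)"
    using A ij(1) unfolding mckay_cond_def
    by (intro char_prod_iso tensor_rep_representation(1)[OF \<rho> representation_irr[OF ij(1)]]
        representation_direct_sum_rep representation_map_irr set_block_list) auto
  also have "\<dots> = of_nat (A $$ (i,j))" by (rule char_prod_block_list[OF ij(2)])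
  finally show ?thesis ..
qed

text \<open>Justifies the definite description: each row exists by complete reducibility, and each
  entry is forced because it is a product of characters.\<close>

lemma mckay_cond_mckay_matrix:
  assumes \<rho>: "representation G \<rho>"
  shows "mckay_cond \<rho> (mckay_matrix G \<rho>)"
proof -
  have "\<forall>i. \<exists>m. i < num_irr \<longrightarrow> rep_iso G (tensor_rep \<rho> (irr i)) (direct_sum_rep (map irr (block_list m num_irr)))"
    using decomposition_block_list tensor_rep_representation(1)[OF \<rho> representation_irr] by blast
  then obtain m where m: "\<And>i. i < num_irr \<Longrightarrow>
      rep_iso G (tensor_rep \<rho> (irr i)) (direct_sum_rep (map irr (block_list (m i) num_irr)))" by metis
  define A where "A = mat num_irr num_irr (\<lambda>(i,j). m i j)"
  have "block_list (\<lambda>j. A $$ (i,j)) num_irr = block_list (m i) num_irr" if "i < num_irr" for i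
    unfolding block_list_def using that by (intro arg_cong[of _ _ concat] map_cong) (auto simp: A_def)
  then have A: "mckay_cond \<rho> A" unfolding mckay_cond_def using m by (auto simp: A_def)
  moreover have "B = A" if B: "mckay_cond \<rho> B" for B
  proof (rule eq_matI)
    fix i j assume ij: "i < dim_row A" "j < dim_col A"
    then have ij: "i < num_irr" "j < num_irr" by (auto simp: A_def)
    have "(of_nat (B $$ (i,j)) :: complex) = of_nat (A $$ (i,j))"
      unfolding mckay_cond_entry[OF \<rho> A ij] mckay_cond_entry[OF \<rho> B ij] ..
    then show "B $$ (i,j) = A $$ (i,j)" by simp
  qed (use A B in \<open>auto simp: mckay_cond_def\<close>)
  ultimately show ?thesis unfolding mckay_matrix_eq by (rule theI)
qed

lemmas mckay_matrix_entry = mckay_cond_entry[OF _ mckay_cond_mckay_matrix]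

lemma mckay_matrix_row_sum:
  assumes \<rho>: "representation G \<rho>" and i: "i < num_irr"
  shows "(\<Sum>j<num_irr. mckay_matrix G \<rho> $$ (i,j) * deg (irr j)) = deg \<rho> * deg (irr i)"
proof -
  let ?js = "block_list (\<lambda>j. mckay_matrix G \<rho> $$ (i, j)) num_irr"
  have "deg \<rho> * deg (irr i) = deg (direct_sum_rep (map irr ?js))"
    using mckay_cond_mckay_matrix[OF \<rho>] i rep_iso_deg tensor_rep_representation(2)[OF \<rho> representation_irr[OF i]]
    unfolding mckay_cond_def by metis
  also have "\<dots> = (\<Sum>j\<leftarrow>?js. deg (irr j))"
    using deg_direct_sum_rep[OF representation_map_irr[OF set_block_list]] by (simp add: o_def)
  finally show ?thesis by (simp add: sum_list_block_list)
qed

text \<open>Only the term at \<one> survives in the product of characters; there the regular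
  character contributes the group order, which cancels, and the other two factors are
  degrees.\<close>

lemma mckay_matrix_regular_rep:
  assumes ij: "i < num_irr" "j < num_irr"
  shows "mckay_matrix G regular_rep $$ (i,j) = deg (irr i) * deg (irr j)"
proof -
  note r = representation_irr[OF ij(1)] representation_irr[OF ij(2)]
  let ?N = "of_nat (card (carrier G)) :: complex"
  have "(of_nat (mckay_matrix G regular_rep $$ (i,j)) :: complex) = char_prod (tensor_rep regular_rep (irr i)) (irr j)"
    by (rule mckay_matrix_entry[OF regular_rep_representation(1) regular_rep_representation(1) ij])
  also have "\<dots> = (\<Sum>g\<in>carrier G. if g = \<one> then ?N * of_nat (deg (irr i)) * of_nat (deg (irr j)) else 0) / ?N"
    unfolding char_prod_def
    by (intro arg_cong2[of _ _ _ _ "(/)"] sum.cong refl)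
      (auto simp: mat_trace_tensor_rep[OF regular_rep_representation(1) r(1)] mat_trace_regular_rep
         mat_trace_one_rep[OF r(1)] mat_trace_one_rep[OF r(2)])
  also have "\<dots> = of_nat (deg (irr i) * deg (irr j))" using fin card_carrier_pos by simp
  finally show ?thesis by (simp only: of_nat_eq_iff)
qed

end

subsection \<open>Quivers and positive eigenvectors\<close>

text \<open>Here \<open>c\<close> is the least ratio \<open>d i / e i\<close>, attained at
  \<open>k\<close>, so \<open>c * e\<close> lies below \<open>d\<close> and touches it at
  \<open>k\<close>. Applying row \<open>k\<close> of the nonnegative matrix to both compares the
  eigenvalues.\<close>

lemma positive_eigenvector_le:
  fixes A :: "nat \<Rightarrow> nat \<Rightarrow> nat" and d e :: "nat \<Rightarrow> nat"
  assumes r: "0 < r"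
    and d: "\<And>i. i < r \<Longrightarrow> (\<Sum>j<r. A i j * d j) = n * d i" "\<And>i. i < r \<Longrightarrow> 0 < d i"
    and e: "\<And>i. i < r \<Longrightarrow> (\<Sum>j<r. A i j * e j) = m * e i" "\<And>i. i < r \<Longrightarrow> 0 < e i"
  obtains c :: real and k where "k < r" "real (d k) = c * real (e k)" "\<And>i. i < r \<Longrightarrow> c * real (e i) \<le> real (d i)" "m \<le> n"
proof -
  define c where "c = Min ((\<lambda>i. real (d i) / real (e i)) ` {..<r})"
  have "c \<in> (\<lambda>i. real (d i) / real (e i)) ` {..<r}"
    unfolding c_def using r by (intro Min_in) auto
  then obtain k where k: "k < r" "c = real (d k) / real (e k)" by auto
  have eq: "real (d k) = c * real (e k)" using k e(2)[OF k(1)] by simp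
  have le: "c * real (e i) \<le> real (d i)" if "i < r" for i
  proof -
    have "c \<le> real (d i) / real (e i)" unfolding c_def using that by (intro Min_le) auto
    then show ?thesis using e(2)[OF that] by (simp add: pos_le_divide_eq)
  qed
  have "real m * real (d k) = c * (real m * real (e k))" by (simp add: eq)
  also have "real m * real (e k) = (\<Sum>j<r. real (A k j) * real (e j))"
    using e(1)[OF k(1)] by (simp flip: of_nat_mult of_nat_sum)
  also have "c * \<dots> = (\<Sum>j<r. real (A k j) * (c * real (e j)))" by (simp add: sum_distrib_left mult_ac)
  also have "\<dots> \<le> (\<Sum>j<r. real (A k j) * real (d j))" using le by (intro sum_mono mult_left_mono) auto
  also have "\<dots> = real n * real (d k)" using d(1)[OF k(1)] by (simp flip: of_nat_mult of_nat_sum)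
  finally have "m \<le> n" using d(2)[OF k(1)] by simp
  with k(1) eq le show thesis using that by blast
qed

text \<open>Used in both directions, the previous lemma shows \<open>m = n\<close>. Then
  \<open>d - c * e\<close> is a nonnegative solution of the eigenvalue equation with a zero at
  \<open>k\<close>. At a zero the equation is a vanishing sum of nonnegative terms, so zeros spread
  along arrows, and by connectedness to all indices.\<close>

lemma positive_eigenvector_unique:
  fixes A :: "nat \<Rightarrow> nat \<Rightarrow> nat" and d e :: "nat \<Rightarrow> nat"
  assumes conn: "\<And>i j. i < r \<Longrightarrow> j < r \<Longrightarrow> (i,j) \<in> {(i,j). i < r \<and> j < r \<and> 0 < A i j}\<^sup>*"
    and d: "\<And>i. i < r \<Longrightarrow> (\<Sum>j<r. A i j * d j) = n * d i" "\<And>i. i < r \<Longrightarrow> 0 < d i" "k1 < r" "d k1 = 1"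
    and e: "\<And>i. i < r \<Longrightarrow> (\<Sum>j<r. A i j * e j) = m * e i" "\<And>i. i < r \<Longrightarrow> 0 < e i" "k2 < r" "e k2 = 1"
    and i: "i < r"
  shows "d i = e i"
proof -
  have r: "0 < r" using i by simp
  obtain c k where k: "k < r" and eq: "real (d k) = c * real (e k)"
    and le: "\<And>i. i < r \<Longrightarrow> c * real (e i) \<le> real (d i)" and mn: "m \<le> n"
    using positive_eigenvector_le[OF r d(1,2) e(1,2)] by blast
  have nm: "n \<le> m" using positive_eigenvector_le[OF r e(1,2) d(1,2)] by blast
  define v where "v i = real (d i) - c * real (e i)" for i
  have v_step: "v q = 0" if "v p = 0" "p < r" "q < r" "0 < A p q" for p q
  proof -
    have "(\<Sum>j<r. real (A p j) * v j) = real (\<Sum>j<r. A p j * d j) - c * real (\<Sum>j<r. A p j * e j)"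
      by (simp add: v_def right_diff_distrib sum_subtractf sum_distrib_left mult_ac)
    also have "\<dots> = real n * v p" using d(1) e(1) that(2) mn nm by (simp add: v_def right_diff_distrib)
    finally have "(\<Sum>j<r. real (A p j) * v j) = 0" using that by simp
    then have "\<forall>j\<in>{..<r}. real (A p j) * v j = 0"
      by (subst (asm) sum_nonneg_eq_0_iff) (use le in \<open>auto simp: v_def\<close>)
    then have "real (A p q) * v q = 0" using that(3) by blast
    then show ?thesis using that(4) by simp
  qed
  have v0: "v q = 0" if "q < r" for q
    using conn[OF k that]
  proof (induction rule: rtrancl_induct)
    case base
    show ?case using eq by (simp add: v_def)
  next
    case (step y z)
    then show ?case using v_step[of y z] by simp
  qed
  have dc: "real (d q) = c * real (e q)" if "q < r" for q using v0[OF that] by (simp add: v_def)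
  \<comment> \<open>The entries 1 may sit at different indices: at \<open>k2\<close> proportionality
    gives \<open>c = d k2\<close>, which is at least 1, while at \<open>k1\<close> it gives
    \<open>1 = c * e k1\<close>, which is at least \<open>c\<close>.\<close>
  have "1 \<le> c" using dc[OF e(3)] e(4) d(2)[OF e(3)] by simp
  moreover have "c \<le> 1"
  proof -
    have "1 = c * real (e k1)" using dc[OF d(3)] d(4) by simp
    moreover have "c * 1 \<le> c * real (e k1)" using e(2)[OF d(3)] \<open>1 \<le> c\<close> by (intro mult_left_mono) auto
    ultimately show ?thesis by simp
  qed
  ultimately show ?thesis using dc[OF i] by simp
qed

section \<open>Quiver isomorphisms\<close>

definition arc_count :: "('v, 'e) pre_digraph \<Rightarrow> 'v \<Rightarrow> 'v \<Rightarrow> nat" where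
  "arc_count D u v = card {a \<in> arcs D. tail D a = u \<and> head D a = v}"

text \<open>Passes from a quiver isomorphism to equality of McKay matrices up to a relabelling of
  the indices.\<close>

lemma digraph_iso_arc_count:
  assumes "digraph_iso D H"
  shows "\<exists>f. bij_betw f (verts D) (verts H) \<and>
    (\<forall>u \<in> verts D. \<forall>v \<in> verts D. arc_count D u v = arc_count H (f u) (f v))"
proof -
  obtain h where h: "pre_digraph.digraph_isomorphism D h" and H: "H = app_iso h D"
    using assms unfolding digraph_iso_def by blast
  have wf: "wf_digraph D" and iv: "inj_on (iso_verts h) (verts D)" and ia: "inj_on (iso_arcs h) (arcs D)"
    and th: "\<And>a. a \<in> arcs D \<Longrightarrow> iso_tail h (iso_arcs h a) = iso_verts h (tail D a) \<and>
         iso_head h (iso_arcs h a) = iso_verts h (head D a)"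
    using h unfolding pre_digraph.digraph_isomorphism_def by auto
  have "arc_count D u v = arc_count H (iso_verts h u) (iso_verts h v)" if uv: "u \<in> verts D" "v \<in> verts D" for u v
  proof -
    let ?S = "{a \<in> arcs D. tail D a = u \<and> head D a = v}"
    have "{a \<in> arcs H. tail H a = iso_verts h u \<and> head H a = iso_verts h v} = iso_arcs h ` ?S"
    proof (intro equalityI subsetI)
      fix b assume "b \<in> {a \<in> arcs H. tail H a = iso_verts h u \<and> head H a = iso_verts h v}"
      then obtain a where a: "a \<in> arcs D" "b = iso_arcs h a" "iso_verts h (tail D a) = iso_verts h u"
        "iso_verts h (head D a) = iso_verts h v" unfolding H using th by auto
      \<comment> \<open>\<open>iso_verts h\<close> is injective on the vertices only, so the ends of
        the arc must be known to be vertices.\<close>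
      moreover have "tail D a \<in> verts D" "head D a \<in> verts D" using wf a(1) by (auto simp: wf_digraph_def)
      ultimately have "tail D a = u" "head D a = v" using iv uv by (auto dest: inj_onD)
      then show "b \<in> iso_arcs h ` ?S" using a by auto
    qed (auto simp: H th)
    moreover have "card (iso_arcs h ` ?S) = card ?S" using ia by (intro card_image inj_on_subset[OF ia]) auto
    ultimately show ?thesis by (simp add: arc_count_def)
  qed
  moreover have "bij_betw (iso_verts h) (verts D) (verts H)" using iv H by (auto simp: bij_betw_def)
  ultimately show ?thesis by blast
qed

lemma arc_count_mckay_quiver:
  assumes "i < length (irreps G)" "j < length (irreps G)"
  shows "arc_count (mckay_quiver G \<rho>) i j = mckay_matrix G \<rho> $$ (i,j)"
proof -
  have "{a \<in> arcs (mckay_quiver G \<rho>). tail (mckay_quiver G \<rho>) a = i \<and> head (mckay_quiver G \<rho>) a = j} =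
      (\<lambda>k. (i,j,k)) ` {..<mckay_matrix G \<rho> $$ (i,j)}"
    using assms by (auto simp: mckay_quiver_def Let_def)
  moreover have "card ((\<lambda>k. (i,j,k)) ` {..<mckay_matrix G \<rho> $$ (i,j)}) = mckay_matrix G \<rho> $$ (i,j)"
    by (subst card_image) (auto simp: inj_on_def)
  ultimately show ?thesis by (simp add: arc_count_def)
qed

lemma verts_mckay_quiver: "verts (mckay_quiver G \<rho>) = {..<length (irreps G)}"
  by (simp add: mckay_quiver_def Let_def)

lemma digraph_iso_mckay_quiverI:
  assumes f: "bij_betw f {..<length (irreps G)} {..<length (irreps H)}"
    and eq: "\<And>i j. i < length (irreps G) \<Longrightarrow> j < length (irreps G) \<Longrightarrow>
       mckay_matrix G \<rho> $$ (i,j) = mckay_matrix H \<sigma> $$ (f i, f j)"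
  shows "digraph_iso (mckay_quiver G \<rho>) (mckay_quiver H \<sigma>)"
  unfolding digraph_iso_def
proof (intro exI conjI)
  \<comment> \<open>An arrow keeps its number \<open>k\<close>. The fields \<open>iso_head\<close>
    and \<open>iso_tail\<close> describe the ends of arrows in the target, hence are plain
    projections.\<close>
  let ?h = "\<lparr> iso_verts = f, iso_arcs = (\<lambda>(i,j,k). (f i, f j, k)), iso_head = (\<lambda>(i,j,k). j), iso_tail = (\<lambda>(i,j,k). i) \<rparr>
     :: (nat, nat \<times> nat \<times> nat, nat, nat \<times> nat \<times> nat) digraph_isomorphism"
  have inj: "f i = f j \<longleftrightarrow> i = j" if "i < length (irreps G)" "j < length (irreps G)" for i j
    using f that unfolding bij_betw_def inj_on_def by auto
  have im: "f ` {..<length (irreps G)} = {..<length (irreps H)}" using f by (simp add: bij_betw_def)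
  have lt: "f i < length (irreps H)" if "i < length (irreps G)" for i using im that by auto
  show "pre_digraph.digraph_isomorphism (mckay_quiver G \<rho>) ?h"
    unfolding pre_digraph.digraph_isomorphism_def wf_digraph_def
    by (auto simp: mckay_quiver_def Let_def inj_on_def inj)
  have "(\<lambda>(i,j,k). (f i, f j, k)) ` {(i,j,k). i < length (irreps G) \<and> j < length (irreps G) \<and> k < mckay_matrix G \<rho> $$ (i,j)} =
     {(i,j,k). i < length (irreps H) \<and> j < length (irreps H) \<and> k < mckay_matrix H \<sigma> $$ (i,j)}" (is "?F ` ?S = ?T")
  proof (intro equalityI subsetI)
    fix x assume "x \<in> ?F ` ?S"
    then obtain i j k where "x = (f i, f j, k)" "i < length (irreps G)" "j < length (irreps G)"
      "k < mckay_matrix G \<rho> $$ (i,j)" by auto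
    then show "x \<in> ?T" using lt eq[of i j] by simp
  next
    fix x assume "x \<in> ?T"
    then obtain i j k where x: "x = (i,j,k)" "i < length (irreps H)" "j < length (irreps H)" "k < mckay_matrix H \<sigma> $$ (i,j)" by auto
    have "i \<in> f ` {..<length (irreps G)}" "j \<in> f ` {..<length (irreps G)}" unfolding im using x by auto
    then obtain i' j' where ij: "i' < length (irreps G)" "j' < length (irreps G)" "i = f i'" "j = f j'" by auto
    then have "(i',j',k) \<in> ?S" using x(4) eq[OF ij(1,2)] by simp
    moreover have "x = ?F (i',j',k)" using x(1) ij by simp
    ultimately show "x \<in> ?F ` ?S" by blast
  qed
  then show "mckay_quiver H \<sigma> = app_iso ?h (mckay_quiver G \<rho>)"
    unfolding mckay_quiver_def Let_def app_iso_def by (simp add: im)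
qed

lemma mset_eq_bij_betw:
  assumes f: "bij_betw f {..<length xs} {..<length ys}" and eq: "\<And>i. i < length xs \<Longrightarrow> xs ! i = ys ! f i"
  shows "mset xs = mset ys"
proof -
  have m: "mset zs = image_mset ((!) zs) (mset_set {..<length zs})" for zs :: "'b list"
    by (metis atLeast0LessThan map_nth mset_map mset_upt)
  have "mset xs = image_mset (\<lambda>i. ys ! f i) (mset_set {..<length xs})"
    unfolding m[of xs] by (rule image_mset_cong) (simp add: eq)
  also have "\<dots> = image_mset ((!) ys) (image_mset f (mset_set {..<length xs}))"
    by (simp add: multiset.map_comp o_def)
  also have "image_mset f (mset_set {..<length xs}) = mset_set {..<length ys}"
    using f by (simp add: bij_betw_def image_mset_mset_set)
  finally show ?thesis by (simp flip: m)
qed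

lemma irrep_degrees_mset: "irrep_degrees G = mset (map (rep_degree G) (irreps G))"
  by (simp add: irrep_degrees_def)

text \<open>This is \<open>T = Q D P\<close> written out entrywise. The coefficients come from
  \<open>P\<close> and \<open>Q\<close> alone, so for an isomorphism of representations they do not
  depend on the group element.\<close>

lemma index_similar:
  fixes T D P Q :: "complex mat"
  assumes T: "T \<in> carrier_mat n n" and D: "D \<in> carrier_mat m m" and P: "P \<in> carrier_mat m n"
    and Q: "Q \<in> carrier_mat n m" and QP: "Q * P = 1\<^sub>m n" and PT: "P * T = D * P" and xy: "x < n" "y < n"
  shows "T $$ (x,y) = (\<Sum>u\<in>{0..<m}. \<Sum>v\<in>{0..<m}. (Q $$ (x,u) * P $$ (v,y)) * D $$ (u,v))"
proof -
  have "T = Q * (D * P)" using mat_cancel_left[OF QP, of T] T P Q by (simp flip: PT)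
  then have "T $$ (x,y) = (\<Sum>u\<in>{0..<m}. Q $$ (x,u) * (\<Sum>v\<in>{0..<m}. D $$ (u,v) * P $$ (v,y)))"
    using assms by (simp add: scalar_prod_def)
  then show ?thesis by (simp add: sum_distrib_left mult_ac)
qed

section \<open>Strong connectivity of the McKay quiver\<close>

context finite_group
begin

text \<open>Products of coefficients of \<open>\<rho>\<close> and \<open>\<sigma>\<^sub>i\<close> are linear combinations of coefficients of those \<open>\<sigma>\<^sub>k\<close>
  with an arrow from \<open>i\<close> to \<open>k\<close>.\<close>

lemma mckay_step:
  assumes \<rho>: "representation G \<rho>" and i: "i < num_irr" and pq: "p < deg \<rho>" "q < deg \<rho>"
    and ab: "a < deg (irr i)" "b < deg (irr i)"
    and zero: "\<And>k s t. k < num_irr \<Longrightarrow> 0 < mckay_matrix G \<rho> $$ (i,k) \<Longrightarrow> s < deg (irr k) \<Longrightarrow> t < deg (irr k) \<Longrightarrow>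
        (\<Sum>g\<in>carrier G. irr k g $$ (s,t) * h g) = 0"
  shows "(\<Sum>g\<in>carrier G. \<rho> g $$ (p,q) * irr i g $$ (a,b) * h g) = 0"
proof -
  note ri = representation_irr[OF i]
  let ?T = "tensor_rep \<rho> (irr i)" and ?js = "block_list (\<lambda>j. mckay_matrix G \<rho> $$ (i, j)) num_irr"
  define D where "D = direct_sum_rep (map irr ?js)"
  have rs: "\<forall>\<sigma> \<in> set (map irr ?js). representation G \<sigma>" by (rule representation_map_irr[OF set_block_list])
  have rD: "representation G D" unfolding D_def by (rule representation_direct_sum_rep[OF rs])
  note rT = tensor_rep_representation[OF \<rho> ri]
  have "rep_iso G ?T D" using mckay_cond_mckay_matrix[OF \<rho>] i unfolding mckay_cond_def D_def by blast
  then obtain P Q where P: "intertwiner ?T D P" and Q: "Q \<in> carrier_mat (deg ?T) (deg D)"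
    and QP: "Q * P = 1\<^sub>m (deg ?T)" unfolding rep_iso_iff by blast
  \<comment> \<open>The positions of the pairs \<open>(p, a)\<close> and \<open>(q, b)\<close> in
    the Kronecker product.\<close>
  define x where "x = p * deg (irr i) + a"
  define y where "y = q * deg (irr i) + b"
  have lt: "u * n + c < l * n" if "u < l" "c < n" for u c n l :: nat
  proof -
    have "u * n + c < Suc u * n" using that by simp
    also have "\<dots> \<le> l * n" using that by (intro mult_le_mono1) simp
    finally show ?thesis .
  qed
  have xy: "x < deg ?T" "y < deg ?T" unfolding x_def y_def rT(2) using pq ab by (auto intro: lt)
  have T: "\<rho> g $$ (p,q) * irr i g $$ (a,b) = (\<Sum>u\<in>{0..<deg D}. \<Sum>v\<in>{0..<deg D}. (Q $$ (x,u) * P $$ (v,y)) * D g $$ (u,v))"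
    if g: "g \<in> carrier G" for g
  proof -
    have "\<rho> g $$ (p,q) * irr i g $$ (a,b) = ?T g $$ (x,y)"
      unfolding tensor_rep_def x_def y_def
      using index_kronecker[OF rep_carrier[OF \<rho> g] rep_carrier[OF ri g] pq ab] by simp
    also have "\<dots> = (\<Sum>u\<in>{0..<deg D}. \<Sum>v\<in>{0..<deg D}. (Q $$ (x,u) * P $$ (v,y)) * D g $$ (u,v))"
      by (rule index_similar[OF rep_carrier[OF rT(1) g] rep_carrier[OF rD g] intertwiner_carrier[OF P] Q QP
            intertwinerD[OF P g] xy])
    finally show ?thesis .
  qed
  have D0: "(\<Sum>g\<in>carrier G. D g $$ (u,v) * h g) = 0" if uv: "u < deg D" "v < deg D" for u v
  proof -
    consider "\<forall>g\<in>carrier G. D g $$ (u,v) = 0" | \<sigma> s t where "\<sigma> \<in> set (map irr ?js)" "s < deg \<sigma>" "t < deg \<sigma>"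
      "\<forall>g\<in>carrier G. D g $$ (u,v) = \<sigma> g $$ (s,t)"
      using direct_sum_rep_entry[OF rs, folded D_def, OF uv] by blast
    then show ?thesis
    proof cases
      case 1
      then show ?thesis by simp
    next
      case 2
      then obtain k where k: "k \<in> set ?js" "\<sigma> = irr k" by auto
      then have "k < num_irr" "0 < mckay_matrix G \<rho> $$ (i,k)"
        by (auto simp: block_list_def split: if_splits)
      then have "(\<Sum>g\<in>carrier G. \<sigma> g $$ (s,t) * h g) = 0" using zero 2(2,3) unfolding k(2) by blast
      then show ?thesis using 2(4) by simp
    qed
  qed
  have "(\<Sum>g\<in>carrier G. \<rho> g $$ (p,q) * irr i g $$ (a,b) * h g) =
      (\<Sum>g\<in>carrier G. \<Sum>u\<in>{0..<deg D}. \<Sum>v\<in>{0..<deg D}. (Q $$ (x,u) * P $$ (v,y)) * (D g $$ (u,v) * h g))"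
    by (intro sum.cong refl) (simp add: T sum_distrib_right mult.assoc)
  also have "\<dots> = (\<Sum>u\<in>{0..<deg D}. \<Sum>g\<in>carrier G. \<Sum>v\<in>{0..<deg D}. (Q $$ (x,u) * P $$ (v,y)) * (D g $$ (u,v) * h g))"
    by (rule sum.swap)
  also have "\<dots> = (\<Sum>u\<in>{0..<deg D}. \<Sum>v\<in>{0..<deg D}. \<Sum>g\<in>carrier G. (Q $$ (x,u) * P $$ (v,y)) * (D g $$ (u,v) * h g))"
    by (intro sum.cong refl sum.swap)
  also have "\<dots> = (\<Sum>u\<in>{0..<deg D}. \<Sum>v\<in>{0..<deg D}. (Q $$ (x,u) * P $$ (v,y)) * (\<Sum>g\<in>carrier G. D g $$ (u,v) * h g))"
    by (simp add: sum_distrib_left)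
  also have "\<dots> = 0" by (simp add: D0)
  finally show ?thesis .
qed

lemma mckay_strongly_connected:
  assumes f: "faithful_rep G \<rho>" and ij: "i < num_irr" "j < num_irr"
  shows "(i,j) \<in> {(i,j). i < num_irr \<and> j < num_irr \<and> 0 < mckay_matrix G \<rho> $$ (i,j)}\<^sup>*"
proof (rule ccontr)
  let ?E = "{(i,j). i < num_irr \<and> j < num_irr \<and> 0 < mckay_matrix G \<rho> $$ (i,j)}"
  assume n: "(i,j) \<notin> ?E\<^sup>*"
  have \<rho>: "representation G \<rho>" and inj: "inj_on \<rho> (carrier G)" using f by (auto simp: faithful_rep_def)
  \<comment> \<open>Quantifying over all \<open>k\<close> reachable from \<open>i\<close> makes the
    property stable under multiplication by coefficients of \<rho>, since \<open>mckay_step\<close>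
    passes from \<open>k\<close> to its successors. The constant 1 is good because \<open>j\<close>
    is not among these \<open>k\<close>.\<close>
  define good where "good f \<longleftrightarrow> (\<forall>k a b c d. k < num_irr \<longrightarrow> (i,k) \<in> ?E\<^sup>* \<longrightarrow> a < deg (irr k) \<longrightarrow> b < deg (irr k) \<longrightarrow>
      c < deg (irr j) \<longrightarrow> d < deg (irr j) \<longrightarrow>
      (\<Sum>g\<in>carrier G. irr k g $$ (a,b) * (f g * irr j (inv g) $$ (c,d))) = 0)" for f :: "'a \<Rightarrow> complex"
  have good_1: "good (\<lambda>_. 1)"
    unfolding good_def
  proof (intro allI impI)
    fix k a b c d
    assume k: "k < num_irr" "(i,k) \<in> ?E\<^sup>*" and l: "a < deg (irr k)" "b < deg (irr k)" "c < deg (irr j)" "d < deg (irr j)"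
    have "j \<noteq> k" using k n by auto
    then show "(\<Sum>g\<in>carrier G. irr k g $$ (a,b) * (1 * irr j (inv g) $$ (c,d))) = 0"
      using schur_orthogonality_noniso[OF irreducible_irr[OF ij(2)] irreducible_irr[OF k(1)] irr_noniso[OF ij(2) k(1)] l]
      by simp
  qed
  have good_lin: "good (\<lambda>g. \<alpha> * f g + \<beta> * f' g)" if "good f" "good f'" for f f' \<alpha> \<beta>
    unfolding good_def
  proof (intro allI impI)
    fix k a b c d
    assume k: "k < num_irr" "(i,k) \<in> ?E\<^sup>*" and l: "a < deg (irr k)" "b < deg (irr k)" "c < deg (irr j)" "d < deg (irr j)"
    have "(\<Sum>g\<in>carrier G. irr k g $$ (a,b) * ((\<alpha> * f g + \<beta> * f' g) * irr j (inv g) $$ (c,d))) =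
       \<alpha> * (\<Sum>g\<in>carrier G. irr k g $$ (a,b) * (f g * irr j (inv g) $$ (c,d))) +
       \<beta> * (\<Sum>g\<in>carrier G. irr k g $$ (a,b) * (f' g * irr j (inv g) $$ (c,d)))"
      unfolding sum_distrib_left sum.distrib[symmetric] by (intro sum.cong refl) (simp add: algebra_simps)
    moreover have "(\<Sum>g\<in>carrier G. irr k g $$ (a,b) * (f g * irr j (inv g) $$ (c,d))) = 0"
      "(\<Sum>g\<in>carrier G. irr k g $$ (a,b) * (f' g * irr j (inv g) $$ (c,d))) = 0"
      using that k l unfolding good_def by blast+
    ultimately show "(\<Sum>g\<in>carrier G. irr k g $$ (a,b) * ((\<alpha> * f g + \<beta> * f' g) * irr j (inv g) $$ (c,d))) = 0"
      by simp
  qed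
  have good_\<rho>: "good (\<lambda>g. \<rho> g $$ (p,q) * f g)" if gf: "good f" and pq: "p < deg \<rho>" "q < deg \<rho>" for f p q
    unfolding good_def
  proof (intro allI impI)
    fix k a b c d
    assume k: "k < num_irr" "(i,k) \<in> ?E\<^sup>*" and l: "a < deg (irr k)" "b < deg (irr k)" "c < deg (irr j)" "d < deg (irr j)"
    have "(\<Sum>g\<in>carrier G. \<rho> g $$ (p,q) * irr k g $$ (a,b) * (f g * irr j (inv g) $$ (c,d))) = 0"
    proof (rule mckay_step[OF \<rho> k(1) pq l(1,2)])
      fix k' s t
      assume k': "k' < num_irr" "0 < mckay_matrix G \<rho> $$ (k,k')" and st: "s < deg (irr k')" "t < deg (irr k')"
      have "(i,k') \<in> ?E\<^sup>*" using k k' by (auto intro: rtrancl_into_rtrancl)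
      then show "(\<Sum>g\<in>carrier G. irr k' g $$ (s,t) * (f g * irr j (inv g) $$ (c,d))) = 0"
        using gf k' st l unfolding good_def by blast
    qed
    then show "(\<Sum>g\<in>carrier G. irr k g $$ (a,b) * (\<rho> g $$ (p,q) * f g * irr j (inv g) $$ (c,d))) = 0"
      by (simp add: mult_ac)
  qed
  \<comment> \<open>Interpolation, one point at a time: for each new \<open>x\<close> a good
    function is multiplied by a factor that is affine in one coefficient of \<rho>, vanishes at
    \<open>x\<close> and equals 1 at \<one>. Faithfulness supplies a coefficient that separates
    \<open>x\<close> from \<one>.\<close>
  have "\<exists>f. good f \<and> f \<one> = 1 \<and> (\<forall>g\<in>S. f g = 0)" if "finite S" "S \<subseteq> carrier G - {\<one>}" for S
    using that
  proof (induction S rule: finite_induct)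
    case empty
    then show ?case using good_1 by (intro exI[of _ "\<lambda>_. 1"]) simp
  next
    case (insert x S)
    then obtain f where f: "good f" "f \<one> = 1" "\<forall>g\<in>S. f g = 0" by blast
    have x: "x \<in> carrier G" "x \<noteq> \<one>" using insert.prems by auto
    then have "\<rho> x \<noteq> \<rho> \<one>" using inj_onD[OF inj _ x(1) one_closed] by blast
    have "\<exists>p q. p < deg \<rho> \<and> q < deg \<rho> \<and> \<rho> \<one> $$ (p,q) \<noteq> \<rho> x $$ (p,q)"
    proof (rule ccontr)
      assume "\<not> ?thesis"
      then have "\<rho> x = \<rho> \<one>"
        using rep_dim[OF \<rho> x(1)] rep_dim[OF \<rho> one_closed] by (intro eq_matI) auto
      with \<open>\<rho> x \<noteq> \<rho> \<one>\<close> show False ..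
    qed
    then obtain p q where pq: "p < deg \<rho>" "q < deg \<rho>" "\<rho> \<one> $$ (p,q) \<noteq> \<rho> x $$ (p,q)" by blast
    define \<alpha> where "\<alpha> = 1 / (\<rho> \<one> $$ (p,q) - \<rho> x $$ (p,q))"
    let ?f = "\<lambda>g. \<alpha> * (\<rho> g $$ (p,q) * f g) + (- \<alpha> * \<rho> x $$ (p,q)) * f g"
    have "good ?f" by (rule good_lin[OF good_\<rho>[OF f(1) pq(1,2)] f(1)])
    moreover have "?f \<one> = 1"
    proof -
      have "?f \<one> = \<alpha> * (\<rho> \<one> $$ (p,q) - \<rho> x $$ (p,q))" using f(2) by (simp add: algebra_simps)
      then show ?thesis unfolding \<alpha>_def using pq(3) by simp
    qed
    moreover have "\<forall>g\<in>insert x S. ?f g = 0" using f(3) by auto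
    ultimately show ?case by blast
  qed
  from this[of "carrier G - {\<one>}"] obtain f where f: "good f" "f \<one> = 1" "\<And>g. g \<in> carrier G \<Longrightarrow> g \<noteq> \<one> \<Longrightarrow> f g = 0"
    using fin by auto
  note d = deg_irr_pos[OF ij(1)] deg_irr_pos[OF ij(2)]
  \<comment> \<open>For the indicator of \<one> the sum reduces to a product of diagonal entries of
    two identity matrices, hence to 1; but it should vanish, as \<open>i\<close> is reachable from
    itself.\<close>
  have "(\<Sum>g\<in>carrier G. irr i g $$ (0,0) * (f g * irr j (inv g) $$ (0,0))) =
      (\<Sum>g\<in>carrier G. if g = \<one> then irr i \<one> $$ (0,0) * irr j \<one> $$ (0,0) else 0)"
    using f by (intro sum.cong) auto
  also have "\<dots> = 1"
    using fin d by (simp add: rep_one[OF representation_irr[OF ij(1)]] rep_one[OF representation_irr[OF ij(2)]])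
  finally show False using f(1) ij d unfolding good_def by simp
qed

end

section \<open>The equivalence\<close>

theorem proposition5p5:
  fixes G1 :: "('a, 'm) monoid_scheme" and G2 :: "('b, 'n) monoid_scheme"
  assumes "group G1" and "finite (carrier G1)"
    and "group G2" and "finite (carrier G2)"
  shows "(\<exists>\<rho>1 \<rho>2. faithful_rep G1 \<rho>1 \<and> faithful_rep G2 \<rho>2 \<and>
             digraph_iso (mckay_quiver G1 \<rho>1) (mckay_quiver G2 \<rho>2))
         \<longleftrightarrow> irrep_degrees G1 = irrep_degrees G2"
proof
  interpret G1: finite_group G1 using assms by (intro finite_group.intro finite_group_axioms.intro)
  interpret G2: finite_group G2 using assms by (intro finite_group.intro finite_group_axioms.intro)
  {
    assume "\<exists>\<rho>1 \<rho>2. faithful_rep G1 \<rho>1 \<and> faithful_rep G2 \<rho>2 \<and>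
             digraph_iso (mckay_quiver G1 \<rho>1) (mckay_quiver G2 \<rho>2)"
    then obtain \<rho>1 \<rho>2 where \<rho>: "faithful_rep G1 \<rho>1" "faithful_rep G2 \<rho>2"
      and iso: "digraph_iso (mckay_quiver G1 \<rho>1) (mckay_quiver G2 \<rho>2)" by blast
    have r: "representation G1 \<rho>1" "representation G2 \<rho>2" using \<rho> by (auto simp: faithful_rep_def)
    let ?r = "length (irreps G1)"
    let ?A = "\<lambda>i j. mckay_matrix G1 \<rho>1 $$ (i,j)"
    obtain f where f: "bij_betw f {..<?r} {..<length (irreps G2)}"
      and fc: "\<forall>u\<in>{..<?r}. \<forall>v\<in>{..<?r}. arc_count (mckay_quiver G1 \<rho>1) u v = arc_count (mckay_quiver G2 \<rho>2) (f u) (f v)"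
      using digraph_iso_arc_count[OF iso] unfolding verts_mckay_quiver by blast
    have flt: "f i < length (irreps G2)" if "i < ?r" for i using bij_betwE[OF f] that by auto
    have A: "?A i j = mckay_matrix G2 \<rho>2 $$ (f i, f j)" if "i < ?r" "j < ?r" for i j
      using fc that by (simp add: arc_count_mckay_quiver flt)
    \<comment> \<open>Pulled back along \<open>f\<close>, the degrees for \<open>G2\<close> are a
      second positive eigenvector of the matrix of \<open>G1\<close>, with eigenvalue the degree of
      \<open>\<rho>2\<close>.\<close>
    have e: "(\<Sum>j<?r. ?A i j * G2.deg (G2.irr (f j))) = G2.deg \<rho>2 * G2.deg (G2.irr (f i))" if i: "i < ?r" for i
    proof -
      have "(\<Sum>j<?r. ?A i j * G2.deg (G2.irr (f j))) =
          (\<Sum>j<?r. mckay_matrix G2 \<rho>2 $$ (f i, f j) * G2.deg (G2.irr (f j)))"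
        using A i by (intro sum.cong) auto
      also have "\<dots> = (\<Sum>j<length (irreps G2). mckay_matrix G2 \<rho>2 $$ (f i, j) * G2.deg (G2.irr j))"
        by (rule sum.reindex_bij_betw[OF f])
      finally show ?thesis using G2.mckay_matrix_row_sum[OF r(2) flt[OF i]] by simp
    qed
    \<comment> \<open>The vertex that \<open>f\<close> sends to the trivial representation of
      \<open>G2\<close>; there the second eigenvector has the entry 1.\<close>
    obtain k where k: "k < ?r" "f k = 0"
      using f G2.num_irr_pos unfolding bij_betw_def by (metis imageE lessThan_iff)
    have "G1.deg (G1.irr i) = G2.deg (G2.irr (f i))" if "i < ?r" for i
      by (rule positive_eigenvector_unique[where A = ?A and r = ?r])
        (use G1.mckay_strongly_connected[OF \<rho>(1)] G1.mckay_matrix_row_sum[OF r(1)] G1.deg_irr_pos e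
          G2.deg_irr_pos flt k that G1.num_irr_pos G1.deg_irr_0 G2.deg_irr_0 in auto)
    then show "irrep_degrees G1 = irrep_degrees G2"
      unfolding irrep_degrees_mset using f flt by (intro mset_eq_bij_betw[of f]) auto
  next
    assume "irrep_degrees G1 = irrep_degrees G2"
    then obtain f where f: "bij_betw f {..<length (irreps G1)} {..<length (irreps G2)}"
      and d: "\<And>i. i < length (irreps G1) \<Longrightarrow> map (rep_degree G1) (irreps G1) ! i = map (rep_degree G2) (irreps G2) ! f i"
      unfolding irrep_degrees_mset using permutation_Ex_bij by (metis length_map)
    have flt: "f i < length (irreps G2)" if "i < length (irreps G1)" for i using bij_betwE[OF f] that by auto
    \<comment> \<open>The entries are products of degrees, so every degree-preserving bijection of
      the irreducibles is an isomorphism of these quivers.\<close>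
    have "digraph_iso (mckay_quiver G1 G1.regular_rep) (mckay_quiver G2 G2.regular_rep)"
    proof (rule digraph_iso_mckay_quiverI[OF f])
      fix i j assume "i < length (irreps G1)" "j < length (irreps G1)"
      then show "mckay_matrix G1 G1.regular_rep $$ (i,j) = mckay_matrix G2 G2.regular_rep $$ (f i, f j)"
        using d flt by (simp add: G1.mckay_matrix_regular_rep G2.mckay_matrix_regular_rep)
    qed
    then show "\<exists>\<rho>1 \<rho>2. faithful_rep G1 \<rho>1 \<and> faithful_rep G2 \<rho>2 \<and>
             digraph_iso (mckay_quiver G1 \<rho>1) (mckay_quiver G2 \<rho>2)"
      using G1.faithful_regular_rep G2.faithful_regular_rep by blast
  }
qed

end
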